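(* Let $K/\mathbb{Q}_p$ be a field extension of degree $d$ and ramification degree $e$. Let $A$ denote the ring of integers of $K$, let $\pi$ denote a uniformizer for $A$, let $k$ denote the residue field of $A$, and let $q$ be the cardinality of $k$. Let $n$ be a positive integer and let $\omega$ denote a $\frac{q^{en}-1}{q^n-1}$th root of (the image in $k$ of) $\frac{\pi^e}{p}$ in $\overline{k}$. Then $\mathrm{Aut}({}_\omega\mathbb{G}^A_{1/n}\otimes_k\overline{k})$ is a closed subgroup of the height $dn$ Morava stabilizer group $\mathrm{Aut}({}_1\mathbb{G}^{\hat{\mathbb{Z}}_p}_{1/dn}\otimes_{\mathbb{F}_p}\overline{k})$.
   Context: A (one-dimensional) formal $A$-module over a commutative $A$-algebra $R$ is a one-dimensional formal group law $F$ over $R$ with a ring map $A\to\mathrm{End}(F)$, $a\mapsto[a]$, such that $[a](x)\equiv ax\bmod x^2$. The classifying ring of $A$-typical formal $A$-modules is $V^A\cong A[v_1^A,v_2^A,\dots]$ with Hazewinkel's generators: the universal $A$-typical formal $A$-module has logarithm $\sum_{i\ge0}\ell_ix^{q^i}$ with $\ell_0=1$ and $\pi\ell_h=\sum_{i=0}^{h-1}\ell_i(v^A_{h-i})^{q^i}$ (for $A=\hat{\mathbb{Z}}_p$, use $\pi=p$, $q=p$). For a field extension $k'$ of $k$ and $\alpha\in(k')^\times$, ${}_\alpha\mathbb{G}^A_{1/n}$ is the formal $A$-module over $k'$ classified by the map $V^A\to k'$ sending $v^A_n$ to $\alpha$ and $v^A_i$ to $0$ for $i\ne n$. Under the hypothesis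 on $\omega$, the underlying formal $\hat{\mathbb{Z}}_p$-module (formal group law) of ${}_\omega\mathbb{G}^A_{1/n}$ is ${}_1\mathbb{G}^{\hat{\mathbb{Z}}_p}_{1/dn}$ (a known fact). The notation ${}_\omega\mathbb{G}^A_{1/n}\otimes_k\overline{k}$ means base change to $\overline{k}$. $\mathrm{Aut}$ denotes the group of (not necessarily strict) automorphisms: of a formal $A$-module on the left, i.e. automorphisms of the formal group law commuting with the action of $A$, and of a formal group law on the right. The Morava stabilizer group $\mathrm{Aut}({}_1\mathbb{G}^{\hat{\mathbb{Z}}_p}_{1/dn}\otimes_{\mathbb{F}_p}\overline{k})$ carries its usual profinite topology, as the inverse limit over $a$ of the groups obtained by truncating automorphism power series (automorphisms of the underlying formal group law $a$-buds). *)

theory Defs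
  imports
    "HOL-Analysis.Analysis"
    "HOL-Algebra.Group"
    "HOL-Computational_Algebra.Computational_Algebra"
    "HOL-Library.Poly_Mapping"
    "Berlekamp_Zassenhaus.Finite_Field"
begin

section \<open>The $p$-adic numbers\<close>

text \<open>
  The prime $p$ is the cardinality of a type \<open>'p\<close> of class \<open>prime_card\<close>. The ring of $p$-adic
  integers is the inverse limit of the rings $\mathbb{Z}/p^n$, an element of which is represented by
  its residue in $\{0,\dots,p^n-1\}$.
\<close>

typedef (overloaded) ('p::prime_card) padic_int =
  "{x :: nat \<Rightarrow> int. \<forall>n. x n \<in> {0..<int CARD('p) ^ n} \<and> x (Suc n) mod int CARD('p) ^ n = x n}"
proof -
  have "int CARD('p) > 0"
    using prime_card_int[where 'a = 'p] by (simp add: prime_gt_0_int)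
  then show ?thesis by (intro exI[of _ "\<lambda>_. 0"]) simp
qed

setup_lifting type_definition_padic_int

lemma card_pos_int: "int CARD('p::prime_card) > 0"
  using prime_card_int[where 'a = 'p] by (simp add: prime_gt_0_int)

lemma mod_power_Suc_mod: "(a mod b ^ Suc n) mod b ^ n = a mod (b::int) ^ n"
  by (metis le_imp_power_dvd lessI less_imp_le_nat mod_mod_cancel)

lemma coherent_modI:
  assumes "\<And>n. f (Suc n) mod int CARD('p::prime_card) ^ n = f n mod int CARD('p) ^ n"
  shows "f n mod int CARD('p) ^ n \<in> {0..<int CARD('p) ^ n} \<and>
         (f (Suc n) mod int CARD('p) ^ Suc n) mod int CARD('p) ^ n = f n mod int CARD('p) ^ n"
  unfolding mod_power_Suc_mod using assms card_pos_int[where 'p = 'p] by simp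

instantiation padic_int :: (prime_card) comm_ring_1
begin

lift_definition zero_padic_int :: "'a padic_int" is "\<lambda>_. 0"
  using card_pos_int[where 'p = 'a] by simp

lift_definition one_padic_int :: "'a padic_int" is "\<lambda>n. 1 mod int CARD('a) ^ n"
  using coherent_modI[where 'p = 'a and f = "\<lambda>_. 1"] by simp

lift_definition plus_padic_int :: "'a padic_int \<Rightarrow> 'a padic_int \<Rightarrow> 'a padic_int"
  is "\<lambda>x y n. (x n + y n) mod int CARD('a) ^ n"
  subgoal for x y
    using coherent_modI[where 'p = 'a and f = "\<lambda>n. x n + y n"] by (metis (no_types, lifting) mod_add_eq)
  done

lift_definition uminus_padic_int :: "'a padic_int \<Rightarrow> 'a padic_int"
  is "\<lambda>x n. (- x n) mod int CARD('a) ^ n"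
  subgoal for x
    using coherent_modI[where 'p = 'a and f = "\<lambda>n. - x n"] by (metis (no_types, lifting) mod_minus_eq)
  done

definition minus_padic_int :: "'a padic_int \<Rightarrow> 'a padic_int \<Rightarrow> 'a padic_int"
  where "minus_padic_int x y = x + (- y)"

lift_definition times_padic_int :: "'a padic_int \<Rightarrow> 'a padic_int \<Rightarrow> 'a padic_int"
  is "\<lambda>x y n. (x n * y n) mod int CARD('a) ^ n"
  subgoal for x y
    using coherent_modI[where 'p = 'a and f = "\<lambda>n. x n * y n"] by (metis (no_types, lifting) mod_mult_eq)
  done

instance
proof
  fix a b c :: "'a padic_int"
  show "a * b * c = a * (b * c)"
    by transfer (simp add: fun_eq_iff mod_mult_left_eq mod_mult_right_eq mult.assoc)
  show "a * b = b * a" by transfer (simp add: mult.commute)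
  show "1 * a = a" by transfer (simp add: fun_eq_iff mod_mult_left_eq)
  show "a + b + c = a + (b + c)"
    by transfer (simp add: fun_eq_iff mod_add_left_eq mod_add_right_eq add.assoc)
  show "a + b = b + a" by transfer (simp add: add.commute)
  show "0 + a = a" by transfer (simp add: fun_eq_iff)
  show "- a + a = 0" by transfer (simp add: fun_eq_iff mod_add_left_eq)
  show "a - b = a + - b" by (simp add: minus_padic_int_def)
  show "(a + b) * c = a * c + b * c"
    by transfer (simp add: fun_eq_iff mod_mult_left_eq mod_add_eq distrib_right)
  show "(0 :: 'a padic_int) \<noteq> 1"
  proof (transfer, rule notI)
    assume eq: "(\<lambda>_. 0) = (\<lambda>n. 1 mod int CARD('a) ^ n)"
    have "int CARD('a) > 1" using prime_card_int[where 'a = 'a] by (rule prime_gt_1_int)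
    with fun_cong[OF eq, of 1] show False by simp
  qed
qed

end

instance padic_int :: (prime_card) idom
proof
  fix a b :: "'a padic_int"
  let ?p = "int CARD('a)"
  have pr: "prime ?p" by (rule prime_card_int)
  assume "a \<noteq> 0" "b \<noteq> 0"
  then show "a * b \<noteq> 0"
  proof transfer
    fix x y :: "nat \<Rightarrow> int"
    assume x: "\<forall>n. x n \<in> {0..<?p ^ n} \<and> x (Suc n) mod ?p ^ n = x n"
       and y: "\<forall>n. y n \<in> {0..<?p ^ n} \<and> y (Suc n) mod ?p ^ n = y n"
       and "x \<noteq> (\<lambda>_. 0)" "y \<noteq> (\<lambda>_. 0)"
    then obtain m k where m: "x m \<noteq> 0" and k: "y k \<noteq> 0" by (auto simp: fun_eq_iff)
    have coh: "z (n + j) mod ?p ^ n = z n"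
      if z: "\<forall>n. z n \<in> {0..<?p ^ n} \<and> z (Suc n) mod ?p ^ n = z n" for z n j
    proof (induction j)
      case 0
      then show ?case using z by simp
    next
      case (Suc j)
      have "z (n + Suc j) mod ?p ^ n = (z (Suc (n + j)) mod ?p ^ (n + j)) mod ?p ^ n"
        by (simp add: mod_mod_cancel le_imp_power_dvd)
      then show ?case using z Suc by simp
    qed
    let ?N = "m + k"
    have nx: "\<not> ?p ^ m dvd x ?N" using coh[OF x, of m k] m by auto
    have ny: "\<not> ?p ^ k dvd y ?N" using coh[OF y, of k m] k by (auto simp: add.commute)
    have x0: "x ?N \<noteq> 0" and y0: "y ?N \<noteq> 0" using nx ny by auto
    have "multiplicity ?p (x ?N) < m" "multiplicity ?p (y ?N) < k"
      using nx ny by (meson multiplicity_dvd' not_le)+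
    then have "multiplicity ?p (x ?N * y ?N) < ?N"
      using x0 y0 pr by (simp add: prime_elem_multiplicity_mult_distrib)
    then have "\<not> ?p ^ ?N dvd x ?N * y ?N"
      using x0 y0 pr by (subst power_dvd_iff_le_multiplicity) auto
    then have "x ?N * y ?N mod ?p ^ ?N \<noteq> 0" by (simp add: dvd_eq_mod_eq_0)
    then show "(\<lambda>n. x n * y n mod ?p ^ n) \<noteq> (\<lambda>_. 0)" by metis
  qed
qed

type_synonym 'p padic = "'p padic_int fract"

definition padic_integers :: "'p::prime_card padic set" where
  "padic_integers = range (\<lambda>a. Fract a 1)"


section \<open>Extensions of the field of $p$-adic numbers\<close>

text \<open>
  A field extension of $\mathbb{Q}_p$ is a field \<open>'K\<close> together with a homomorphism
  \<open>\<iota>\<close> from $\mathbb{Q}_p$. The dimension of an infinite-dimensional space is $0$ by convention, so it has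
  to be excluded.
\<close>

definition padic_extension_of_degree :: "('p::prime_card padic \<Rightarrow> 'K::field) \<Rightarrow> nat \<Rightarrow> bool" where
  "padic_extension_of_degree \<iota> d \<longleftrightarrow>
     field_hom \<iota> \<and> d > 0 \<and> vector_space.dim (\<lambda>a x. \<iota> a * x) (UNIV :: 'K set) = d"

definition ring_of_integers :: "('p::prime_card padic \<Rightarrow> 'K::field) \<Rightarrow> 'K set" where
  "ring_of_integers \<iota> =
     {x. \<exists>P. lead_coeff P = 1 \<and> (\<forall>i. Polynomial.coeff P i \<in> \<iota> ` padic_integers) \<and> poly P x = 0}"

definition principal_ideal :: "'K::comm_ring_1 set \<Rightarrow> 'K \<Rightarrow> 'K set" where
  "principal_ideal A x = (\<lambda>a. x * a) ` A"

text \<open>A uniformizer of a local domain \<open>A\<close> generates its maximal ideal, the set of non-units.\<close>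

definition uniformizer :: "'K::field set \<Rightarrow> 'K \<Rightarrow> bool" where
  "uniformizer A \<pi> \<longleftrightarrow> \<pi> \<in> A \<and> principal_ideal A \<pi> = {a \<in> A. \<not> (\<exists>b\<in>A. a * b = 1)}"

definition ramification_degree :: "'K::field set \<Rightarrow> nat \<Rightarrow> 'K \<Rightarrow> nat \<Rightarrow> bool" where
  "ramification_degree A p \<pi> e \<longleftrightarrow> principal_ideal A (of_nat p) = principal_ideal A (\<pi> ^ e)"

text \<open>
  The residue field $k = A/(\pi)$ is given together with an algebraic closure, as follows: \<open>red\<close> is
  the composite $A \to k \to \overline{k}$, where $\overline{k}$ is the field \<open>'L\<close>. So $k$ is (identified with)
  the subfield \<open>red ` A\<close> of \<open>'L\<close>, over which \<open>'L\<close> is required to be algebraic. The values of \<open>red\<close>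
  outside of \<open>A\<close> are irrelevant.
\<close>

definition residue_map :: "'K::field set \<Rightarrow> 'K \<Rightarrow> ('K \<Rightarrow> 'L::alg_closed_field) \<Rightarrow> bool" where
  "residue_map A \<pi> red \<longleftrightarrow>
     red 1 = 1 \<and>
     (\<forall>a\<in>A. \<forall>b\<in>A. red (a + b) = red a + red b \<and> red (a * b) = red a * red b) \<and>
     {a \<in> A. red a = 0} = principal_ideal A \<pi> \<and>
     (\<forall>x. \<exists>P. P \<noteq> 0 \<and> (\<forall>i. Polynomial.coeff P i \<in> red ` A) \<and> poly P x = 0)"


section \<open>Power series in two variables\<close>

text \<open>
  The coefficient of $x^i y^j$ in \<open>F :: 'r fps fps\<close> is \<open>F $ i $ j\<close>. The substitutions below are
  meant for series \<open>G\<close> and \<open>H\<close> without constant term. Then \<open>G ^ a * H ^ b\<close> has no terms of total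
  degree below \<open>a + b\<close>, so that the truncated sums are in fact the full ones.
\<close>

definition fps_x :: "'r::comm_ring_1 fps fps" where "fps_x = fps_X"

definition fps_y :: "'r::comm_ring_1 fps fps" where "fps_y = fps_const fps_X"

definition subst1 :: "'r::comm_ring_1 fps \<Rightarrow> 'r fps fps \<Rightarrow> 'r fps fps" where
  "subst1 f G = Abs_fps (\<lambda>i. Abs_fps (\<lambda>j. \<Sum>a\<le>i+j. f $ a * (G ^ a) $ i $ j))"

definition subst2 :: "'r::comm_ring_1 fps fps \<Rightarrow> 'r fps fps \<Rightarrow> 'r fps fps \<Rightarrow> 'r fps fps" where
  "subst2 F G H = Abs_fps (\<lambda>i. Abs_fps (\<lambda>j.
     \<Sum>a\<le>i+j. \<Sum>b\<le>i+j. F $ a $ b * (G ^ a * H ^ b) $ i $ j))"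

definition map_coeffs1 :: "('r \<Rightarrow> 's) \<Rightarrow> 'r fps \<Rightarrow> 's fps" where
  "map_coeffs1 \<phi> f = Abs_fps (\<lambda>i. \<phi> (f $ i))"

definition map_coeffs2 :: "('r \<Rightarrow> 's) \<Rightarrow> 'r fps fps \<Rightarrow> 's fps fps" where
  "map_coeffs2 \<phi> F = Abs_fps (\<lambda>i. Abs_fps (\<lambda>j. \<phi> (F $ i $ j)))"

text \<open>The compositional inverse of a series \<open>l\<close> with \<open>l $ 0 = 0\<close> and \<open>l $ 1 = 1\<close>. (The library's
  \<open>fps_inv\<close> is restricted to fields of coefficients.)\<close>

definition comp_inverse :: "'r::comm_ring_1 fps \<Rightarrow> 'r fps" where
  "comp_inverse l = (THE f. f $ 0 = 0 \<and> l oo f = fps_X)"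


section \<open>The universal $A$-typical formal $A$-module\<close>

text \<open>
  Polynomials over \<open>'K\<close> in variables indexed by \<open>nat\<close>. If \<open>'K\<close> is the fraction field of \<open>A\<close>, then
  $V^A = A[v_1, v_2, \dots]$ is the subring of all polynomials with coefficients in \<open>A\<close> in which the
  variable of index $0$ does not occur.
\<close>

type_synonym 'K vpoly = "(nat \<Rightarrow>\<^sub>0 nat) \<Rightarrow>\<^sub>0 'K"

definition vvar :: "nat \<Rightarrow> 'K::comm_ring_1 vpoly" where
  "vvar i = Poly_Mapping.single (Poly_Mapping.single i 1) 1"

definition vconst :: "'K::comm_ring_1 \<Rightarrow> 'K vpoly" where
  "vconst c = Poly_Mapping.single 0 c"

fun hazewinkel_ell :: "'K::field \<Rightarrow> nat \<Rightarrow> nat \<Rightarrow> 'K vpoly" where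
  "hazewinkel_ell \<pi> q h =
     (if h = 0 then 1
      else vconst (1 / \<pi>) * (\<Sum>i<h. hazewinkel_ell \<pi> q i * vvar (h - i) ^ (q ^ i)))"

declare hazewinkel_ell.simps [simp del]

text \<open>The logarithm $\sum_i \ell_i x^{q^i}$.\<close>

definition universal_log :: "'K::field \<Rightarrow> nat \<Rightarrow> 'K vpoly fps" where
  "universal_log \<pi> q = Abs_fps (\<lambda>m. \<Sum>i | q ^ i = m. hazewinkel_ell \<pi> q i)"

text \<open>
  The unique formal module with logarithm $l$ (over the $\mathbb{Q}$-algebra of polynomials over \<open>'K\<close>) has the formal group law $l^{-1}(l(x) + l(y))$ and the action
  $[a](x) = l^{-1}(a\, l(x))$. The coefficients of these series lie in $V^A$ (for $a \in A$).
\<close>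

definition universal_fgl :: "'K::field \<Rightarrow> nat \<Rightarrow> 'K vpoly fps fps" where
  "universal_fgl \<pi> q =
     (let l = universal_log \<pi> q in subst1 (comp_inverse l) (subst1 l fps_x + subst1 l fps_y))"

definition universal_action :: "'K::field \<Rightarrow> nat \<Rightarrow> 'K \<Rightarrow> 'K vpoly fps" where
  "universal_action \<pi> q a =
     (let l = universal_log \<pi> q in comp_inverse l oo (fps_const (vconst a) * l))"

text \<open>The ring homomorphism on $V^A$ which is \<open>red\<close> on \<open>A\<close> and sends $v_i$ to \<open>g i\<close>.\<close>

definition classifying_map :: "('K::field \<Rightarrow> 'L::field) \<Rightarrow> (nat \<Rightarrow> 'L) \<Rightarrow> 'K vpoly \<Rightarrow> 'L" where
  "classifying_map red g P =
     (\<Sum>m\<in>Poly_Mapping.keys P. red (Poly_Mapping.lookup P m) *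
        (\<Prod>i\<in>Poly_Mapping.keys m. g i ^ Poly_Mapping.lookup m i))"

text \<open>
  The formal module ${}_\alpha\mathbb{G}^A_{1/n}$ with coefficients in \<open>'L\<close>, consisting of a formal
  group law and an action of \<open>A\<close>. For $\alpha$ in a subfield $k'$ of \<open>'L\<close> containing $k$, this
  is the base change to \<open>'L\<close> of the formal module over $k'$, as base change amounts to composing the classifying
  map with the inclusion of $k'$.
\<close>

definition G_fgl :: "'K::field \<Rightarrow> nat \<Rightarrow> ('K \<Rightarrow> 'L::field) \<Rightarrow> nat \<Rightarrow> 'L \<Rightarrow> 'L fps fps" where
  "G_fgl \<pi> q red n \<alpha> =
     map_coeffs2 (classifying_map red (\<lambda>i. if i = n then \<alpha> else 0)) (universal_fgl \<pi> q)"

definition G_action :: "'K::field \<Rightarrow> nat \<Rightarrow> ('K \<Rightarrow> 'L::field) \<Rightarrow> nat \<Rightarrow> 'L \<Rightarrow> 'K \<Rightarrow> 'L fps" where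
  "G_action \<pi> q red n \<alpha> a =
     map_coeffs1 (classifying_map red (\<lambda>i. if i = n then \<alpha> else 0)) (universal_action \<pi> q a)"


section \<open>Automorphism groups\<close>

definition fgl_iso :: "'L::field fps fps \<Rightarrow> 'L fps fps \<Rightarrow> 'L fps \<Rightarrow> bool" where
  "fgl_iso F G f \<longleftrightarrow>
     f $ 0 = 0 \<and> f $ 1 \<noteq> 0 \<and> subst1 f F = subst2 G (subst1 f fps_x) (subst1 f fps_y)"

definition strict_fgl_iso :: "'L::field fps fps \<Rightarrow> 'L fps fps \<Rightarrow> 'L fps \<Rightarrow> bool" where
  "strict_fgl_iso F G f \<longleftrightarrow> fgl_iso F G f \<and> f $ 1 = 1"

definition fgl_aut :: "'L::field fps fps \<Rightarrow> 'L fps set" where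
  "fgl_aut F = {f. fgl_iso F F f}"

definition formal_module_aut :: "'K set \<Rightarrow> 'L::field fps fps \<Rightarrow> ('K \<Rightarrow> 'L fps) \<Rightarrow> 'L fps set" where
  "formal_module_aut A F act = {f \<in> fgl_aut F. \<forall>a\<in>A. f oo act a = act a oo f}"

definition fgl_aut_group :: "'L::field fps fps \<Rightarrow> 'L fps monoid" where
  "fgl_aut_group F = \<lparr>carrier = fgl_aut F, mult = (oo), one = fps_X\<rparr>"

text \<open>
  The topology of the inverse limit over \<open>a\<close> of the (discrete) groups of truncations
  of automorphisms modulo $x^{a+1}$: it is induced from the product of these groups.
\<close>

definition fgl_aut_topology :: "'L::field fps fps \<Rightarrow> 'L fps topology" where
  "fgl_aut_topology F =
     pullback_topology (fgl_aut F) (\<lambda>f a. fps_cutoff (Suc a) f)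
       (product_topology (\<lambda>a. discrete_topology (fps_cutoff (Suc a) ` fgl_aut F)) UNIV)"

text \<open>
  For an isomorphism \<open>\<phi>\<close> from \<open>F\<close> to \<open>H\<close>, this is the induced isomorphism from the automorphism group of
  \<open>F\<close> to that of \<open>H\<close>. It is the identity for \<open>\<phi> = fps_X\<close>.
\<close>

definition conjugate_by :: "'L::field fps \<Rightarrow> 'L fps \<Rightarrow> 'L fps" where
  "conjugate_by \<phi> f = \<phi> oo f oo fps_inv \<phi>"

end

theory Submission
  imports Defs "Jordan_Normal_Form.Char_Poly"
begin

text \<open>
  Let $Q = q^n$ and $P = p^{dn}$. Choose $b$ with $b^{Q-1} = \omega$. Over $\overline{k}$, the
  formal module ${}_\omega\mathbb{G}^A_{1/n}$ is the rescaling $b^{-1} F_0(bx, by)$ of the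
  reduction $F_0$ of the formal $A$-module with logarithm $\sum_k x^{Q^k}/\pi^k$
  (\<open>G_fgl_eq_scale2\<close>, \<open>G_action_eq_scale1\<close>), and
  ${}_1\mathbb{G}^{\hat{\mathbb{Z}}_p}_{1/dn}$ is the reduction of the one with logarithm
  $\sum_k x^{P^k}/p^k$. Both are integral by Hazewinkel's functional equation lemma
  (\<open>lg_inverse_integral\<close>), which also shows that the uniformizer acts on the
  reductions as $x^Q$ and $x^P$, respectively (\<open>act_uniformizer\<close>).

  Counting $A/pA = A/\pi^e A$ in two ways gives $q^e = p^d$ (\<open>residue_degree\<close>),
  hence $Q^e = P$. Write $p = w \pi^e$ with a unit $w$. Then multiplication by $p$ on $F_0$ is
  $[w](x^P)$. After rescaling by $b$ it becomes $T(x^P)$ for a series $T$ with linear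
  coefficient $b^{P-1} w$. As $P - 1 = (Q - 1) \cdot \frac{q^{en}-1}{q^n-1}$, the hypothesis
  on $\omega$ says precisely that this coefficient is $1$ in $\overline{k}$. So the two formal
  group laws $F$ and $H$ have multiplication by $p$ equal to $T(x^P)$, with $T$ strict, and to
  $x^P$.

  Over an algebraically closed field, two such formal group laws are strictly isomorphic
  (\<open>exists_strict_iso\<close>). A strict isomorphism $\psi$ has to satisfy $\psi(T(x^P))
  = \psi(x)^P$. A series with this property is found by solving one equation $c^P - c = s$ for
  each coefficient $c$. It is then corrected degree by degree, as in Lazard's classification.
  The leading form of the failure of $\psi$ to be a homomorphism is a symmetric 2-cocycle. The
  property makes it a coboundary with coefficient in the field of $P$ elements
  (\<open>symmetric_cocycle_coboundary\<close>, \<open>approx_hom_step\<close>), so that it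
  can be removed without destroying the property.

  Conjugation by any isomorphism $\varphi$ from $F$ to $H$ maps the automorphisms of $F$
  isomorphically to those of $H$, and those that commute with $A$ to a subgroup
  (\<open>conjugate_formal_module_aut_subgroup\<close>). It is closed because a failure to
  commute with some $[a]$ is visible in a truncation
  (\<open>conjugate_formal_module_aut_closed\<close>).
\<close>

(* Throughout, $ is the coefficient of a power series, not the entry of a vector. *)
unbundle no vec_syntax
no_notation Matrix.vec_index (infixl "$" 100)

section \<open>Subrings and homomorphisms defined on subrings\<close>

text \<open>
  Coefficient rings are subsets of an ambient ring rather than types, because the logarithm
  of a formal group law over \<open>A\<close> has coefficients in the fraction field of
  \<open>A\<close> only.
\<close>

definition is_subring :: "'a::comm_ring_1 set \<Rightarrow> bool" where
  "is_subring A \<longleftrightarrow> 1 \<in> A \<and> (\<forall>a\<in>A. \<forall>b\<in>A. a + b \<in> A \<and> a * b \<in> A \<and> - a \<in> A)"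

lemma is_subring_UNIV [simp]: "is_subring UNIV"
  by (simp add: is_subring_def)

context
  fixes A :: "'a::comm_ring_1 set"
  assumes A: "is_subring A"
begin

lemma subring_1: "1 \<in> A"
  and subring_add: "a \<in> A \<Longrightarrow> b \<in> A \<Longrightarrow> a + b \<in> A"
  and subring_mult: "a \<in> A \<Longrightarrow> b \<in> A \<Longrightarrow> a * b \<in> A"
  and subring_uminus: "a \<in> A \<Longrightarrow> - a \<in> A"
  using A by (auto simp: is_subring_def)

lemma subring_diff: "a \<in> A \<Longrightarrow> b \<in> A \<Longrightarrow> a - b \<in> A"
  using subring_add[of a "- b"] subring_uminus[of b] by simp

lemma subring_0: "0 \<in> A"
  using subring_diff[OF subring_1 subring_1] by simp

lemma subring_sum: "(\<And>x. x \<in> X \<Longrightarrow> g x \<in> A) \<Longrightarrow> sum g X \<in> A"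
  by (induction X rule: infinite_finite_induct) (auto simp: subring_0 subring_add)

lemma subring_prod: "(\<And>x. x \<in> X \<Longrightarrow> g x \<in> A) \<Longrightarrow> prod g X \<in> A"
  by (induction X rule: infinite_finite_induct) (auto simp: subring_1 subring_mult)

lemma subring_power: "a \<in> A \<Longrightarrow> a ^ n \<in> A"
  by (induction n) (auto simp: subring_1 subring_mult)

lemma subring_of_nat: "of_nat n \<in> A"
  by (induction n) (auto simp: subring_0 subring_1 subring_add)

lemma subring_of_int: "of_int n \<in> A"
  by (cases n) (auto simp: subring_of_nat subring_uminus subring_add subring_1 simp del: of_nat_Suc)

end

definition fps_over :: "'a set \<Rightarrow> 'a fps set" where
  "fps_over A = {f. \<forall>n. f $ n \<in> A}"

lemma is_subring_fps_over: "is_subring A \<Longrightarrow> is_subring (fps_over A)"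
  unfolding is_subring_def[of "fps_over A"]
  by (auto simp: fps_over_def fps_mult_nth subring_0 subring_1
      intro!: subring_add subring_mult subring_uminus subring_sum)

text \<open>
  The function \<open>h\<close> is total, as is the residue map of the theorem, but only its
  values on the subring \<open>A\<close> matter.
\<close>

locale subring_hom =
  fixes A :: "'a::comm_ring_1 set" and h :: "'a \<Rightarrow> 'b::comm_ring_1"
  assumes subring: "is_subring A"
    and hom_1: "h 1 = 1"
    and hom_add: "a \<in> A \<Longrightarrow> b \<in> A \<Longrightarrow> h (a + b) = h a + h b"
    and hom_mult: "a \<in> A \<Longrightarrow> b \<in> A \<Longrightarrow> h (a * b) = h a * h b"
begin

lemma hom_0: "h 0 = 0"
  using hom_add[of 0 0] subring_0[OF subring] by simp

lemma hom_uminus: "a \<in> A \<Longrightarrow> h (- a) = - h a"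
  using hom_add[of "- a" a] subring_uminus[OF subring, of a] hom_0
  by (simp add: eq_neg_iff_add_eq_0)

lemma hom_diff: "a \<in> A \<Longrightarrow> b \<in> A \<Longrightarrow> h (a - b) = h a - h b"
  using hom_add[of a "- b"] hom_uminus[of b] subring_uminus[OF subring, of b] by simp

lemma hom_sum: "(\<And>x. x \<in> X \<Longrightarrow> g x \<in> A) \<Longrightarrow> h (sum g X) = (\<Sum>x\<in>X. h (g x))"
  by (induction X rule: infinite_finite_induct)
     (auto simp: hom_0 hom_add subring_sum[OF subring])

lemma hom_power: "a \<in> A \<Longrightarrow> h (a ^ n) = h a ^ n"
  by (induction n) (auto simp: hom_1 hom_mult subring_power[OF subring])

lemma hom_of_nat: "h (of_nat n) = of_nat n"
  by (induction n) (auto simp: hom_0 hom_1 hom_add subring_1[OF subring] subring_of_nat[OF subring])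

end

lemma map_coeffs1_nth [simp]: "map_coeffs1 h f $ n = h (f $ n)"
  by (simp add: map_coeffs1_def)

lemma map_coeffs2_nth [simp]: "map_coeffs2 h F $ i $ j = h (F $ i $ j)"
  by (simp add: map_coeffs2_def)

lemma map_coeffs2_conv: "map_coeffs2 h F = map_coeffs1 (map_coeffs1 h) F"
  by (simp add: fps_eq_iff)

lemma (in subring_hom) subring_hom_fps: "subring_hom (fps_over A) (map_coeffs1 h)"
proof
  show "is_subring (fps_over A)"
    by (rule is_subring_fps_over[OF subring])
  fix f g assume fg: "f \<in> fps_over A" "g \<in> fps_over A"
  show "map_coeffs1 h (f + g) = map_coeffs1 h f + map_coeffs1 h g"
    using fg by (simp add: fps_eq_iff fps_over_def hom_add)
  show "map_coeffs1 h (f * g) = map_coeffs1 h f * map_coeffs1 h g"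
    using fg by (simp add: fps_eq_iff fps_over_def fps_mult_nth hom_sum hom_mult subring_mult[OF subring])
qed (simp add: fps_eq_iff hom_0 hom_1)

lemma (in subring_hom) map_coeffs1_power:
  "f \<in> fps_over A \<Longrightarrow> h ((f ^ k) $ n) = (map_coeffs1 h f ^ k) $ n"
  using subring_hom.hom_power[OF subring_hom_fps, of f k] by (metis map_coeffs1_nth)

lemma fps_over_power:
  "is_subring A \<Longrightarrow> f \<in> fps_over A \<Longrightarrow> (f ^ k) $ n \<in> A"
  using subring_power[OF is_subring_fps_over, of A f k] by (simp add: fps_over_def)

lemma (in subring_hom) map_coeffs1_compose:
  assumes "f \<in> fps_over A" "g \<in> fps_over A"
  shows "map_coeffs1 h (f oo g) = map_coeffs1 h f oo map_coeffs1 h g"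
  using assms(1)
  by (simp add: fps_eq_iff fps_compose_nth fps_over_def hom_sum hom_mult map_coeffs1_power[OF assms(2)]
      subring_mult[OF subring] fps_over_power[OF subring assms(2)])

section \<open>Evaluation of a series in two variables\<close>

text \<open>
  The series \<open>F(u, v)\<close> in one variable, for \<open>u\<close> and
  \<open>v\<close> without constant term; the truncated sums are then the full ones.
  Identities between series in two or three variables are expressed through such values
  below, so that three variables never occur.
\<close>

definition fps_eval2 :: "'r::comm_ring_1 fps fps \<Rightarrow> 'r fps \<Rightarrow> 'r fps \<Rightarrow> 'r fps" where
  "fps_eval2 F u v = Abs_fps (\<lambda>n. \<Sum>a\<le>n. \<Sum>b\<le>n. F $ a $ b * (u ^ a * v ^ b) $ n)"

lemma fps_power_nth_below:
  fixes u :: "'r::comm_ring_1 fps"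
  assumes "u $ 0 = 0" "n < a" shows "(u ^ a) $ n = 0"
  using assms startsby_zero_power_prefix by blast

lemma fps_power_mult_nth_below:
  fixes u v :: "'r::comm_ring_1 fps"
  assumes "u $ 0 = 0" "v $ 0 = 0" "n < a + b"
  shows "(u ^ a * v ^ b) $ n = 0"
proof -
  have "(u ^ a) $ i * (v ^ b) $ (n - i) = 0" if "i \<le> n" for i
  proof (cases "i < a")
    case True
    then show ?thesis using fps_power_nth_below[OF assms(1)] by simp
  next
    case False
    then have "n - i < b" using assms(3) that by linarith
    then show ?thesis using fps_power_nth_below[OF assms(2)] by simp
  qed
  then show ?thesis by (simp add: fps_mult_nth)
qed

lemma fps_eval2_nth:
  assumes "u $ 0 = 0" "v $ 0 = 0" "n \<le> N"
  shows "fps_eval2 F u v $ n = (\<Sum>a\<le>N. \<Sum>b\<le>N. F $ a $ b * (u ^ a * v ^ b) $ n)"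
proof -
  have "(\<Sum>b\<le>N. F $ a $ b * (u ^ a * v ^ b) $ n) = (\<Sum>b\<le>n. F $ a $ b * (u ^ a * v ^ b) $ n)" for a
    using assms by (intro sum.mono_neutral_right) (auto simp: fps_power_mult_nth_below)
  then show ?thesis
    using assms unfolding fps_eval2_def
    by (simp, intro sum.mono_neutral_left) (auto simp: fps_power_mult_nth_below intro!: sum.neutral)
qed

lemma fps_eval2_nth_0 [simp]: "fps_eval2 F u v $ 0 = F $ 0 $ 0"
  by (simp add: fps_eval2_def)

lemma fps_eval2_add: "fps_eval2 (F + G) u v = fps_eval2 F u v + fps_eval2 G u v"
  by (simp add: fps_eq_iff fps_eval2_def distrib_right sum.distrib)

lemma fps_eval2_diff: "fps_eval2 (F - G) u v = fps_eval2 F u v - fps_eval2 G u v"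
  by (simp add: fps_eq_iff fps_eval2_def left_diff_distrib sum_subtractf)

lemma sum_square_eq_triangle:
  fixes f :: "nat \<Rightarrow> nat \<Rightarrow> 'a::comm_monoid_add"
  assumes "\<And>a c. n < a + c \<Longrightarrow> f a c = 0"
  shows "(\<Sum>a\<le>n. \<Sum>c\<le>n. f a c) = (\<Sum>k\<le>n. \<Sum>a\<le>k. f a (k - a))"
proof -
  have "(\<Sum>a\<le>n. \<Sum>c\<le>n. f a c) = (\<Sum>(a, c) \<in> {..n} \<times> {..n}. f a c)"
    by (simp add: sum.cartesian_product)
  also have "\<dots> = (\<Sum>(a, c) \<in> {(a, c). a + c \<le> n}. f a c)"
    using assms by (intro sum.mono_neutral_right) (auto, meson not_le)
  finally show ?thesis by (simp add: sum.triangle_reindex_eq)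
qed

text \<open>
  In the product, exponents \<open>(a, b)\<close> of \<open>F\<close> and \<open>(c,
  d)\<close> of \<open>G\<close> are regrouped by \<open>(a + c, b + d)\<close>; the terms
  by which the square and the triangular ranges of summation differ have order above
  \<open>n\<close>.
\<close>

lemma fps_eval2_mult:
  fixes F G :: "'r::comm_ring_1 fps fps"
  assumes u: "u $ 0 = 0" and v: "v $ 0 = 0"
  shows "fps_eval2 (F * G) u v = fps_eval2 F u v * fps_eval2 G u v"
proof (rule fps_ext)
  fix n
  define W where "W a b = u ^ a * v ^ b" for a b
  have W_mult: "W a b * W c d = W (a + c) (b + d)" for a b c d
    by (simp add: W_def power_add algebra_simps)
  have W_0: "W a b $ n = 0" if "n < a + b" for a b
    unfolding W_def by (rule fps_power_mult_nth_below[OF u v that])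
  have "(fps_eval2 F u v * fps_eval2 G u v) $ n =
      (\<Sum>i\<le>n. (\<Sum>a\<le>n. \<Sum>b\<le>n. F $ a $ b * W a b $ i) *
               (\<Sum>c\<le>n. \<Sum>d\<le>n. G $ c $ d * W c d $ (n - i)))"
    unfolding fps_mult_nth[of "fps_eval2 F u v"] W_def atLeast0AtMost
    by (intro sum.cong) (simp_all add: fps_eval2_nth[OF u v, of _ n])
  also have "\<dots> = (\<Sum>i\<le>n. \<Sum>a\<le>n. \<Sum>b\<le>n. \<Sum>c\<le>n. \<Sum>d\<le>n. F $ a $ b * G $ c $ d * (W a b $ i * W c d $ (n - i)))"
    by (simp only: sum_distrib_right) (simp only: sum_distrib_left mult_ac)
  also have "\<dots> = (\<Sum>a\<le>n. \<Sum>b\<le>n. \<Sum>c\<le>n. \<Sum>d\<le>n. \<Sum>i\<le>n. F $ a $ b * G $ c $ d * (W a b $ i * W c d $ (n - i)))"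
    by (subst sum.swap, rule sum.cong, simp, subst sum.swap, rule sum.cong, simp,
        subst sum.swap, rule sum.cong, simp, subst sum.swap, rule sum.cong, simp_all)
  also have "\<dots> = (\<Sum>a\<le>n. \<Sum>b\<le>n. \<Sum>c\<le>n. \<Sum>d\<le>n. F $ a $ b * G $ c $ d * W (a + c) (b + d) $ n)"
    by (simp add: W_mult[symmetric] fps_mult_nth sum_distrib_left atLeast0AtMost)
  also have "\<dots> = (\<Sum>a\<le>n. \<Sum>c\<le>n. \<Sum>b\<le>n. \<Sum>d\<le>n. F $ a $ b * G $ c $ d * W (a + c) (b + d) $ n)"
    by (rule sum.cong, simp, subst sum.swap, simp)
  also have "\<dots> = (\<Sum>a\<le>n. \<Sum>c\<le>n. \<Sum>B\<le>n. \<Sum>b\<le>B. F $ a $ b * G $ c $ (B - b) * W (a + c) (b + (B - b)) $ n)"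
    by (intro sum.cong refl sum_square_eq_triangle) (simp add: W_0)
  also have "\<dots> = (\<Sum>a\<le>n. \<Sum>c\<le>n. \<Sum>B\<le>n. \<Sum>b\<le>B. F $ a $ b * G $ c $ (B - b) * W (a + c) B $ n)"
    by simp
  also have "\<dots> = (\<Sum>k\<le>n. \<Sum>a\<le>k. \<Sum>B\<le>n. \<Sum>b\<le>B. F $ a $ b * G $ (k - a) $ (B - b) * W (a + (k - a)) B $ n)"
    by (rule sum_square_eq_triangle) (simp add: W_0)
  also have "\<dots> = (\<Sum>k\<le>n. \<Sum>B\<le>n. \<Sum>a\<le>k. \<Sum>b\<le>B. F $ a $ b * G $ (k - a) $ (B - b) * W k B $ n)"
    by (rule sum.cong, simp, subst sum.swap, simp)
  also have "\<dots> = fps_eval2 (F * G) u v $ n"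
    by (simp add: fps_eval2_def W_def fps_mult_nth fps_sum_nth sum_distrib_right atLeast0AtMost)
  finally show "fps_eval2 (F * G) u v $ n = (fps_eval2 F u v * fps_eval2 G u v) $ n" by simp
qed

lemma fps_eval2_1 [simp]: "fps_eval2 1 u v = 1"
proof (rule fps_ext)
  fix n
  have "fps_eval2 1 u v $ n = (\<Sum>a\<le>n. \<Sum>b\<le>n. if b = 0 then if a = 0 then 1 $ n else 0 else 0)"
    unfolding fps_eval2_def fps_nth_Abs_fps by (intro sum.cong) auto
  also have "\<dots> = 1 $ n" by (simp del: fps_one_nth add: sum.delta)
  finally show "fps_eval2 1 u v $ n = 1 $ n" .
qed

lemma fps_eval2_power:
  assumes u: "u $ 0 = 0" and v: "v $ 0 = 0"
  shows "fps_eval2 (F ^ k) u v = fps_eval2 F u v ^ k"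
  by (induction k) (simp_all add: fps_eval2_mult[OF u v])

lemma fps_eval2_x:
  assumes "u $ 0 = 0" shows "fps_eval2 fps_x u v = u"
proof (rule fps_ext)
  fix n
  have "fps_eval2 fps_x u v $ n = (\<Sum>a\<le>n. \<Sum>b\<le>n. if b = 0 then if a = 1 then u $ n else 0 else 0)"
    unfolding fps_eval2_def fps_x_def fps_nth_Abs_fps by (intro sum.cong) (auto simp: fps_X_def)
  also have "\<dots> = u $ n" using assms by (cases "n = 0") (auto simp: sum.delta)
  finally show "fps_eval2 fps_x u v $ n = u $ n" .
qed

lemma fps_eval2_y:
  assumes "v $ 0 = 0" shows "fps_eval2 fps_y u v = v"
proof (rule fps_ext)
  fix n
  have "fps_eval2 fps_y u v $ n = (\<Sum>a\<le>n. \<Sum>b\<le>n. if a = 0 then if b = 1 then v $ n else 0 else 0)"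
    unfolding fps_eval2_def fps_y_def fps_nth_Abs_fps by (intro sum.cong) (auto simp: fps_X_def)
  also have "\<dots> = (\<Sum>a\<le>n. if a = 0 then (\<Sum>b\<le>n. if b = 1 then v $ n else 0) else 0)"
    by (intro sum.cong) auto
  also have "\<dots> = v $ n" using assms by (cases "n = 0") (auto simp: sum.delta)
  finally show "fps_eval2 fps_y u v $ n = v $ n" .
qed

lemma fps2_power_nth_below:
  fixes G :: "'r::comm_ring_1 fps fps"
  assumes "G $ 0 $ 0 = 0" "i + j < k"
  shows "(G ^ k) $ i $ j = 0"
  using assms(2)
proof (induction k arbitrary: i j)
  case (Suc k)
  have "(G $ a) $ b * (G ^ k) $ (i - a) $ (j - b) = 0" if "a \<le> i" "b \<le> j" for a b
  proof (cases "a = 0 \<and> b = 0")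
    case False
    then have "(i - a) + (j - b) < k" using Suc.prems that by linarith
    then show ?thesis using Suc.IH by simp
  qed (use assms in auto)
  then show ?case by (simp add: fps_mult_nth fps_sum_nth)
qed auto

lemma subst1_nth:
  assumes "G $ 0 $ 0 = 0" "i + j \<le> N"
  shows "subst1 f G $ i $ j = (\<Sum>a\<le>N. f $ a * (G ^ a) $ i $ j)"
  unfolding subst1_def using assms
  by (simp, intro sum.mono_neutral_left) (auto simp: fps2_power_nth_below)

lemma fps2_power_mult_nth_below:
  fixes G H :: "'r::comm_ring_1 fps fps"
  assumes "G $ 0 $ 0 = 0" "H $ 0 $ 0 = 0" "i + j < k + l"
  shows "(G ^ k * H ^ l) $ i $ j = 0"
proof -
  have "(G ^ k) $ a $ b * (H ^ l) $ (i - a) $ (j - b) = 0" if "a \<le> i" "b \<le> j" for a b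
  proof (cases "a + b < k")
    case False
    then have "(i - a) + (j - b) < l" using assms that by linarith
    then show ?thesis using fps2_power_nth_below[OF assms(2)] by simp
  qed (use fps2_power_nth_below[OF assms(1)] in auto)
  then show ?thesis by (simp add: fps_mult_nth fps_sum_nth)
qed

lemma subst2_nth:
  assumes "G $ 0 $ 0 = 0" "H $ 0 $ 0 = 0" "i + j \<le> N"
  shows "subst2 F G H $ i $ j = (\<Sum>a\<le>N. \<Sum>b\<le>N. F $ a $ b * (G ^ a * H ^ b) $ i $ j)"
proof -
  have "(\<Sum>b\<le>N. F $ a $ b * (G ^ a * H ^ b) $ i $ j) = (\<Sum>b\<le>i+j. F $ a $ b * (G ^ a * H ^ b) $ i $ j)" for a
    using assms by (intro sum.mono_neutral_right) (auto simp: fps2_power_mult_nth_below)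
  then show ?thesis
    using assms unfolding subst2_def
    by (simp, intro sum.mono_neutral_left) (auto simp: fps2_power_mult_nth_below intro!: sum.neutral)
qed

lemma fps_eval2_subst1:
  assumes u: "u $ 0 = 0" and v: "v $ 0 = 0" and G: "G $ 0 $ 0 = 0"
  shows "fps_eval2 (subst1 f G) u v = f oo fps_eval2 G u v"
proof (rule fps_ext)
  fix n
  have "fps_eval2 (subst1 f G) u v $ n =
      (\<Sum>a\<le>n. \<Sum>b\<le>n. \<Sum>k\<le>n+n. f $ k * ((G ^ k) $ a $ b * (u ^ a * v ^ b) $ n))"
    unfolding fps_eval2_def
    by (simp add: subst1_nth[OF G, of _ _ "n + n"] sum_distrib_right mult.assoc)
  also have "\<dots> = (\<Sum>k\<le>n+n. \<Sum>a\<le>n. \<Sum>b\<le>n. f $ k * ((G ^ k) $ a $ b * (u ^ a * v ^ b) $ n))"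
    by (simp only: sum.swap[where A = "{..n}" and B = "{..n+n}"])
  also have "\<dots> = (\<Sum>k\<le>n+n. f $ k * (fps_eval2 (G ^ k) u v) $ n)"
    by (simp add: fps_eval2_def sum_distrib_left)
  also have "\<dots> = (\<Sum>k\<le>n. f $ k * (fps_eval2 G u v ^ k) $ n)"
    unfolding fps_eval2_power[OF u v] using G
    by (intro sum.mono_neutral_right) (auto simp: fps_power_nth_below)
  finally show "fps_eval2 (subst1 f G) u v $ n = (f oo fps_eval2 G u v) $ n"
    by (simp add: fps_compose_nth atLeast0AtMost)
qed

lemma fps_eval2_subst2:
  assumes u: "u $ 0 = 0" and v: "v $ 0 = 0" and G: "G $ 0 $ 0 = 0" and H: "H $ 0 $ 0 = 0"
  shows "fps_eval2 (subst2 F G H) u v = fps_eval2 F (fps_eval2 G u v) (fps_eval2 H u v)"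
proof (rule fps_ext)
  fix n
  have "fps_eval2 (subst2 F G H) u v $ n =
      (\<Sum>a\<le>n. \<Sum>b\<le>n. \<Sum>k\<le>n+n. \<Sum>l\<le>n+n. F $ k $ l * ((G ^ k * H ^ l) $ a $ b * (u ^ a * v ^ b) $ n))"
    unfolding fps_eval2_def
    by (simp add: subst2_nth[OF G H, of _ _ "n + n"] sum_distrib_right mult.assoc)
  also have "\<dots> = (\<Sum>k\<le>n+n. \<Sum>l\<le>n+n. \<Sum>a\<le>n. \<Sum>b\<le>n. F $ k $ l * ((G ^ k * H ^ l) $ a $ b * (u ^ a * v ^ b) $ n))"
    by (simp only: sum.swap[where A = "{..n}" and B = "{..n+n}"])
  also have "\<dots> = (\<Sum>k\<le>n+n. \<Sum>l\<le>n+n. F $ k $ l * (fps_eval2 (G ^ k * H ^ l) u v) $ n)"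
    by (simp add: fps_eval2_def sum_distrib_left)
  also have "\<dots> = fps_eval2 F (fps_eval2 G u v) (fps_eval2 H u v) $ n"
    using G H by (simp add: fps_eval2_nth[of _ _ n "n + n"] fps_eval2_mult[OF u v] fps_eval2_power[OF u v])
  finally show "fps_eval2 (subst2 F G H) u v $ n = fps_eval2 F (fps_eval2 G u v) (fps_eval2 H u v) $ n" .
qed

lemma fps_over_eval2:
  assumes "is_subring A" "F \<in> fps_over (fps_over A)" "u \<in> fps_over A" "v \<in> fps_over A"
  shows "fps_eval2 F u v \<in> fps_over A"
proof -
  have "u ^ a * v ^ b \<in> fps_over A" for a b
    using assms by (intro subring_mult subring_power is_subring_fps_over)
  then show ?thesis
    using assms(2) unfolding fps_over_def fps_eval2_def
    by (auto intro!: subring_sum[OF assms(1)] subring_mult[OF assms(1)])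
qed

lemma (in subring_hom) map_coeffs1_eval2:
  assumes "F \<in> fps_over (fps_over A)" "u \<in> fps_over A" "v \<in> fps_over A"
  shows "map_coeffs1 h (fps_eval2 F u v) = fps_eval2 (map_coeffs2 h F) (map_coeffs1 h u) (map_coeffs1 h v)"
proof -
  interpret fps: subring_hom "fps_over A" "map_coeffs1 h"
    by (rule subring_hom_fps)
  have W: "u ^ a * v ^ b \<in> fps_over A" for a b
    using assms by (intro subring_mult subring_power is_subring_fps_over subring)
  have *: "h ((u ^ a * v ^ b) $ n) = (map_coeffs1 h u ^ a * map_coeffs1 h v ^ b) $ n" for a b n
    using assms subring_power[OF fps.subring]
    by (metis map_coeffs1_nth fps.hom_mult fps.hom_power)
  have "F $ a $ b * (u ^ a * v ^ b) $ n \<in> A" for a b n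
    using W assms(1) by (auto simp: fps_over_def intro!: subring_mult[OF subring])
  then show ?thesis
    using W assms(1)
    by (simp add: fps_eq_iff fps_eval2_def hom_sum hom_mult fps_over_def * subring_sum[OF subring] subring_mult[OF subring])
qed

lemma (in subring_hom) map_coeffs2_subst1:
  assumes "f \<in> fps_over A" "G \<in> fps_over (fps_over A)"
  shows "map_coeffs2 h (subst1 f G) = subst1 (map_coeffs1 h f) (map_coeffs2 h G)"
proof -
  interpret fps: subring_hom "fps_over A" "map_coeffs1 h"
    by (rule subring_hom_fps)
  have "(G ^ a) $ i \<in> fps_over A" for a i
    by (rule fps_over_power[OF fps.subring assms(2)])
  then have mem: "(G ^ a) $ i $ j \<in> A" for a i j
    by (simp add: fps_over_def)
  have "h ((G ^ a) $ i $ j) = (map_coeffs2 h G ^ a) $ i $ j" for a i j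
    using fps.map_coeffs1_power[OF assms(2), of a i] by (metis map_coeffs1_nth map_coeffs2_conv)
  with mem assms(1) show ?thesis
    by (simp add: fps_eq_iff subst1_def hom_sum hom_mult fps_over_def subring_mult[OF subring])
qed

section \<open>Recovering a two-variable series from its values on lines\<close>

lemma fps_monomial_power_mult: "(fps_const x * fps_X) ^ a * (fps_const y * fps_X) ^ b = (fps_const (x ^ a * y ^ b) * fps_X ^ (a + b) :: 'a::comm_ring_1 fps)"
    unfolding power_mult_distrib fps_const_power power_add fps_const_mult[symmetric]
    by (simp only: mult_ac)
lemma fps_monomial_power_nth:
  "((fps_const x * fps_X) ^ a * (fps_const y * fps_X) ^ b) $ n = (if a + b = n then x ^ a * y ^ b else (0::'a::comm_ring_1))"
  unfolding fps_monomial_power_mult by (simp add: fps_X_power_nth)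
lemma fps_eval2_monomials_nth:
  "fps_eval2 F (fps_const x * fps_X) (fps_const y * fps_X) $ n =
     (\<Sum>i\<le>n. F $ i $ (n - i) * (x ^ i * y ^ (n - i)) :: 'a::comm_ring_1)"
proof -
  have "fps_eval2 F (fps_const x * fps_X) (fps_const y * fps_X) $ n =
      (\<Sum>a\<le>n. \<Sum>b\<le>n. if b = n - a then F $ a $ b * (x ^ a * y ^ b) else 0)"
    unfolding fps_eval2_def fps_nth_Abs_fps fps_monomial_power_nth
    by (intro sum.cong refl) auto
  also have "\<dots> = (\<Sum>i\<le>n. F $ i $ (n - i) * (x ^ i * y ^ (n - i)))"
    by (intro sum.cong refl) (simp add: sum.delta)
  finally show ?thesis .
qed
lemma poly_eqI_infinite:
  fixes P Q :: "'a::idom poly"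
  assumes "infinite X" "\<And>x. x \<in> X \<Longrightarrow> poly P x = poly Q x"
  shows "P = Q"
proof (rule ccontr)
  assume "P \<noteq> Q"
  then have "finite {x. poly (P - Q) x = 0}" by (intro poly_roots_finite) simp
  moreover have "X \<subseteq> {x. poly (P - Q) x = 0}" using assms(2) by auto
  ultimately show False using assms(1) finite_subset by blast
qed

lemma power_sum_eqI_infinite:
  fixes c d :: "nat \<Rightarrow> 'a::idom"
  assumes "infinite X" "\<And>x. x \<in> X \<Longrightarrow> (\<Sum>i\<le>n. c i * x ^ i) = (\<Sum>i\<le>n. d i * x ^ i)" "i \<le> n"
  shows "c i = d i"
proof -
  have "(\<Sum>i\<le>n. Polynomial.monom (c i) i) = (\<Sum>i\<le>n. Polynomial.monom (d i) i)"
    by (rule poly_eqI_infinite[OF assms(1)]) (simp add: poly_sum poly_monom assms(2))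
  then have "poly.coeff (\<Sum>i\<le>n. Polynomial.monom (c i) i) i = poly.coeff (\<Sum>i\<le>n. Polynomial.monom (d i) i) i" by simp
  then show ?thesis using assms(3) by (simp add: coeff_sum sum.delta)
qed

text \<open>
  The coefficient of \<open>t\<^sup>n\<close> in \<open>F(x t, y t)\<close> is the
  homogeneous part of degree \<open>n\<close> of \<open>F\<close> at \<open>(x, y)\<close>,
  and over an infinite domain a polynomial is determined by its values.
\<close>

lemma fps2_eqI_points:
  fixes F G :: "'a::idom fps fps"
  assumes "infinite (UNIV :: 'a set)"
    and "\<And>x y. fps_eval2 F (fps_const x * fps_X) (fps_const y * fps_X) =
                fps_eval2 G (fps_const x * fps_X) (fps_const y * fps_X)"
  shows "F = G"
proof (intro fps_ext)
  fix i j :: nat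
  let ?n = "i + j"
  have "(\<Sum>i\<le>?n. F $ i $ (?n - i) * x ^ i) = (\<Sum>i\<le>?n. G $ i $ (?n - i) * x ^ i)" for x
    using arg_cong[OF assms(2)[of x 1], of "\<lambda>f. f $ ?n"]
    unfolding fps_eval2_monomials_nth by simp
  then have "F $ i $ (?n - i) = G $ i $ (?n - i)"
    by (intro power_sum_eqI_infinite[OF assms(1), where n = ?n and i = i
          and c = "\<lambda>i. F $ i $ (?n - i)" and d = "\<lambda>i. G $ i $ (?n - i)"]) auto
  then show "F $ i $ j = G $ i $ j" by simp
qed

lemma subring_hom_const_poly: "subring_hom UNIV (\<lambda>c::'a::comm_ring_1. [:c:])"
  by unfold_locales (simp_all add: one_pCons)

text \<open>
  This is \<open>F(t, s t)\<close> as a series in \<open>t\<close> over polynomials in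
  \<open>s\<close>. No information is lost, so facts about series in one variable, such as
  cancellation and associativity of composition, carry over to two variables.
\<close>

definition homogenize :: "'a::comm_ring_1 fps fps \<Rightarrow> 'a poly fps" where
  "homogenize F = fps_eval2 (map_coeffs2 (\<lambda>c. [:c:]) F) fps_X (fps_const [:0, 1:] * fps_X)"

lemma coeff_homogenize:
  "j \<le> n \<Longrightarrow> poly.coeff (homogenize F $ n) j = F $ (n - j) $ j"
proof -
  assume j: "j \<le> n"
  have "homogenize F $ n = (\<Sum>i\<le>n. [:F $ i $ (n - i):] * [:0, 1:] ^ (n - i))"
    using fps_eval2_monomials_nth[of "map_coeffs2 (\<lambda>c. [:c:]) F" 1 "[:0, 1:]" n]
    unfolding homogenize_def map_coeffs2_nth power_one fps_const_1_eq_1 mult_1 .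
  also have "\<dots> = (\<Sum>i\<le>n. Polynomial.monom (F $ i $ (n - i)) (n - i))"
    unfolding monom_altdef by (intro sum.cong refl) simp
  also have "poly.coeff \<dots> j = (\<Sum>i\<le>n. if i = n - j then F $ i $ (n - i) else 0)"
    unfolding coeff_sum coeff_monom using j by (intro sum.cong) auto
  finally show ?thesis using j by (simp only: sum.delta) simp
qed

lemma homogenize_inject:
  assumes "homogenize F = homogenize G" shows "F = G"
proof (intro fps_ext)
  fix i j :: nat
  show "F $ i $ j = G $ i $ j"
    using coeff_homogenize[of j "i + j" F] coeff_homogenize[of j "i + j" G] assms by simp
qed

lemma fps_over_UNIV [simp]: "fps_over UNIV = UNIV"
  by (auto simp: fps_over_def)

lemma homogenize_subst1:
  assumes "G $ 0 $ 0 = 0"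
  shows "homogenize (subst1 f G) = map_coeffs1 (\<lambda>c. [:c:]) f oo homogenize G"
proof -
  interpret subring_hom UNIV "\<lambda>c::'a. [:c:]" by (rule subring_hom_const_poly)
  show ?thesis
    unfolding homogenize_def using assms
    by (simp add: map_coeffs2_subst1 fps_eval2_subst1)
qed

lemma homogenize_nth_0: "homogenize F $ 0 = [:F $ 0 $ 0:]"
  by (simp add: homogenize_def)

lemma subst1_compose:
  fixes f g :: "'a::idom fps"
  assumes "g $ 0 = 0" "G $ 0 $ 0 = 0"
  shows "subst1 f (subst1 g G) = subst1 (f oo g) G"
proof (rule homogenize_inject)
  interpret subring_hom UNIV "\<lambda>c::'a. [:c:]" by (rule subring_hom_const_poly)
  have "subst1 g G $ 0 $ 0 = 0" using assms by (simp add: subst1_def)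
  then show "homogenize (subst1 f (subst1 g G)) = homogenize (subst1 (f oo g) G)"
    using assms
    by (simp add: homogenize_subst1 map_coeffs1_compose fps_compose_assoc homogenize_nth_0)
qed

section \<open>Coefficientwise construction and the compositional inverse\<close>

lemma fps_power_nth_cong:
  fixes f g :: "'a::comm_ring_1 fps"
  assumes "\<And>i. i \<le> n \<Longrightarrow> f $ i = g $ i"
  shows "(f ^ k) $ n = (g ^ k) $ n"
  using assms
proof (induction k arbitrary: n)
  case (Suc k)
  have "f $ i * (f ^ k) $ (n - i) = g $ i * (g ^ k) $ (n - i)" if "i \<le> n" for i
    using Suc.IH[of "n - i"] Suc.prems that by simp
  then show ?case by (simp add: fps_mult_nth)
qed simp

text \<open>
  For \<open>k \<ge> 2\<close> no factor of \<open>f\<^sup>k\<close> can contribute in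
  degree \<open>n\<close>, since each of the other factors has order at least
  \<open>1\<close>. The same fact makes it possible to solve equations for power series
  degree by degree.
\<close>

lemma fps_power_nth_cong_below:
  fixes f g :: "'a::comm_ring_1 fps"
  assumes "\<And>i. i < n \<Longrightarrow> f $ i = g $ i" "f $ 0 = 0" "g $ 0 = 0" "k \<ge> 2"
  shows "(f ^ k) $ n = (g ^ k) $ n"
proof -
  obtain l where k: "k = Suc l" "l > 0" using assms(4) by (cases k) auto
  have "f $ i * (f ^ l) $ (n - i) = g $ i * (g ^ l) $ (n - i)" if "i \<le> n" for i
  proof (cases "i = 0 \<or> i = n")
    case True
    have "(f ^ l) $ 0 = 0" "(g ^ l) $ 0 = 0" using assms k by (auto intro!: fps_power_nth_below)
    then show ?thesis using True assms by auto
  next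
    case False
    then have "(f ^ l) $ (n - i) = (g ^ l) $ (n - i)"
      using assms that by (intro fps_power_nth_cong) auto
    then show ?thesis using False assms that by auto
  qed
  then show ?thesis by (simp add: k fps_mult_nth)
qed

lemma fps_compose_nth_Suc_0_split:
  fixes f g :: "'a::comm_ring_1 fps"
  assumes "n > 0"
  shows "(f oo g) $ n = f $ 1 * g $ n + (\<Sum>k=2..n. f $ k * (g ^ k) $ n)"
proof -
  have "{0..n} = insert 0 (insert 1 {2..n})" using assms by auto
  then show ?thesis using assms by (simp add: fps_compose_nth)
qed

lemma fps_compose_left_cancel:
  fixes f a b :: "'a::comm_ring_1 fps"
  assumes "f $ 1 = 1" "a $ 0 = 0" "b $ 0 = 0" "f oo a = f oo b"
  shows "a = b"
proof (rule fps_ext)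
  fix n show "a $ n = b $ n"
  proof (induction n rule: less_induct)
    case (less n)
    show ?case
    proof (cases "n = 0")
      case False
      have "(\<Sum>k=2..n. f $ k * (a ^ k) $ n) = (\<Sum>k=2..n. f $ k * (b ^ k) $ n)"
        using assms less by (intro sum.cong) (auto intro!: arg_cong2[of _ _ _ _ "(*)"] fps_power_nth_cong_below)
      then show ?thesis
        using arg_cong[OF assms(4), of "\<lambda>f. f $ n"] assms(1) False
        by (simp add: fps_compose_nth_Suc_0_split)
    qed (use assms in auto)
  qed
qed

text \<open>
  Here \<open>R f n c\<close> says that \<open>c\<close> is admissible as coefficient of
  \<open>x\<^sup>n\<close> after the coefficients of \<open>f\<close> below
  \<open>n\<close>. The choices may be non-unique (roots of polynomials, later on), so this
  is an instance of dependent choice.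
\<close>

lemma fps_coefficientwise_choice:
  assumes cong: "\<And>f g n c. (\<And>i. i < n \<Longrightarrow> f $ i = g $ i) \<Longrightarrow> R f n c \<Longrightarrow> R g n c"
    and ex: "\<And>f n. (\<And>i. i < n \<Longrightarrow> R f i (f $ i)) \<Longrightarrow> \<exists>c. R f n c"
  shows "\<exists>f. \<forall>n. R f n (f $ n)"
proof -
  have "\<exists>f. \<forall>n. R (Abs_fps f) n (f n)"
  proof (rule dependent_wf_choice[OF wf_less])
    fix f g :: "nat \<Rightarrow> 'a" and n c
    assume "\<And>i. (i, n) \<in> {(x, y). x < y} \<Longrightarrow> f i = g i"
    then show "R (Abs_fps f) n c = R (Abs_fps g) n c"
      using cong[of n "Abs_fps f" "Abs_fps g"] cong[of n "Abs_fps g" "Abs_fps f"] by auto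
  next
    fix f :: "nat \<Rightarrow> 'a" and n
    assume "\<And>i. (i, n) \<in> {(x, y). x < y} \<Longrightarrow> R (Abs_fps f) i (f i)"
    then show "\<exists>c. R (Abs_fps f) n c" using ex[of n "Abs_fps f"] by simp
  qed
  then obtain f where "\<forall>n. R (Abs_fps f) n (f n)" by blast
  then show ?thesis by (intro exI[of _ "Abs_fps f"]) simp
qed

lemma fps_compose_right_inverse_exists:
  fixes f h :: "'a::comm_ring_1 fps"
  assumes "f $ 0 = 0" "f $ 1 = 1" "h $ 0 = 0"
  shows "\<exists>g. g $ 0 = 0 \<and> f oo g = h"
proof -
  \<comment> \<open>Only the coefficients of \<open>g\<close> strictly between
  \<open>0\<close> and \<open>n\<close> enter, by truncation and removal of the constant
  term.\<close>
  define R where "R g n c \<longleftrightarrow> c = (if n = 0 then 0 else h $ n - (\<Sum>k=2..n. f $ k * ((fps_cutoff n g - fps_const (g $ 0)) ^ k) $ n))" for g n c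
  have "\<exists>g. \<forall>n. R g n (g $ n)"
  proof (rule fps_coefficientwise_choice)
    fix f g :: "'a fps" and n c assume "\<And>i. i < n \<Longrightarrow> f $ i = g $ i" and R: "R f n c"
    then have "fps_cutoff n f = fps_cutoff n g" "n = 0 \<or> f $ 0 = g $ 0" by (auto simp: fps_eq_iff)
    then show "R g n c" using R by (auto simp: R_def)
  qed (auto simp: R_def)
  then obtain g where g: "\<And>n. R g n (g $ n)" by blast
  have g0: "g $ 0 = 0" using g[of 0] by (simp add: R_def)
  have "(f oo g) $ n = h $ n" for n
  proof (cases "n = 0")
    case False
    have "(\<Sum>k=2..n. f $ k * ((fps_cutoff n g) ^ k) $ n) = (\<Sum>k=2..n. f $ k * (g ^ k) $ n)"
      using g0 by (intro sum.cong refl arg_cong2[of _ _ _ _ "(*)"] fps_power_nth_cong_below) auto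
    then show ?thesis using g[of n] False assms g0
      by (simp add: R_def fps_compose_nth_Suc_0_split)
  qed (use assms in auto)
  with g0 show ?thesis by (auto simp: fps_eq_iff)
qed

lemma comp_inverse:
  fixes l :: "'a::comm_ring_1 fps"
  assumes "l $ 0 = 0" "l $ 1 = 1"
  shows "comp_inverse l $ 0 = 0" "l oo comp_inverse l = fps_X"
proof -
  obtain f where "f $ 0 = 0" "l oo f = fps_X"
    using fps_compose_right_inverse_exists[OF assms, of fps_X] by auto
  then have "\<exists>!f. f $ 0 = 0 \<and> l oo f = fps_X"
    using fps_compose_left_cancel[OF assms(2)] by metis
  from theI'[OF this] show "comp_inverse l $ 0 = 0" "l oo comp_inverse l = fps_X"
    by (simp_all add: comp_inverse_def)
qed

section \<open>Formal groups given by a logarithm\<close>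

definition log_fgl :: "'a::comm_ring_1 fps \<Rightarrow> 'a fps fps" where
  "log_fgl l = subst1 (comp_inverse l) (subst1 l fps_x + subst1 l fps_y)"

definition log_action :: "'a::comm_ring_1 fps \<Rightarrow> 'a \<Rightarrow> 'a fps" where
  "log_action l a = comp_inverse l oo (fps_const a * l)"

lemma fps_x_0_0 [simp]: "fps_x $ 0 $ 0 = 0" "fps_y $ 0 $ 0 = 0"
  by (simp_all add: fps_x_def fps_y_def)

lemma subst1_0_0 [simp]: "subst1 f G $ 0 $ 0 = f $ 0"
  by (simp add: subst1_def)

lemma subst1_fps_X:
  assumes "(G::'a::idom fps fps) $ 0 $ 0 = 0" shows "subst1 fps_X G = G"
proof (rule homogenize_inject)
  have "map_coeffs1 (\<lambda>c::'a. [:c:]) fps_X = fps_X" by (simp add: fps_eq_iff one_pCons fps_X_def)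
  then show "homogenize (subst1 fps_X G) = homogenize G"
    using assms by (simp add: homogenize_subst1 homogenize_nth_0)
qed

lemma log_action_nth_0: "l $ 0 = 0 \<Longrightarrow> l $ 1 = 1 \<Longrightarrow> log_action l a $ 0 = 0"
  by (simp add: log_action_def comp_inverse)

lemma log_fgl_nth_0: "l $ 0 = 0 \<Longrightarrow> l $ 1 = 1 \<Longrightarrow> log_fgl l $ 0 $ 0 = 0"
  by (simp add: log_fgl_def comp_inverse)

lemma log_compose_log_action:
  fixes l :: "'a::idom fps"
  assumes "l $ 0 = 0" "l $ 1 = 1"
  shows "l oo log_action l a = fps_const a * l"
  unfolding log_action_def using assms comp_inverse[OF assms]
  by (simp add: fps_compose_assoc)

lemma subst1_log_fgl:
  fixes l :: "'a::idom fps"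
  assumes "l $ 0 = 0" "l $ 1 = 1"
  shows "subst1 l (log_fgl l) = subst1 l fps_x + subst1 l fps_y"
  unfolding log_fgl_def using assms comp_inverse[OF assms]
  by (simp add: subst1_compose subst1_fps_X)

lemma log_actionI:
  fixes l :: "'a::idom fps"
  assumes "l $ 0 = 0" "l $ 1 = 1" "E $ 0 = 0" "l oo E = fps_const a * l"
  shows "log_action l a = E"
  using fps_compose_left_cancel[of l "log_action l a" E] assms
  by (simp add: log_compose_log_action log_action_nth_0)

text \<open>
  The series \<open>l\<close> can be cancelled on the left of a composition, so
  \<open>l(F(x, y)) = l(x) + l(y)\<close> characterises \<open>F\<close>.
\<close>

lemma log_fglI:
  fixes l :: "'a::idom fps"
  assumes l: "l $ 0 = 0" "l $ 1 = 1" and F: "F $ 0 $ 0 = 0" "subst1 l F = subst1 l fps_x + subst1 l fps_y"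
  shows "log_fgl l = F"
proof (rule homogenize_inject)
  have eq: "homogenize (subst1 l (log_fgl l)) = homogenize (subst1 l F)"
    using assms by (simp add: subst1_log_fgl)
  show "homogenize (log_fgl l) = homogenize F"
    by (rule fps_compose_left_cancel[of "map_coeffs1 (\<lambda>c. [:c:]) l"])
       (use eq l F(1) in \<open>simp_all add: homogenize_subst1 log_fgl_nth_0 homogenize_nth_0 one_pCons\<close>)
qed

text \<open>
  In this form the logarithm turns every identity between values of the formal group law
  into one about addition.
\<close>

lemma log_compose_log_fgl:
  fixes l :: "'a::idom fps"
  assumes l: "l $ 0 = 0" "l $ 1 = 1" and u: "u $ 0 = 0" "v $ 0 = 0"
  shows "l oo fps_eval2 (log_fgl l) u v = (l oo u) + (l oo v)"
proof -
  have "l oo fps_eval2 (log_fgl l) u v = fps_eval2 (subst1 l (log_fgl l)) u v"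
    using l u by (simp add: fps_eval2_subst1 log_fgl_nth_0)
  also have "\<dots> = fps_eval2 (subst1 l fps_x + subst1 l fps_y) u v"
    by (simp only: subst1_log_fgl[OF l])
  also have "\<dots> = (l oo u) + (l oo v)"
    using u by (simp add: fps_eval2_subst1 fps_eval2_add fps_eval2_x fps_eval2_y)
  finally show ?thesis .
qed

lemma (in subring_hom) map_coeffs1_X: "map_coeffs1 h fps_X = fps_X"
  by (simp add: fps_eq_iff hom_0 hom_1 fps_X_def)

lemma (in subring_hom) map_coeffs2_xy:
  "map_coeffs2 h fps_x = fps_x" "map_coeffs2 h fps_y = fps_y"
  by (simp_all add: fps_eq_iff hom_0 hom_1 fps_X_def fps_x_def fps_y_def)

section \<open>Congruences modulo powers of an element\<close>

text \<open>
  Congruence modulo \<open>w\<^sup>j R\<close>, with the subring \<open>R\<close> explicit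
  since \<open>w\<close> is invertible in the ambient ring in all applications.
\<close>

definition cong_pow :: "'a::comm_ring_1 set \<Rightarrow> 'a \<Rightarrow> nat \<Rightarrow> 'a \<Rightarrow> 'a \<Rightarrow> bool" where
  "cong_pow R w j a b \<longleftrightarrow> (\<exists>c\<in>R. a - b = w ^ j * c)"

lemma cong_powI: "c \<in> R \<Longrightarrow> a - b = w ^ j * c \<Longrightarrow> cong_pow R w j a b"
  by (auto simp: cong_pow_def)

context
  fixes R :: "'a::comm_ring_1 set" and w :: 'a
  assumes R: "is_subring R" and w: "w \<in> R"
begin

lemma cong_pow_refl: "cong_pow R w j a a"
  by (rule cong_powI[OF subring_0[OF R]]) simp

lemma cong_pow_sym: "cong_pow R w j a b \<Longrightarrow> cong_pow R w j b a"
proof -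
  assume "cong_pow R w j a b"
  then obtain c where c: "c \<in> R" "a - b = w ^ j * c" by (auto simp: cong_pow_def)
  have "b - a = - (a - b)" by simp
  also have "\<dots> = w ^ j * (- c)" unfolding c(2) by simp
  finally show ?thesis by (rule cong_powI[OF subring_uminus[OF R c(1)]])
qed

lemma cong_pow_uminus: "cong_pow R w j a b \<Longrightarrow> cong_pow R w j (- a) (- b)"
  by (drule cong_pow_sym) (simp add: cong_pow_def)

lemma cong_pow_add:
  assumes "cong_pow R w j a b" "cong_pow R w j c d" shows "cong_pow R w j (a + c) (b + d)"
proof -
  obtain e f where "e \<in> R" "f \<in> R" "a - b = w ^ j * e" "c - d = w ^ j * f"
    using assms by (auto simp: cong_pow_def)
  then show ?thesis by (intro cong_powI[of "e + f"] subring_add[OF R]) (auto simp: algebra_simps)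
qed

lemma cong_pow_trans:
  assumes "cong_pow R w j a b" "cong_pow R w j b c" shows "cong_pow R w j a c"
proof -
  have "cong_pow R w j (a + b) (b + c)" by (rule cong_pow_add[OF assms])
  then show ?thesis unfolding cong_pow_def by (simp add: algebra_simps)
qed

lemma cong_pow_mult:
  assumes "cong_pow R w j a b" "cong_pow R w j c d" "a \<in> R" "d \<in> R"
  shows "cong_pow R w j (a * c) (b * d)"
proof -
  obtain e f where "e \<in> R" "f \<in> R" and ef: "a - b = w ^ j * e" "c - d = w ^ j * f"
    using assms by (auto simp: cong_pow_def)
  have "a * c - b * d = a * (c - d) + (a - b) * d" by (simp add: algebra_simps)
  also have "\<dots> = w ^ j * (a * f + e * d)" unfolding ef by (simp add: algebra_simps)
  finally show ?thesis
    by (rule cong_powI[rotated]) (use \<open>e \<in> R\<close> \<open>f \<in> R\<close> assms in \<open>auto intro!: subring_add[OF R] subring_mult[OF R]\<close>)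
qed

lemma cong_pow_power:
  assumes "cong_pow R w j a b" "a \<in> R" "b \<in> R"
  shows "cong_pow R w j (a ^ k) (b ^ k)"
  by (induction k) (auto intro!: cong_pow_mult cong_pow_refl assms subring_power[OF R])

lemma cong_pow_sum:
  "(\<And>x. x \<in> X \<Longrightarrow> cong_pow R w j (f x) (g x)) \<Longrightarrow> cong_pow R w j (sum f X) (sum g X)"
  by (induction X rule: infinite_finite_induct) (auto intro!: cong_pow_add cong_pow_refl)

lemma cong_pow_weaken:
  assumes "cong_pow R w j a b" "i \<le> j" shows "cong_pow R w i a b"
proof -
  obtain c where "c \<in> R" "a - b = w ^ j * c" using assms by (auto simp: cong_pow_def)
  then have "a - b = w ^ i * (w ^ (j - i) * c)"
    using assms(2) by (simp add: mult.assoc[symmetric] power_add[symmetric])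
  then show ?thesis
    by (rule cong_powI[rotated]) (auto intro!: subring_mult[OF R] subring_power[OF R] w \<open>c \<in> R\<close>)
qed

context
  fixes p :: nat and c0 :: 'a
  assumes p: "prime p" and c0: "c0 \<in> R" "of_nat p = w * c0"
begin

text \<open>
  The quotient of \<open>a\<^sup>p - b\<^sup>p\<close> by \<open>a - b\<close> is a sum of
  \<open>p\<close> terms each congruent to \<open>b\<^sup>p\<^sup>-\<^sup>1\<close> modulo
  \<open>w\<close>, hence divisible by \<open>w\<close>, as \<open>p\<close> is. So each
  \<open>p\<close>-th power improves a congruence by one power of \<open>w\<close>.
\<close>

lemma cong_pow_prime_power_step:
  assumes ab: "cong_pow R w (Suc j) a b" "a \<in> R" "b \<in> R"
  shows "cong_pow R w (Suc (Suc j)) (a ^ p) (b ^ p)"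
proof -
  define S where "S = (\<Sum>i<p. b ^ (p - Suc i) * a ^ i)"
  have ab1: "cong_pow R w 1 a b" using cong_pow_weaken[OF ab(1)] by simp
  have "cong_pow R w 1 S (\<Sum>i<p. b ^ (p - Suc i) * b ^ i)"
    unfolding S_def by (intro cong_pow_sum cong_pow_mult cong_pow_power cong_pow_refl ab ab1 subring_power[OF R])
  also have "(\<Sum>i<p. b ^ (p - Suc i) * b ^ i) = of_nat p * b ^ (p - 1)"
    by (simp add: power_add[symmetric])
  finally obtain c where "c \<in> R" "S - of_nat p * b ^ (p - 1) = w ^ 1 * c"
    by (auto simp: cong_pow_def)
  then have S: "S = w * (c + c0 * b ^ (p - 1))" unfolding c0 by (simp add: algebra_simps)
  obtain d where d: "d \<in> R" "a - b = w ^ Suc j * d" using ab(1) by (auto simp: cong_pow_def)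
  have "a ^ p - b ^ p = (a - b) * S" unfolding S_def by (rule power_diff_sumr2)
  also have "\<dots> = w ^ Suc (Suc j) * (d * (c + c0 * b ^ (p - 1)))"
    unfolding S d by simp
  finally show ?thesis
    by (rule cong_powI[rotated])
       (auto intro!: subring_add[OF R] subring_mult[OF R] subring_power[OF R] c0 ab d \<open>c \<in> R\<close>)
qed

lemma cong_pow_prime_power:
  assumes ab: "cong_pow R w (Suc j) a b" "a \<in> R" "b \<in> R"
  shows "cong_pow R w (Suc (j + s)) (a ^ (p ^ s)) (b ^ (p ^ s))"
proof (induction s)
  case (Suc s)
  have "cong_pow R w (Suc (Suc (j + s))) ((a ^ (p ^ s)) ^ p) ((b ^ (p ^ s)) ^ p)"
    by (intro cong_pow_prime_power_step Suc.IH subring_power[OF R] ab)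
  then show ?case by (simp add: power_mult[symmetric] mult.commute)
qed (use ab in simp)

lemma cong_pow_prime_power_iterate:
  assumes ab: "cong_pow R w 1 a b" "a \<in> R" "b \<in> R" and s: "s > 0"
  shows "cong_pow R w (Suc k) (a ^ ((p ^ s) ^ k)) (b ^ ((p ^ s) ^ k))"
proof -
  have "cong_pow R w (Suc (0 + s * k)) (a ^ (p ^ (s * k))) (b ^ (p ^ (s * k)))"
    using ab by (intro cong_pow_prime_power) auto
  then have "cong_pow R w (Suc (s * k)) (a ^ ((p ^ s) ^ k)) (b ^ ((p ^ s) ^ k))"
    by (simp add: power_mult)
  then show ?thesis by (rule cong_pow_weaken) (use s in \<open>cases s, auto\<close>)
qed

text \<open>
  The inner binomial coefficients of the expansion are divisible by \<open>p\<close>.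
\<close>

lemma cong_pow_prime_add:
  assumes "x \<in> R" "y \<in> R"
  shows "cong_pow R w 1 ((x + y) ^ p) (x ^ p + y ^ p)"
proof -
  define c where "c = (\<Sum>k\<in>{0<..<p}. of_nat ((p choose k) div p) * x ^ k * y ^ (p - k))"
  have p0: "p > 0" using p by (rule prime_gt_0_nat)
  have "(x + y) ^ p = (\<Sum>k\<le>p. of_nat (p choose k) * x ^ k * y ^ (p - k))"
    by (rule binomial_ring)
  also have "{..p} = insert 0 (insert p {0<..<p})" using p0 by auto
  also have "(\<Sum>k\<in>insert 0 (insert p {0<..<p}). of_nat (p choose k) * x ^ k * y ^ (p - k)) =
      y ^ p + (x ^ p + (\<Sum>k\<in>{0<..<p}. of_nat (p choose k) * x ^ k * y ^ (p - k)))"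
    using p0 by simp
  also have "(\<Sum>k\<in>{0<..<p}. of_nat (p choose k) * x ^ k * y ^ (p - k)) = of_nat p * c"
    unfolding c_def sum_distrib_left
  proof (rule sum.cong)
    fix k assume "k \<in> {0<..<p}"
    then have "p dvd (p choose k)" using p by (intro dvd_choose_prime) auto
    then have "of_nat (p choose k) = (of_nat p * of_nat ((p choose k) div p) :: 'a)"
      by (simp flip: of_nat_mult)
    then show "of_nat (p choose k) * x ^ k * y ^ (p - k) =
        of_nat p * (of_nat ((p choose k) div p) * x ^ k * y ^ (p - k))"
      by (simp add: mult.assoc)
  qed simp
  finally have "(x + y) ^ p - (x ^ p + y ^ p) = w ^ 1 * (c0 * c)"
    unfolding c0 by (simp add: algebra_simps)
  moreover have "c \<in> R" unfolding c_def
    by (intro subring_sum subring_mult subring_power subring_of_nat R assms)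
  ultimately show ?thesis
    by (intro cong_powI[of "c0 * c"] subring_mult[OF R] c0)
qed

lemma cong_pow_prime_power_add:
  assumes "x \<in> R" "y \<in> R"
  shows "cong_pow R w 1 ((x + y) ^ (p ^ s)) (x ^ (p ^ s) + y ^ (p ^ s))"
proof (induction s)
  case (Suc s)
  have "cong_pow R w 1 (((x + y) ^ (p ^ s)) ^ p) ((x ^ (p ^ s) + y ^ (p ^ s)) ^ p)"
    by (intro cong_pow_power Suc.IH subring_power[OF R] subring_add[OF R] assms)
  then have "cong_pow R w 1 (((x + y) ^ (p ^ s)) ^ p) ((x ^ (p ^ s)) ^ p + (y ^ (p ^ s)) ^ p)"
    by (rule cong_pow_trans) (intro cong_pow_prime_add subring_power[OF R] assms)
  then show ?case by (simp add: power_mult[symmetric] mult.commute)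
qed (simp add: cong_pow_refl)

end

end

section \<open>The logarithm of Lubin--Tate type\<close>

text \<open>
  The series \<open>x + c x^Q + c^2 x^(Q^2) + \<dots>\<close>, written with a sum over a set
  of at most one element. For \<open>c = 1 / \<pi>\<close> it is what Hazewinkel's recursion
  gives for the logarithm if \<open>v\<^sub>n = 1\<close>, the other
  \<open>v\<^sub>i\<close> vanish and \<open>Q = q\<^sup>n\<close>.
\<close>

definition lt_log :: "'s::comm_ring_1 \<Rightarrow> nat \<Rightarrow> 's fps" where
  "lt_log c Q = Abs_fps (\<lambda>m. \<Sum>k | Q ^ k = m. c ^ k)"

lemma lt_log_nth_power: "Q \<ge> 2 \<Longrightarrow> lt_log c Q $ (Q ^ k) = c ^ k"
proof -
  assume "Q \<ge> 2"
  then have "{j. Q ^ j = Q ^ k} = {k}" by (auto simp: power_inject_exp)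
  then show ?thesis by (simp add: lt_log_def)
qed

lemma lt_log_nth_0_1:
  assumes "Q \<ge> 2" shows "lt_log c Q $ 0 = 0" "lt_log c Q $ 1 = 1"
  using lt_log_nth_power[OF assms, of c 0] assms by (auto simp: lt_log_def)

lemma lt_log_compose_nth:
  assumes Q: "Q \<ge> 2" and E: "E $ 0 = 0" and "n \<le> N"
  shows "(lt_log c Q oo E) $ n = (\<Sum>k\<le>N. c ^ k * (E ^ (Q ^ k)) $ n)"
proof -
  have less: "k < Q ^ k" for k using Q by (simp add: power_gt_expt)
  have "lt_log c Q $ i * (E ^ i) $ n = (\<Sum>k\<le>N. if i = Q ^ k then c ^ k * (E ^ (Q ^ k)) $ n else 0)"
    if "i \<le> n" for i
  proof -
    have "{k. Q ^ k = i} = {k\<in>{..N}. i = Q ^ k}"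
      using that \<open>n \<le> N\<close> by (auto intro: order.trans[OF less_imp_le[OF less]])
    then have "lt_log c Q $ i * (E ^ i) $ n = (\<Sum>k\<in>{k\<in>{..N}. i = Q ^ k}. c ^ k * (E ^ (Q ^ k)) $ n)"
      by (simp add: lt_log_def sum_distrib_right)
    then show ?thesis by (simp only: sum.inter_filter[OF finite_atMost])
  qed
  then have "(lt_log c Q oo E) $ n =
      (\<Sum>i\<le>n. \<Sum>k\<le>N. if i = Q ^ k then c ^ k * (E ^ (Q ^ k)) $ n else 0)"
    by (simp add: fps_compose_nth atLeast0AtMost)
  also have "\<dots> = (\<Sum>k\<le>N. \<Sum>i\<le>n. if i = Q ^ k then c ^ k * (E ^ (Q ^ k)) $ n else 0)"
    by (rule sum.swap)
  also have "\<dots> = (\<Sum>k\<le>N. c ^ k * (E ^ (Q ^ k)) $ n)"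
    by (intro sum.cong refl) (auto simp: sum.delta fps_power_nth_below[OF E])
  finally show ?thesis .
qed

text \<open>
  The term \<open>k = 0\<close> of the series is split off; the others form \<open>c\<close>
  times the same series at \<open>E\<^sup>Q\<close>.
\<close>

lemma lt_log_functional_equation:
  fixes c :: "'s::comm_ring_1"
  assumes Q: "Q \<ge> 2" and E: "E $ 0 = 0"
  shows "lt_log c Q oo E = E + fps_const c * (lt_log c Q oo E ^ Q)"
proof (rule fps_ext)
  fix n
  have EQ: "(E ^ Q) $ 0 = 0" using E Q by (simp add: fps_power_zeroth zero_power)
  have "(lt_log c Q oo E) $ n = (\<Sum>k\<le>Suc n. c ^ k * (E ^ (Q ^ k)) $ n)"
    by (rule lt_log_compose_nth[OF Q E]) simp
  also have "\<dots> = E $ n + c * (\<Sum>k\<le>n. c ^ k * (E ^ (Q ^ Suc k)) $ n)"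
    by (simp add: sum.atMost_Suc_shift sum_distrib_left mult.assoc del: sum.atMost_Suc)
  also have "(\<Sum>k\<le>n. c ^ k * (E ^ (Q ^ Suc k)) $ n) = (lt_log c Q oo E ^ Q) $ n"
    by (simp add: lt_log_compose_nth[OF Q EQ order.refl] power_mult[symmetric])
  finally show "(lt_log c Q oo E) $ n = (E + fps_const c * (lt_log c Q oo E ^ Q)) $ n"
    by simp
qed

lemma fps_compose_X_power_nth:
  fixes f :: "'a::comm_ring_1 fps"
  assumes "Q > 0"
  shows "(f oo fps_X ^ Q) $ n = (if Q dvd n then f $ (n div Q) else 0)"
proof -
  have "(f oo fps_X ^ Q) $ n = (\<Sum>i\<in>{0..n}. if n = Q * i then f $ i else 0)"
    unfolding fps_compose_nth power_mult[symmetric] fps_X_power_nth by (intro sum.cong refl) simp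
  also have "\<dots> = (\<Sum>i\<in>{0..n}. if i = n div Q then (if Q dvd n then f $ i else 0) else 0)"
    using assms by (intro sum.cong refl) auto
  finally show ?thesis by (simp add: sum.delta)
qed

section \<open>Hazewinkel's functional equation lemma\<close>

text \<open>
  The setting of the functional equation lemma: \<open>\<sigma>\<close> lifts the
  \<open>Q\<close>-power map modulo \<open>w\<close>, and \<open>w'\<close> is the inverse
  of \<open>w\<close> in the ambient ring. It is used with \<open>\<sigma>\<close> the
  identity of \<open>A\<close> for the action, and with the endomorphism \<open>s \<mapsto>
  s\<^sup>Q\<close> of \<open>A[s]\<close> for the formal group law, which is brought to one
  variable by setting \<open>y = s x\<close>.
\<close>

locale frobenius_lift =
  fixes B :: "'s::idom set" and w w' :: 's and \<sigma> :: "'s \<Rightarrow> 's" and p s :: nat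
  assumes B: "is_subring B" and w: "w \<in> B" "w * w' = 1"
    and \<sigma>: "subring_hom UNIV \<sigma>" and \<sigma>_w': "\<sigma> w' = w'" and \<sigma>_B: "b \<in> B \<Longrightarrow> \<sigma> b \<in> B"
    and frobenius: "b \<in> B \<Longrightarrow> cong_pow B w 1 (b ^ (p ^ s)) (\<sigma> b)"
    and p: "prime p" "cong_pow B w 1 (of_nat p) 0" and s: "s > 0"
begin

abbreviation Q where "Q \<equiv> p ^ s"

abbreviation lg where "lg \<equiv> lt_log w' Q"

lemma Q_ge_2: "Q \<ge> 2"
  using prime_ge_2_nat[OF p(1)] s self_le_power[of p s] by linarith

lemma Q_power_ge_2: "2 \<le> Q ^ Suc k"
  by (rule order.trans[OF Q_ge_2 self_le_power]) (use Q_ge_2 in auto)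

sublocale \<sigma>: subring_hom UNIV \<sigma> by (rule \<sigma>)

sublocale \<sigma>_fps: subring_hom UNIV "map_coeffs1 \<sigma>"
  using \<sigma>.subring_hom_fps by simp

definition twist :: "'s fps \<Rightarrow> 's fps" where
  "twist g = map_coeffs1 \<sigma> g oo fps_X ^ Q"

lemma twist_nth: "twist g $ n = (if Q dvd n then \<sigma> (g $ (n div Q)) else 0)"
  unfolding twist_def using p(1) by (subst fps_compose_X_power_nth) (auto simp: prime_gt_0_nat)

lemma X_power_nth_0: "(fps_X ^ Q) $ 0 = (0::'s)"
  using prime_gt_0_nat[OF p(1)] by (simp add: fps_X_power_nth)

lemma twist_add: "twist (f + g) = twist f + twist g"
  by (simp add: twist_def \<sigma>_fps.hom_add fps_compose_add_distrib)

lemma twist_mult: "twist (f * g) = twist f * twist g"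
  by (simp add: twist_def \<sigma>_fps.hom_mult fps_compose_mult_distrib[OF X_power_nth_0])

lemma twist_const: "twist (fps_const c) = fps_const (\<sigma> c)"
proof -
  have "map_coeffs1 \<sigma> (fps_const c) = fps_const (\<sigma> c)" by (simp add: fps_eq_iff \<sigma>.hom_0)
  then show ?thesis by (simp add: twist_def)
qed

lemma twist_X: "twist fps_X = fps_X ^ Q"
  unfolding twist_def \<sigma>.map_coeffs1_X by (rule fps_X_fps_compose_startby0[OF X_power_nth_0])

lemma twist_power: "twist (f ^ k) = twist f ^ k"
proof (induction k)
  case 0
  show ?case using twist_const[of 1] by (simp add: \<sigma>.hom_1)
qed (simp add: twist_mult)

lemma twist_nth_0: "g $ 0 = 0 \<Longrightarrow> twist g $ 0 = 0"
  by (simp add: twist_nth \<sigma>.hom_0)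

lemma twist_lg_compose:
  assumes "E $ 0 = 0" shows "twist (lg oo E) = lg oo twist E"
proof -
  have "map_coeffs1 \<sigma> lg = lg"
    by (simp add: fps_eq_iff lt_log_def \<sigma>.hom_sum \<sigma>.hom_power \<sigma>_w')
  then show ?thesis
    using assms by (simp add: twist_def \<sigma>.map_coeffs1_compose fps_compose_assoc[OF X_power_nth_0] \<sigma>.hom_0)
qed

text \<open>
  If \<open>E\<close> is compatible with the lift of the \<open>Q\<close>-power map, then
  twisting \<open>lg(E)\<close> is the same as inserting \<open>E\<^sup>Q\<close>, and the
  functional equation of \<open>lg\<close> leaves \<open>E\<close>.
\<close>

lemma lg_minus_twist:
  assumes "E $ 0 = 0" "twist E = E ^ Q"
  shows "(lg oo E) - fps_const w' * twist (lg oo E) = E"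
  unfolding twist_lg_compose[OF assms(1)] assms(2)
  by (subst lt_log_functional_equation[OF Q_ge_2 assms(1)]) simp

abbreviation R where "R \<equiv> fps_over B"

lemma R: "is_subring R" by (rule is_subring_fps_over[OF B])

lemma const_mem: "c \<in> B \<Longrightarrow> fps_const c \<in> R"
  using subring_0[OF B] by (auto simp: fps_over_def)

lemma X_mem: "fps_X \<in> R"
  using subring_0[OF B] subring_1[OF B] by (auto simp: fps_over_def fps_X_def)

lemma cutoff_mem: "(\<And>i. i < n \<Longrightarrow> f $ i \<in> B) \<Longrightarrow> fps_cutoff n f \<in> R"
  using subring_0[OF B] by (auto simp: fps_over_def)

lemma twist_mem: "f \<in> R \<Longrightarrow> twist f \<in> R"
  using subring_0[OF B] \<sigma>_B by (auto simp: fps_over_def twist_nth)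

lemma p_fps: obtains c0 where "c0 \<in> R" "of_nat p = fps_const w * c0"
proof -
  obtain c where "c \<in> B" "of_nat p = w * c" using p(2) by (auto simp: cong_pow_def)
  then show ?thesis
    by (intro that[of "fps_const c"] const_mem) (simp_all add: fps_of_nat[symmetric])
qed

lemma cong_pow_const: "cong_pow B w j b c \<Longrightarrow> cong_pow R (fps_const w) j (fps_const b) (fps_const c)"
  unfolding cong_pow_def
  by (auto simp: fps_const_power intro!: bexI[OF _ const_mem])

lemma cong_pow_nth: "cong_pow R (fps_const w) j f g \<Longrightarrow> cong_pow B w j (f $ n) (g $ n)"
proof -
  assume "cong_pow R (fps_const w) j f g"
  then obtain c where c: "c \<in> R" "f - g = fps_const w ^ j * c" by (auto simp: cong_pow_def)
  have "(f - g) $ n = w ^ j * c $ n" unfolding c(2) fps_const_power by simp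
  then show ?thesis using c(1) by (intro cong_powI[of "c $ n"]) (auto simp: fps_over_def)
qed

text \<open>
  Modulo \<open>w\<close> the \<open>Q\<close>-th power is additive and is
  \<open>\<sigma>\<close> on coefficients. The statement is about truncations because
  integrality is only known below degree \<open>N\<close> when it is used.
\<close>

lemma frobenius_cutoff:
  assumes "\<And>i. i < N \<Longrightarrow> E $ i \<in> B"
  shows "cong_pow R (fps_const w) 1 (fps_cutoff N E ^ Q) (twist (fps_cutoff N E))"
  using assms
proof (induction N)
  case 0
  have "twist 0 = 0" using twist_const[of 0] by (simp add: \<sigma>.hom_0)
  moreover have "(0 :: 's fps) ^ Q = 0"
    using prime_gt_0_nat[OF p(1)] by (simp add: zero_power)
  ultimately show ?case
    unfolding fps_cutoff_0 by (simp only: cong_pow_refl[OF R const_mem[OF w(1)]])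
next
  case (Suc N)
  let ?W = "fps_const w"
  define x where "x = fps_cutoff N E"
  define y where "y = fps_const (E $ N) * fps_X ^ N"
  obtain c0 where c0: "c0 \<in> R" "of_nat p = fps_const w * c0" by (rule p_fps)
  have W: "?W \<in> R" by (rule const_mem[OF w(1)])
  have EN: "E $ N \<in> B" using Suc.prems by simp
  have x: "x \<in> R" unfolding x_def by (rule cutoff_mem) (use Suc.prems in auto)
  have y: "y \<in> R" unfolding y_def
    by (intro subring_mult[OF R] subring_power[OF R] const_mem X_mem EN)
  have xy: "fps_cutoff (Suc N) E = x + y"
    by (auto simp: fps_eq_iff x_def y_def less_Suc_eq)
  have "cong_pow R ?W 1 (y ^ Q) (twist y)"
  proof -
    have "cong_pow R ?W 1 (fps_const ((E $ N) ^ Q)) (fps_const (\<sigma> (E $ N)))"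
      by (intro cong_pow_const frobenius EN)
    then have "cong_pow R ?W 1 (fps_const ((E $ N) ^ Q) * fps_X ^ (N * Q)) (fps_const (\<sigma> (E $ N)) * fps_X ^ (N * Q))"
      by (rule cong_pow_mult[OF R W])
         (intro cong_pow_refl[OF R W] const_mem subring_power[OF B] subring_power[OF R] EN X_mem)+
    moreover have "y ^ Q = fps_const ((E $ N) ^ Q) * fps_X ^ (N * Q)"
      unfolding y_def power_mult_distrib fps_const_power power_mult[symmetric] ..
    moreover have "twist y = fps_const (\<sigma> (E $ N)) * fps_X ^ (N * Q)"
      unfolding y_def twist_mult twist_const twist_power twist_X power_mult[symmetric] by (simp add: mult.commute)
    ultimately show ?thesis by simp
  qed
  moreover have "cong_pow R ?W 1 (x ^ Q) (twist x)"
    unfolding x_def using Suc by simp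
  moreover have "cong_pow R ?W 1 ((x + y) ^ Q) (x ^ Q + y ^ Q)"
    by (rule cong_pow_prime_power_add[OF R W p(1) c0 x y])
  ultimately show ?case
    unfolding xy twist_add by (meson cong_pow_trans[OF R W] cong_pow_add[OF R W])
qed

lemma w_power_cancel: "w' ^ k * (w ^ k * c) = c"
proof -
  have "w' ^ k * (w ^ k * c) = (w * w') ^ k * c" unfolding power_mult_distrib by (simp only: mult_ac)
  then show ?thesis by (simp add: w(2))
qed

text \<open>
  Induction on the degree: if \<open>E\<close> is integral below degree \<open>n\<close>,
  then \<open>E\<^sup>Q\<close> and \<open>twist E\<close> agree modulo \<open>w\<close> up
  to truncation, hence their \<open>Q\<^sup>k\<close>-th powers agree modulo
  \<open>w\<^sup>k\<^sup>+\<^sup>1\<close>. This cancels the denominators of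
  \<open>lg\<close> in the coefficient of \<open>x\<^sup>n\<close> of \<open>lg(E) - w'
  twist(lg(E))\<close>, which therefore differs from that of \<open>E\<close> by an element
  of \<open>B\<close>.
\<close>

theorem lg_inverse_integral:
  assumes E: "E $ 0 = 0" and g: "(lg oo E) - fps_const w' * twist (lg oo E) \<in> R"
  shows "E \<in> R"
proof -
  have "E $ n \<in> B" for n
  proof (induction n rule: less_induct)
    case (less n)
    show ?case
    proof (cases "n = 0")
      case True then show ?thesis using E subring_0[OF B] by simp
    next
      case False
      let ?W = "fps_const w"
      define E' where "E' = fps_cutoff n E"
      have E'0: "E' $ 0 = 0" using E by (simp add: E'_def)
      have E': "E' \<in> R" unfolding E'_def by (rule cutoff_mem) (use less in auto)
      have W: "?W \<in> R" by (rule const_mem[OF w(1)])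
      obtain c0 where c0: "c0 \<in> R" "of_nat p = fps_const w * c0" by (rule p_fps)
      have frob: "cong_pow R ?W 1 (E' ^ Q) (twist E')"
        unfolding E'_def by (rule frobenius_cutoff) (use less in auto)
      have summand: "w' ^ Suc k * ((E ^ (Q ^ Suc k)) $ n - (twist E ^ (Q ^ k)) $ n) \<in> B" for k
      proof -
        have "cong_pow R ?W (Suc k) ((E' ^ Q) ^ (Q ^ k)) (twist E' ^ (Q ^ k))"
          by (intro cong_pow_prime_power_iterate[OF R W p(1) c0] frob s subring_power[OF R] E' twist_mem)
        then have "cong_pow B w (Suc k) (((E' ^ Q) ^ (Q ^ k)) $ n) ((twist E' ^ (Q ^ k)) $ n)"
          by (rule cong_pow_nth)
        moreover have "((E' ^ Q) ^ (Q ^ k)) $ n = (E ^ (Q ^ Suc k)) $ n"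
        proof -
          have "(E' ^ (Q ^ Suc k)) $ n = (E ^ (Q ^ Suc k)) $ n"
            using E E'0 Q_power_ge_2 by (intro fps_power_nth_cong_below) (auto simp: E'_def simp del: power_Suc)
          then show ?thesis by (simp add: power_mult[symmetric])
        qed
        moreover have "(twist E' ^ (Q ^ k)) $ n = (twist E ^ (Q ^ k)) $ n"
        proof (rule fps_power_nth_cong)
          fix i assume "i \<le> n"
          then have "i div Q < n" using False Q_ge_2
            by (cases "i = 0") (auto intro: less_le_trans[OF div_less_dividend])
          then show "twist E' $ i = twist E $ i" by (simp add: twist_nth E'_def)
        qed
        ultimately obtain c where "c \<in> B" "(E ^ (Q ^ Suc k)) $ n - (twist E ^ (Q ^ k)) $ n = w ^ Suc k * c"
          by (auto simp: cong_pow_def)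
        then show ?thesis by (simp only: w_power_cancel)
      qed
      have tE: "twist E $ 0 = 0" by (rule twist_nth_0[OF E])
      have "(lg oo E) $ n = E $ n + (\<Sum>k\<le>n. w' ^ Suc k * (E ^ (Q ^ Suc k)) $ n)"
        by (simp add: lt_log_compose_nth[OF Q_ge_2 E, of n "Suc n"] sum.atMost_Suc_shift del: sum.atMost_Suc power_Suc)
      moreover have "(fps_const w' * twist (lg oo E)) $ n = (\<Sum>k\<le>n. w' ^ Suc k * (twist E ^ (Q ^ k)) $ n)"
        by (simp add: twist_lg_compose[OF E] lt_log_compose_nth[OF Q_ge_2 tE order.refl] sum_distrib_left mult.assoc)
      ultimately have "E $ n = ((lg oo E) - fps_const w' * twist (lg oo E)) $ n -
          (\<Sum>k\<le>n. w' ^ Suc k * ((E ^ (Q ^ Suc k)) $ n - (twist E ^ (Q ^ k)) $ n))"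
        by (simp add: right_diff_distrib sum_subtractf del: power_Suc)
      then show ?thesis
        using g summand by (auto simp: fps_over_def simp del: fps_sub_nth intro!: subring_diff[OF B] subring_sum[OF B])
    qed
  qed
  then show ?thesis by (simp add: fps_over_def)
qed

text \<open>
  As before, a congruence of \<open>E\<close> and \<open>F\<close> modulo \<open>w\<close>
  below degree \<open>n\<close> improves on taking powers by more than the denominators of
  \<open>lg\<close>, so that the higher terms of \<open>lg\<close> do not matter modulo
  \<open>w\<close> in degree \<open>n\<close>.
\<close>

theorem lg_cong_cancel:
  assumes E: "E $ 0 = 0" "E \<in> R" and F: "F $ 0 = 0" "F \<in> R"
    and g: "\<And>n. cong_pow B w 1 ((lg oo E) $ n) ((lg oo F) $ n)"
  shows "cong_pow B w 1 (E $ n) (F $ n)"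
proof (induction n rule: less_induct)
  case (less n)
  let ?W = "fps_const w"
  define E' where "E' = fps_cutoff n E"
  define F' where "F' = fps_cutoff n F"
  have 0: "E' $ 0 = 0" "F' $ 0 = 0" using E F by (simp_all add: E'_def F'_def)
  have W: "?W \<in> R" by (rule const_mem[OF w(1)])
  obtain c0 where c0: "c0 \<in> R" "of_nat p = fps_const w * c0" by (rule p_fps)
  have mem: "E' \<in> R" "F' \<in> R"
    unfolding E'_def F'_def by (rule cutoff_mem; use E F in \<open>simp add: fps_over_def\<close>)+
  have "\<forall>i. \<exists>c\<in>B. i < n \<longrightarrow> E $ i - F $ i = w * c"
    using less subring_0[OF B] unfolding cong_pow_def by auto
  then obtain c where c: "\<And>i. c i \<in> B" "\<And>i. i < n \<Longrightarrow> E $ i - F $ i = w * c i" by metis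
  have "cong_pow R ?W 1 E' F'"
    by (rule cong_powI[of "fps_cutoff n (Abs_fps c)"])
       (auto simp: fps_eq_iff E'_def F'_def c intro!: cutoff_mem)
  then have "cong_pow R ?W (Suc k) (E' ^ (Q ^ k)) (F' ^ (Q ^ k))" for k
    by (intro cong_pow_prime_power_iterate[OF R W p(1) c0] s mem)
  then have *: "cong_pow B w (Suc k) ((E' ^ (Q ^ k)) $ n) ((F' ^ (Q ^ k)) $ n)" for k
    by (rule cong_pow_nth)
  have summand: "cong_pow B w 1 (w' ^ Suc k * (E ^ (Q ^ Suc k)) $ n) (w' ^ Suc k * (F ^ (Q ^ Suc k)) $ n)" for k
  proof -
    have "(E' ^ (Q ^ Suc k)) $ n = (E ^ (Q ^ Suc k)) $ n" "(F' ^ (Q ^ Suc k)) $ n = (F ^ (Q ^ Suc k)) $ n"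
      using E F 0 Q_power_ge_2 by (intro fps_power_nth_cong_below; auto simp: E'_def F'_def simp del: power_Suc)+
    then obtain c where "c \<in> B" "(E ^ (Q ^ Suc k)) $ n - (F ^ (Q ^ Suc k)) $ n = w ^ Suc (Suc k) * c"
      using *[of "Suc k"] by (auto simp: cong_pow_def)
    then have "w' ^ Suc k * (E ^ (Q ^ Suc k)) $ n - w' ^ Suc k * (F ^ (Q ^ Suc k)) $ n = w' ^ Suc k * (w ^ Suc k * (w * c))"
      by (simp only: right_diff_distrib[symmetric]) (simp add: mult_ac)
    then show ?thesis using \<open>c \<in> B\<close> unfolding w_power_cancel by (intro cong_powI[of c]) auto
  qed
  have eq: "(lg oo E) $ n = E $ n + (\<Sum>k\<le>n. w' ^ Suc k * (E ^ (Q ^ Suc k)) $ n)" if "E $ 0 = 0" for E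
    by (simp add: lt_log_compose_nth[OF Q_ge_2 that, of n "Suc n"] sum.atMost_Suc_shift del: sum.atMost_Suc power_Suc)
  define S where "S E = (\<Sum>k\<le>n. w' ^ Suc k * (E ^ (Q ^ Suc k)) $ n)" for E
  have S: "cong_pow B w 1 (- S E) (- S F)"
    unfolding S_def by (intro cong_pow_uminus[OF B w(1)] cong_pow_sum[OF B w(1)] summand)
  from cong_pow_add[OF B w(1) g[of n] S] show ?case
    using eq[OF E(1)] eq[OF F(1)] by (simp add: S_def)
qed

end

section \<open>The classifying map as a ring homomorphism\<close>

definition monomial_value :: "(nat \<Rightarrow> 'b::comm_ring_1) \<Rightarrow> (nat \<Rightarrow>\<^sub>0 nat) \<Rightarrow> 'b" where
  "monomial_value g m = (\<Prod>i\<in>Poly_Mapping.keys m. g i ^ Poly_Mapping.lookup m i)"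

lemma monomial_value_superset:
  "finite I \<Longrightarrow> Poly_Mapping.keys m \<subseteq> I \<Longrightarrow> monomial_value g m = (\<Prod>i\<in>I. g i ^ Poly_Mapping.lookup m i)"
  unfolding monomial_value_def by (rule prod.mono_neutral_left) (auto simp: in_keys_iff)

lemma monomial_value_add: "monomial_value g (m + m') = monomial_value g m * monomial_value g m'"
proof -
  let ?I = "Poly_Mapping.keys m \<union> Poly_Mapping.keys m'"
  have "Poly_Mapping.keys (m + m') \<subseteq> ?I" by (rule Poly_Mapping.keys_add)
  then show ?thesis
    by (simp add: monomial_value_superset[where I = ?I] lookup_add power_add prod.distrib)
qed

lemma monomial_value_0 [simp]: "monomial_value g 0 = 1"
  by (simp add: monomial_value_def)

lemma poly_mapping_eq_sum_single:
  "P = (\<Sum>m\<in>Poly_Mapping.keys P. Poly_Mapping.single m (Poly_Mapping.lookup P m))"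
  by (rule poly_mapping_eqI) (simp add: lookup_sum lookup_single when_def sum.delta in_keys_iff)

lemma poly_mapping_mult_eq_sum_single:
  fixes P Q :: "'k::comm_monoid_add \<Rightarrow>\<^sub>0 'a::comm_ring_1"
  shows "P * Q = (\<Sum>m\<in>Poly_Mapping.keys P. \<Sum>m'\<in>Poly_Mapping.keys Q.
      Poly_Mapping.single (m + m') (Poly_Mapping.lookup P m * Poly_Mapping.lookup Q m'))"
proof -
  have "P * Q = (\<Sum>m\<in>Poly_Mapping.keys P. Poly_Mapping.single m (Poly_Mapping.lookup P m)) *
      (\<Sum>m\<in>Poly_Mapping.keys Q. Poly_Mapping.single m (Poly_Mapping.lookup Q m))"
    by (rule arg_cong2[of P _ Q _ "(*)"]) (rule poly_mapping_eq_sum_single)+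
  also have "\<dots> = (\<Sum>m\<in>Poly_Mapping.keys P. \<Sum>m'\<in>Poly_Mapping.keys Q.
      Poly_Mapping.single (m + m') (Poly_Mapping.lookup P m * Poly_Mapping.lookup Q m'))"
    by (simp only: sum_product mult_single)
  finally show ?thesis .
qed

definition coeffs_in :: "'a::zero set \<Rightarrow> ('k \<Rightarrow>\<^sub>0 'a) set" where
  "coeffs_in A = {P. \<forall>m. Poly_Mapping.lookup P m \<in> A}"

lemma (in subring_hom) subring_coeffs_in:
  "is_subring (coeffs_in A :: ('k::comm_monoid_add \<Rightarrow>\<^sub>0 'a) set)"
proof -
  have add: "P + Q \<in> coeffs_in A" if "P \<in> coeffs_in A" "Q \<in> coeffs_in A" for P Q :: "'k \<Rightarrow>\<^sub>0 'a"
    using that by (auto simp: coeffs_in_def lookup_add subring_add[OF subring])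
  have zero: "(0 :: 'k \<Rightarrow>\<^sub>0 'a) \<in> coeffs_in A"
    by (simp add: coeffs_in_def subring_0[OF subring])
  have single: "Poly_Mapping.single m a \<in> coeffs_in A" if "a \<in> A" for m :: 'k and a
    using that by (auto simp: coeffs_in_def lookup_single when_def subring_0[OF subring])
  have sum: "sum f X \<in> coeffs_in A" if "\<And>x. x \<in> X \<Longrightarrow> f x \<in> coeffs_in A" for X and f :: "'k \<Rightarrow> 'k \<Rightarrow>\<^sub>0 'a"
    using that by (induction X rule: infinite_finite_induct) (auto simp: add zero)
  have mult: "P * Q \<in> coeffs_in A" if "P \<in> coeffs_in A" "Q \<in> coeffs_in A" for P Q :: "'k \<Rightarrow>\<^sub>0 'a"
  proof -
    show ?thesis
      unfolding poly_mapping_mult_eq_sum_single[of P Q]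
      using that by (intro sum single subring_mult[OF subring]) (auto simp: coeffs_in_def)
  qed
  have "(1 :: 'k \<Rightarrow>\<^sub>0 'a) \<in> coeffs_in A"
    using single[OF subring_1[OF subring], of 0] by (simp add: single_one)
  moreover have "- P \<in> coeffs_in A" if "P \<in> coeffs_in A" for P :: "'k \<Rightarrow>\<^sub>0 'a"
    using that by (auto simp: coeffs_in_def subring_uminus[OF subring])
  ultimately show ?thesis using add mult by (auto simp: is_subring_def)
qed

context
  fixes A :: "'a::field set" and h :: "'a \<Rightarrow> 'b::field" and g :: "nat \<Rightarrow> 'b"
  assumes h: "subring_hom A h"
begin

interpretation subring_hom A h by (rule h)

lemma classifying_map_superset:
  assumes "finite S" "Poly_Mapping.keys P \<subseteq> S"
  shows "classifying_map h g P = (\<Sum>m\<in>S. h (Poly_Mapping.lookup P m) * monomial_value g m)"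
  unfolding classifying_map_def monomial_value_def using assms
  by (intro sum.mono_neutral_left) (auto simp: in_keys_iff hom_0)

lemma classifying_map_single: "classifying_map h g (Poly_Mapping.single m a) = h a * monomial_value g m"
  by (subst classifying_map_superset[of "{m}"]) auto

text \<open>
  The classifying map evaluates polynomials with coefficients in \<open>A\<close>.
  Multiplicativity is reduced to monomials by writing both factors as sums of monomials.
\<close>

lemma subring_hom_classifying_map: "subring_hom (coeffs_in A) (classifying_map h g)"
proof
  show sub: "is_subring (coeffs_in A :: 'a vpoly set)" by (rule subring_coeffs_in)
  show "classifying_map h g 1 = 1"
    using classifying_map_single[of 0 1] by (simp add: single_one hom_1)
  fix P Q :: "'a vpoly" assume PQ: "P \<in> coeffs_in A" "Q \<in> coeffs_in A"
  have add: "classifying_map h g (P + Q) = classifying_map h g P + classifying_map h g Q"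
    if "P \<in> coeffs_in A" "Q \<in> coeffs_in A" for P Q :: "'a vpoly"
  proof -
    let ?S = "Poly_Mapping.keys P \<union> Poly_Mapping.keys Q"
    have "Poly_Mapping.keys (P + Q) \<subseteq> ?S" by (rule Poly_Mapping.keys_add)
    then show ?thesis using that
      by (simp add: classifying_map_superset[where S = ?S] lookup_add coeffs_in_def hom_add
          distrib_right sum.distrib)
  qed
  show "classifying_map h g (P + Q) = classifying_map h g P + classifying_map h g Q"
    by (rule add[OF PQ])
  have single: "Poly_Mapping.single m a \<in> coeffs_in A" if "a \<in> A" for m :: "nat \<Rightarrow>\<^sub>0 nat" and a
    using that by (auto simp: coeffs_in_def lookup_single when_def subring_0[OF subring])
  have sum: "classifying_map h g (sum f X) = (\<Sum>x\<in>X. classifying_map h g (f x))"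
    if "\<And>x. x \<in> X \<Longrightarrow> f x \<in> coeffs_in A" for X and f :: "(nat \<Rightarrow>\<^sub>0 nat) \<Rightarrow> 'a vpoly"
    using that
  proof (induction X rule: infinite_finite_induct)
    case (insert x X)
    then show ?case by (simp add: add subring_sum[OF sub])
  qed (simp_all add: classifying_map_def)
  have mem: "Poly_Mapping.lookup P m \<in> A" "Poly_Mapping.lookup Q m \<in> A" for m
    using PQ by (auto simp: coeffs_in_def)
  have "classifying_map h g (P * Q) = classifying_map h g
      (\<Sum>m\<in>Poly_Mapping.keys P. \<Sum>m'\<in>Poly_Mapping.keys Q.
        Poly_Mapping.single (m + m') (Poly_Mapping.lookup P m * Poly_Mapping.lookup Q m'))"
    unfolding poly_mapping_mult_eq_sum_single ..
  also have "\<dots> = (\<Sum>m\<in>Poly_Mapping.keys P. \<Sum>m'\<in>Poly_Mapping.keys Q.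
      classifying_map h g (Poly_Mapping.single (m + m') (Poly_Mapping.lookup P m * Poly_Mapping.lookup Q m')))"
    by (simp add: sum subring_sum[OF sub] single subring_mult[OF subring] mem)
  also have "\<dots> = (\<Sum>m\<in>Poly_Mapping.keys P. \<Sum>m'\<in>Poly_Mapping.keys Q.
      (h (Poly_Mapping.lookup P m) * monomial_value g m) * (h (Poly_Mapping.lookup Q m') * monomial_value g m'))"
    by (simp add: classifying_map_single hom_mult mem monomial_value_add mult_ac)
  also have "\<dots> = classifying_map h g P * classifying_map h g Q"
    by (simp add: classifying_map_superset[OF finite_keys order.refl] sum_product)
  finally show "classifying_map h g (P * Q) = classifying_map h g P * classifying_map h g Q" .
qed

lemma classifying_map_vconst: "classifying_map h g (vconst c) = h c"
  unfolding vconst_def by (simp add: classifying_map_single)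

lemma classifying_map_vvar: "classifying_map h g (vvar i) = g i"
  unfolding vvar_def by (simp add: classifying_map_single hom_1 monomial_value_def)

end

lemma subring_hom_vconst: "subring_hom UNIV (vconst :: 'a::field \<Rightarrow> 'a vpoly)"
  by unfold_locales (simp_all add: vconst_def single_add mult_single single_one)

lemma subring_hom_id: "is_subring A \<Longrightarrow> subring_hom A (\<lambda>x. x)"
  by (simp add: subring_hom_def)

text \<open>
  If the values of \<open>P\<close> at \<open>v\<^sub>n = c\<^sup>k\<close>, with all other
  variables set to \<open>0\<close>, are \<open>c\<^sup>m r\<close> for every \<open>c
  \<noteq> 0\<close> in an infinite field, then at most one monomial of \<open>P\<close>
  involves no variable but \<open>v\<^sub>n\<close>, and its coefficient is
  \<open>r\<close>. So \<open>red r\<close> determines the corresponding values of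
  \<open>P\<close> over the other field.
\<close>

lemma classifying_map_specialize:
  fixes P :: "'a::field vpoly" and red :: "'a \<Rightarrow> 'b::field"
  assumes inf: "infinite (UNIV :: 'a set)" and red: "red 0 = 0" and k: "k > 0"
    and P: "\<And>c. c \<noteq> 0 \<Longrightarrow> classifying_map (\<lambda>x. x) (\<lambda>i. if i = n then c ^ k else 0) P = c ^ m * r"
  shows "classifying_map red (\<lambda>i. if i = n then b ^ k else 0) P = b ^ m * red r"
proof -
  define S where "S = {\<mu>\<in>Poly_Mapping.keys P. Poly_Mapping.keys \<mu> \<subseteq> {n}}"
  have "finite S" by (simp add: S_def)
  have mono: "monomial_value (\<lambda>i. if i = n then x ^ k else 0) \<mu> =
      (if Poly_Mapping.keys \<mu> \<subseteq> {n} then x ^ (Poly_Mapping.lookup \<mu> n * k) else 0)"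
    for x :: "'c::field" and \<mu>
  proof (cases "Poly_Mapping.keys \<mu> \<subseteq> {n}")
    case True
    then show ?thesis
      by (simp add: monomial_value_superset[of "{n}"] power_mult[symmetric] mult.commute)
  next
    case False
    then obtain i where "i \<in> Poly_Mapping.keys \<mu>" "i \<noteq> n" by auto
    then have "\<exists>i\<in>Poly_Mapping.keys \<mu>. (if i = n then x ^ k else 0) ^ Poly_Mapping.lookup \<mu> i = 0"
      by (intro bexI[of _ i]) (auto simp: in_keys_iff zero_power)
    then show ?thesis using False by (auto simp: monomial_value_def)
  qed
  have cm: "classifying_map f (\<lambda>i. if i = n then x ^ k else 0) P =
      (\<Sum>\<mu>\<in>S. f (Poly_Mapping.lookup P \<mu>) * x ^ (Poly_Mapping.lookup \<mu> n * k))"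
    for f and x :: "'c::field"
  proof -
    have "classifying_map f (\<lambda>i. if i = n then x ^ k else 0) P =
      (\<Sum>\<mu>\<in>Poly_Mapping.keys P. f (Poly_Mapping.lookup P \<mu>) *
         (if Poly_Mapping.keys \<mu> \<subseteq> {n} then x ^ (Poly_Mapping.lookup \<mu> n * k) else 0))"
      unfolding classifying_map_def monomial_value_def[symmetric] mono ..
    also have "\<dots> = (\<Sum>\<mu>\<in>S. f (Poly_Mapping.lookup P \<mu>) *
         (if Poly_Mapping.keys \<mu> \<subseteq> {n} then x ^ (Poly_Mapping.lookup \<mu> n * k) else 0))"
      by (rule sum.mono_neutral_right) (auto simp: S_def)
    finally show ?thesis by (simp add: S_def)
  qed
  define pp where "pp = (\<Sum>\<mu>\<in>S. Polynomial.monom (Poly_Mapping.lookup P \<mu>) (Poly_Mapping.lookup \<mu> n * k))"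
  have pp: "pp = Polynomial.monom r m"
  proof (rule poly_eqI_infinite)
    show "infinite (UNIV - {0 :: 'a})" using inf by simp
    fix c :: 'a assume "c \<in> UNIV - {0}"
    then show "poly pp c = poly (Polynomial.monom r m) c"
      using P[of c] unfolding cm by (simp add: pp_def poly_sum poly_monom mult.commute)
  qed
  have inj: "\<mu> = \<nu>" if "\<mu> \<in> S" "\<nu> \<in> S" "Poly_Mapping.lookup \<mu> n * k = Poly_Mapping.lookup \<nu> n * k" for \<mu> \<nu>
  proof (rule poly_mapping_eqI)
    fix i
    have "i \<notin> Poly_Mapping.keys \<mu> \<and> i \<notin> Poly_Mapping.keys \<nu>" if "i \<noteq> n"
      using that \<open>\<mu> \<in> S\<close> \<open>\<nu> \<in> S\<close> by (auto simp: S_def)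
    then show "Poly_Mapping.lookup \<mu> i = Poly_Mapping.lookup \<nu> i"
      using that(3) k by (cases "i = n") (auto simp: in_keys_iff)
  qed
  have coeff: "Poly_Mapping.lookup P \<mu> = r \<and> Poly_Mapping.lookup \<mu> n * k = m" if \<mu>: "\<mu> \<in> S" for \<mu>
  proof -
    have "poly.coeff pp (Poly_Mapping.lookup \<mu> n * k) =
        (\<Sum>\<nu>\<in>S. if \<nu> = \<mu> then Poly_Mapping.lookup P \<nu> else 0)"
      unfolding pp_def coeff_sum coeff_monom using inj[OF _ \<mu>] by (intro sum.cong) auto
    also have "\<dots> = Poly_Mapping.lookup P \<mu>" using \<open>finite S\<close> \<mu> by simp
    finally have "Poly_Mapping.lookup P \<mu> = (if Poly_Mapping.lookup \<mu> n * k = m then r else 0)"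
      unfolding pp by auto
    moreover have "Poly_Mapping.lookup P \<mu> \<noteq> 0" using \<mu> by (auto simp: S_def in_keys_iff)
    ultimately show ?thesis by (auto split: if_splits)
  qed
  show ?thesis
  proof (cases "S = {}")
    case True
    then have "Polynomial.monom r m = 0" using pp by (simp add: pp_def)
    then show ?thesis unfolding cm using True red by simp
  next
    case False
    then obtain \<mu> where \<mu>: "\<mu> \<in> S" by auto
    then have "S = {\<mu>}" using coeff inj by blast
    then show ?thesis unfolding cm using coeff[OF \<mu>] by (simp add: mult.commute)
  qed
qed

section \<open>Naturality and rescaling of the logarithm\<close>

lemma map_coeffs2_log_fgl:
  fixes h :: "'a::idom \<Rightarrow> 'b::idom"
  assumes h: "subring_hom UNIV h" and l: "l $ 0 = 0" "l $ 1 = 1"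
  shows "map_coeffs2 h (log_fgl l) = log_fgl (map_coeffs1 h l)"
proof -
  interpret subring_hom UNIV h by (rule h)
  have add: "map_coeffs2 h (F + G) = map_coeffs2 h F + map_coeffs2 h G" for F G
    by (simp add: fps_eq_iff hom_add)
  have "subst1 (map_coeffs1 h l) (map_coeffs2 h (log_fgl l)) = map_coeffs2 h (subst1 l fps_x + subst1 l fps_y)"
    by (simp add: subst1_log_fgl[OF l, symmetric] map_coeffs2_subst1)
  then show ?thesis
    using l by (intro log_fglI[symmetric])
      (simp_all add: hom_0 hom_1 log_fgl_nth_0 add map_coeffs2_subst1 map_coeffs2_xy)
qed

lemma map_coeffs1_log_action:
  fixes h :: "'a::idom \<Rightarrow> 'b::idom"
  assumes h: "subring_hom UNIV h" and l: "l $ 0 = 0" "l $ 1 = 1"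
  shows "map_coeffs1 h (log_action l a) = log_action (map_coeffs1 h l) (h a)"
proof -
  interpret subring_hom UNIV h by (rule h)
  have "map_coeffs1 h l oo map_coeffs1 h (log_action l a) = map_coeffs1 h (fps_const a * l)"
    by (simp add: map_coeffs1_compose[symmetric] log_compose_log_action[OF l])
  also have "\<dots> = fps_const (h a) * map_coeffs1 h l" by (simp add: fps_eq_iff hom_mult)
  finally show ?thesis
    using l by (intro log_actionI[symmetric]) (simp_all add: hom_0 hom_1 log_action_nth_0)
qed

text \<open>
  This is \<open>c\<^sup>-\<^sup>1 f(c x)\<close> for a series \<open>f\<close> without
  constant term, written without division so that it makes sense for \<open>c = 0\<close>;
  the truncated difference is harmless because the coefficient concerned vanishes. Likewise
  for two variables below.
\<close>

definition scale1 :: "'a::comm_ring_1 \<Rightarrow> 'a fps \<Rightarrow> 'a fps" where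
  "scale1 c f = Abs_fps (\<lambda>i. c ^ (i - 1) * f $ i)"

definition scale2 :: "'a::comm_ring_1 \<Rightarrow> 'a fps fps \<Rightarrow> 'a fps fps" where
  "scale2 c F = Abs_fps (\<lambda>i. Abs_fps (\<lambda>j. c ^ (i + j - 1) * F $ i $ j))"

lemma fps_const_mult_power_nth: "((fps_const c * u) ^ i) $ n = c ^ i * (u ^ i) $ n"
  for c :: "'a::comm_ring_1"
  unfolding power_mult_distrib fps_const_power by simp

lemma power_diff_1: "c \<noteq> 0 \<Longrightarrow> i > 0 \<Longrightarrow> c ^ (i - 1) = 1 / c * (c ^ i :: 'a::field)"
  by (cases i) auto

lemma scale1_compose:
  fixes c :: "'a::field"
  assumes "c \<noteq> 0" "f $ 0 = 0"
  shows "scale1 c f oo u = fps_const (1 / c) * (f oo (fps_const c * u))"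
proof (rule fps_ext)
  fix n
  have "scale1 c f $ i * (u ^ i) $ n = 1 / c * (f $ i * ((fps_const c * u) ^ i) $ n)" for i
    unfolding fps_const_mult_power_nth scale1_def
    using power_diff_1[OF assms(1), of i] assms by (cases "i = 0") (auto simp: mult_ac)
  then show "(scale1 c f oo u) $ n = (fps_const (1 / c) * (f oo (fps_const c * u))) $ n"
    unfolding fps_compose_nth by (simp only: fps_mult_left_const_nth fps_compose_nth sum_distrib_left)
qed

lemma scale2_eval:
  fixes c :: "'a::field"
  assumes "c \<noteq> 0" "F $ 0 $ 0 = 0"
  shows "fps_eval2 (scale2 c F) u v = fps_const (1 / c) * fps_eval2 F (fps_const c * u) (fps_const c * v)"
proof (rule fps_ext)
  fix n
  have *: "(fps_const c * u) ^ a * (fps_const c * v) ^ b = fps_const (c ^ (a + b)) * (u ^ a * v ^ b)" for a b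
    unfolding power_mult_distrib fps_const_power power_add fps_const_mult[symmetric] by (simp only: mult_ac)
  have "scale2 c F $ a $ b * (u ^ a * v ^ b) $ n =
      1 / c * (F $ a $ b * ((fps_const c * u) ^ a * (fps_const c * v) ^ b) $ n)" for a b
  proof (cases "a + b = 0")
    case False
    have "scale2 c F $ a $ b * (u ^ a * v ^ b) $ n = c ^ (a + b - 1) * F $ a $ b * (u ^ a * v ^ b) $ n"
      by (simp only: scale2_def fps_nth_Abs_fps)
    also have "\<dots> = 1 / c * c ^ (a + b) * F $ a $ b * (u ^ a * v ^ b) $ n"
      using power_diff_1[OF assms(1), of "a + b"] False by (simp only: neq0_conv)
    finally show ?thesis unfolding * fps_mult_left_const_nth by (simp only: mult_ac)
  qed (use assms in \<open>simp add: scale2_def\<close>)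
  then show "fps_eval2 (scale2 c F) u v $ n =
      (fps_const (1 / c) * fps_eval2 F (fps_const c * u) (fps_const c * v)) $ n"
    unfolding fps_eval2_def by (simp only: fps_nth_Abs_fps fps_mult_left_const_nth sum_distrib_left)
qed

lemma scale1_nth_0_1: "f $ 0 = 0 \<Longrightarrow> scale1 c f $ 0 = 0" "scale1 c f $ 1 = f $ 1"
  by (simp_all add: scale1_def)

lemma fps_const_inverse_cancel:
  "(c::'a::field) \<noteq> 0 \<Longrightarrow> fps_const c * (fps_const (1 / c) * f) = f"
  "(c::'a::field) \<noteq> 0 \<Longrightarrow> fps_const (1 / c) * (fps_const c * f) = f"
  by (simp_all add: mult.assoc[symmetric])

lemma log_fgl_scale:
  fixes c :: "'a::field"
  assumes inf: "infinite (UNIV :: 'a set)" and c: "c \<noteq> 0" and l: "l $ 0 = 0" "l $ 1 = 1"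
  shows "log_fgl (scale1 c l) = scale2 c (log_fgl l)"
proof (rule fps2_eqI_points[OF inf])
  fix x y :: 'a
  define u where "u = fps_const x * fps_X"
  define v where "v = fps_const y * fps_X"
  have uv: "u $ 0 = 0" "v $ 0 = 0" by (simp_all add: u_def v_def)
  have l': "scale1 c l $ 0 = 0" "scale1 c l $ 1 = 1" using l by (simp_all add: scale1_nth_0_1 del: One_nat_def)
  have F0: "log_fgl l $ 0 $ 0 = 0" by (rule log_fgl_nth_0[OF l])
  have "scale1 c l oo fps_eval2 (scale2 c (log_fgl l)) u v =
      fps_const (1 / c) * ((l oo (fps_const c * u)) + (l oo (fps_const c * v)))"
    using uv by (simp add: scale1_compose[OF c l(1)] scale2_eval[OF c F0] fps_const_inverse_cancel[OF c] log_compose_log_fgl[OF l])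
  also have "\<dots> = (scale1 c l oo u) + (scale1 c l oo v)"
    by (simp add: scale1_compose[OF c l(1)] distrib_left)
  also have "\<dots> = scale1 c l oo fps_eval2 (log_fgl (scale1 c l)) u v"
    by (simp add: log_compose_log_fgl[OF l' uv])
  finally have eq: "scale1 c l oo fps_eval2 (scale2 c (log_fgl l)) u v =
      scale1 c l oo fps_eval2 (log_fgl (scale1 c l)) u v" .
  show "fps_eval2 (log_fgl (scale1 c l)) u v = fps_eval2 (scale2 c (log_fgl l)) u v"
    by (rule fps_compose_left_cancel[OF l'(2) _ _ sym])
      (use l' F0 eq in \<open>simp_all add: log_fgl_nth_0 scale2_def\<close>)
qed

lemma log_action_scale:
  fixes c :: "'a::field"
  assumes c: "c \<noteq> 0" and l: "l $ 0 = 0" "l $ 1 = 1"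
  shows "log_action (scale1 c l) a = scale1 c (log_action l a)"
proof (rule log_actionI)
  let ?E = "log_action l a"
  have E0: "?E $ 0 = 0" by (rule log_action_nth_0[OF l])
  have cX: "fps_const c * fps_X $ 0 = (0::'a fps)" by simp
  have E: "scale1 c ?E = fps_const (1 / c) * (?E oo (fps_const c * fps_X))"
    using scale1_compose[OF c E0, of fps_X] by simp
  have "scale1 c l oo scale1 c ?E = fps_const (1 / c) * (l oo (?E oo (fps_const c * fps_X)))"
    by (simp add: scale1_compose[OF c l(1)] E fps_const_inverse_cancel[OF c])
  also have "l oo (?E oo (fps_const c * fps_X)) = (fps_const a * l) oo (fps_const c * fps_X)"
    using E0 by (simp add: fps_compose_assoc log_compose_log_action[OF l])
  also have "\<dots> = fps_const a * (l oo (fps_const c * fps_X))"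
    by (simp add: fps_compose_mult_distrib)
  also have "fps_const (1 / c) * \<dots> = fps_const a * scale1 c l"
    using scale1_compose[OF c l(1), of fps_X] by (simp add: mult_ac)
  finally show "scale1 c l oo scale1 c ?E = fps_const a * scale1 c l" .
qed (use l in \<open>simp_all add: scale1_nth_0_1 log_action_nth_0 del: One_nat_def\<close>)

section \<open>Specialising the universal module\<close>

lemma universal_fgl_conv: "universal_fgl \<pi> q = log_fgl (universal_log \<pi> q)"
  by (simp add: universal_fgl_def log_fgl_def Let_def)

lemma universal_action_conv: "universal_action \<pi> q a = log_action (universal_log \<pi> q) (vconst a)"
  by (simp add: universal_action_def log_action_def Let_def)

text \<open>
  Setting \<open>v\<^sub>n = c^(q\<^sup>n - 1)\<close> and all other variables to
  \<open>0\<close> turns the universal logarithm into \<open>c\<^sup>-\<^sup>1 l(c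
  x)\<close>, where \<open>l\<close> is the logarithm of Lubin--Tate type with \<open>Q =
  q\<^sup>n\<close>.
\<close>

context
  fixes \<pi> :: "'a::field" and q n :: nat and c :: 'a
  assumes q: "q \<ge> 2" and n: "n > 0" and c: "c \<noteq> 0"
begin

abbreviation (input) "spec \<equiv> classifying_map (\<lambda>x. x) (\<lambda>i. if i = n then c ^ (q ^ n - 1) else 0)"

interpretation spec: subring_hom UNIV spec
proof -
  have "coeffs_in UNIV = (UNIV :: 'a vpoly set)" by (simp add: coeffs_in_def)
  then show "subring_hom UNIV spec"
    using subring_hom_classifying_map[OF subring_hom_id[OF is_subring_UNIV]] by metis
qed

text \<open>
  Only the summand \<open>i = h - n\<close> of Hazewinkel's recursion survives.
\<close>

lemma spec_hazewinkel_ell: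
  "spec (hazewinkel_ell \<pi> q h) = (if n dvd h then c ^ (q ^ h - 1) * (1 / \<pi>) ^ (h div n) else 0)"
proof (induction h rule: less_induct)
  case (less h)
  have id: "subring_hom UNIV (\<lambda>x::'a. x)" by (rule subring_hom_id) simp
  show ?case
  proof (cases "h = 0")
    case True
    then show ?thesis by (simp add: hazewinkel_ell.simps spec.hom_1)
  next
    case False
    have "spec (hazewinkel_ell \<pi> q h) =
        1 / \<pi> * (\<Sum>i<h. spec (hazewinkel_ell \<pi> q i) * (if h - i = n then c ^ (q ^ n - 1) else 0) ^ (q ^ i))"
      using False
      by (subst hazewinkel_ell.simps)
         (simp add: spec.hom_mult spec.hom_sum spec.hom_power classifying_map_vconst[OF id] classifying_map_vvar[OF id])
    also have "(\<Sum>i<h. spec (hazewinkel_ell \<pi> q i) * (if h - i = n then c ^ (q ^ n - 1) else 0) ^ (q ^ i)) =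
        (\<Sum>i<h. if i = h - n then (if n \<le> h then spec (hazewinkel_ell \<pi> q i) * c ^ ((q ^ n - 1) * q ^ i) else 0) else 0)"
      using q n by (intro sum.cong refl) (auto simp: power_mult zero_power)
    also have "\<dots> = (if n \<le> h then spec (hazewinkel_ell \<pi> q (h - n)) * c ^ ((q ^ n - 1) * q ^ (h - n)) else 0)"
      using n False by (simp add: sum.delta)
    finally have eq: "spec (hazewinkel_ell \<pi> q h) =
        1 / \<pi> * (if n \<le> h then spec (hazewinkel_ell \<pi> q (h - n)) * c ^ ((q ^ n - 1) * q ^ (h - n)) else 0)" .
    show ?thesis
    proof (cases "n \<le> h")
      case True
      have IH: "spec (hazewinkel_ell \<pi> q (h - n)) =
          (if n dvd h then c ^ (q ^ (h - n) - 1) * (1 / \<pi>) ^ ((h - n) div n) else 0)"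
        using less[of "h - n"] n False True by (simp add: dvd_minus_self)
      have "q ^ (h - n) \<ge> 1" "q ^ n * q ^ (h - n) = q ^ h" using q True by (simp_all add: power_add[symmetric])
      moreover from this have "q ^ (h - n) \<le> q ^ h" using q by (metis mult_le_mono1 nat_mult_1 one_le_power order.trans one_le_numeral)
      ultimately have exp: "(q ^ (h - n) - 1) + (q ^ n - 1) * q ^ (h - n) = q ^ h - 1"
        by (simp add: diff_mult_distrib)
      have div: "h div n = Suc ((h - n) div n)" using True n by (metis le_div_geq)
      show ?thesis
        unfolding eq IH exp[symmetric] power_add div using True by simp
    next
      case False
      then have "\<not> n dvd h" using \<open>h \<noteq> 0\<close> by (auto dest: dvd_imp_le)
      then show ?thesis unfolding eq using False by simp
    qed
  qed
qed

lemma spec_universal_log: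
  "map_coeffs1 spec (universal_log \<pi> q) = scale1 c (lt_log (1 / \<pi>) (q ^ n))"
proof (rule fps_ext)
  fix m
  have q_inj: "q ^ i = q ^ j \<longleftrightarrow> i = j" for i j using q by (simp add: power_inject_exp)
  show "map_coeffs1 spec (universal_log \<pi> q) $ m = scale1 c (lt_log (1 / \<pi>) (q ^ n)) $ m"
  proof (cases "\<exists>i. m = q ^ i")
    case True
    then obtain i where i: "m = q ^ i" by auto
    have "{k. (q ^ n) ^ k = m} = (if n dvd i then {i div n} else {})"
      using n by (auto simp: i q_inj power_mult[symmetric])
    moreover have "{j. q ^ j = m} = {i}" by (auto simp: i q_inj)
    ultimately show ?thesis
      by (simp add: universal_log_def scale1_def lt_log_def spec_hazewinkel_ell i)
  next
    case False
    then have "{j. q ^ j = m} = {}" "{k. (q ^ n) ^ k = m} = {}" by (auto simp: power_mult[symmetric])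
    then show ?thesis by (simp add: universal_log_def scale1_def lt_log_def spec.hom_0)
  qed
qed

lemma universal_log_nth_0_1: "universal_log \<pi> q $ 0 = 0" "universal_log \<pi> q $ 1 = 1"
proof -
  have sets: "{i. q ^ i = 1} = {0}" "{i. q ^ i = 0} = {}" using q by (auto simp: power_eq_1_iff)
  have "hazewinkel_ell \<pi> q 0 = 1" by (subst hazewinkel_ell.simps) simp
  then show "universal_log \<pi> q $ 0 = 0" "universal_log \<pi> q $ 1 = 1"
    by (simp_all only: universal_log_def fps_nth_Abs_fps sets sum.empty) simp
qed

lemma Qn_ge_2: "q ^ n \<ge> 2"
  using q n self_le_power[of q n] by linarith

lemma spec_universal_fgl:
  assumes "infinite (UNIV :: 'a set)"
  shows "spec (universal_fgl \<pi> q $ i $ j) = c ^ (i + j - 1) * log_fgl (lt_log (1 / \<pi>) (q ^ n)) $ i $ j"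
proof -
  have "map_coeffs2 spec (universal_fgl \<pi> q) = scale2 c (log_fgl (lt_log (1 / \<pi>) (q ^ n)))"
    unfolding universal_fgl_conv map_coeffs2_log_fgl[OF spec.subring_hom_axioms universal_log_nth_0_1] spec_universal_log
    by (rule log_fgl_scale[OF assms c lt_log_nth_0_1[OF Qn_ge_2]])
  from arg_cong[OF this, of "\<lambda>F. F $ i $ j"] show ?thesis by (simp add: scale2_def)
qed

lemma spec_universal_action:
  "spec (universal_action \<pi> q a $ i) = c ^ (i - 1) * log_action (lt_log (1 / \<pi>) (q ^ n)) a $ i"
proof -
  have id: "subring_hom UNIV (\<lambda>x::'a. x)" by (rule subring_hom_id) simp
  have "map_coeffs1 spec (universal_action \<pi> q a) = scale1 c (log_action (lt_log (1 / \<pi>) (q ^ n)) a)"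
    unfolding universal_action_conv map_coeffs1_log_action[OF spec.subring_hom_axioms universal_log_nth_0_1]
      spec_universal_log classifying_map_vconst[OF id]
    by (rule log_action_scale[OF c lt_log_nth_0_1[OF Qn_ge_2]])
  from arg_cong[OF this, of "\<lambda>F. F $ i"] show ?thesis by (simp add: scale1_def)
qed

end

text \<open>
  Over an algebraically closed field every parameter has a \<open>(q\<^sup>n - 1)\<close>-th
  root \<open>b\<close>, so the formal modules of the theorem are rescalings of the
  reduction of a fixed formal module over \<open>A\<close>. The coefficients of the
  universal formal group law are polynomials whose values at \<open>v\<^sub>n = c^(q\<^sup>n
  - 1)\<close> are known over the fraction field of \<open>A\<close>, and these values
  determine the reduction.
\<close>

theorem G_fgl_eq_scale2:
  fixes \<pi> :: "'a::field" and red :: "'a \<Rightarrow> 'b::field"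
  assumes "infinite (UNIV :: 'a set)" "red 0 = 0" "q \<ge> 2" "n > 0"
  shows "G_fgl \<pi> q red n (b ^ (q ^ n - 1)) =
      scale2 b (map_coeffs2 red (log_fgl (lt_log (1 / \<pi>) (q ^ n))))"
proof (intro fps_ext)
  fix i j
  have "q ^ n - 1 > 0" using Qn_ge_2[OF assms(3,4) one_neq_zero] by simp
  from classifying_map_specialize[where red = red and b = b, OF assms(1,2) this, where P = "universal_fgl \<pi> q $ i $ j",
      OF spec_universal_fgl[OF assms(3,4) _ assms(1)]]
  show "G_fgl \<pi> q red n (b ^ (q ^ n - 1)) $ i $ j =
      scale2 b (map_coeffs2 red (log_fgl (lt_log (1 / \<pi>) (q ^ n)))) $ i $ j"
    by (simp add: G_fgl_def scale2_def del: One_nat_def)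
qed

theorem G_action_eq_scale1:
  fixes \<pi> :: "'a::field" and red :: "'a \<Rightarrow> 'b::field"
  assumes "infinite (UNIV :: 'a set)" "red 0 = 0" "q \<ge> 2" "n > 0"
  shows "G_action \<pi> q red n (b ^ (q ^ n - 1)) a =
      scale1 b (map_coeffs1 red (log_action (lt_log (1 / \<pi>) (q ^ n)) a))"
proof (intro fps_ext)
  fix i
  have "q ^ n - 1 > 0" using Qn_ge_2[OF assms(3,4) one_neq_zero] by simp
  from classifying_map_specialize[where red = red and b = b, OF assms(1,2) this, where P = "universal_action \<pi> q a $ i",
      OF spec_universal_action[OF assms(3,4)]]
  show "G_action \<pi> q red n (b ^ (q ^ n - 1)) a $ i =
      scale1 b (map_coeffs1 red (log_action (lt_log (1 / \<pi>) (q ^ n)) a)) $ i"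
    by (simp add: G_action_def scale1_def del: One_nat_def)
qed

section \<open>Symmetric 2-cocycles in characteristic p\<close>

context
  fixes p :: nat and ty :: "'a::field itself"
  assumes p: "prime p" and char: "CHAR('a) = p"
begin

lemma of_nat_eq_0_iff_p: "of_nat j = (0::'a) \<longleftrightarrow> p dvd j"
  using of_nat_eq_0_iff_char_dvd[where ?'a = 'a] char by simp

lemma frobenius_add: "((x::'a) + y) ^ (p ^ k) = x ^ (p ^ k) + y ^ (p ^ k)"
  using freshmans_dream'[where ?'a = 'a] p char by blast

lemma frobenius_fps_add: "((x::'a fps) + y) ^ (p ^ k) = x ^ (p ^ k) + y ^ (p ^ k)"
  using freshmans_dream'[where ?'a = "'a fps"] p char by simp

lemma frobenius_diff: "((x::'a) - y) ^ (p ^ k) = x ^ (p ^ k) - y ^ (p ^ k)"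
  using frobenius_add[of "x - y" y k] by (simp add: algebra_simps)

lemma frobenius_fps_diff: "((x::'a fps) - y) ^ (p ^ k) = x ^ (p ^ k) - y ^ (p ^ k)"
  using frobenius_fps_add[of "x - y" y k] by (simp add: algebra_simps)

lemma frobenius_of_nat: "(of_nat l :: 'a) ^ (p ^ k) = of_nat l"
proof (induction l)
  case 0
  then show ?case using prime_gt_0_nat[OF p] by (simp add: zero_power)
next
  case (Suc l)
  then show ?case by (simp add: frobenius_add)
qed

lemma one_plus_X_power_nth: "((1 + fps_X) ^ n) $ k = (of_nat (n choose k) :: 'a)"
proof (induction n arbitrary: k)
  case (Suc n)
  have eq: "(1 + fps_X :: 'a fps) ^ Suc n = (1 + fps_X) ^ n + fps_X * (1 + fps_X) ^ n"
    by (simp only: power_Suc distrib_right mult_1)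
  show ?case
  proof (cases k)
    case 0
    then show ?thesis unfolding eq by (simp add: Suc.IH)
  next
    case (Suc k')
    have "((1 + fps_X :: 'a fps) ^ n + fps_X * (1 + fps_X) ^ n) $ Suc k' =
        of_nat (n choose Suc k') + of_nat (n choose k')"
      by (simp add: Suc.IH)
    then show ?thesis unfolding eq Suc by (simp add: add.commute)
  qed
next
  case 0
  then show ?case by (cases k) simp_all
qed

text \<open>
  Compare coefficients in \<open>(1 + x)^(p a) = (1 + x\<^sup>p)^a\<close>.
\<close>

lemma lucas_multiple: "of_nat ((p * a) choose (p * b)) = (of_nat (a choose b) :: 'a)"
proof -
  have p0: "p > 0" by (rule prime_gt_0_nat[OF p])
  have X0: "(fps_X ^ p) $ 0 = (0::'a)" using p0 by (simp add: fps_X_power_nth)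
  have "(1 + fps_X :: 'a fps) ^ (p * a) = ((1 + fps_X) ^ p) ^ a" by (rule power_mult)
  also have "(1 + fps_X :: 'a fps) ^ p = 1 + fps_X ^ p"
    using frobenius_fps_add[of 1 fps_X 1] by simp
  also have "1 + fps_X ^ p = (1 + fps_X :: 'a fps) oo fps_X ^ p"
    using X0 by (simp add: fps_compose_add_distrib)
  also have "\<dots> ^ a = ((1 + fps_X) ^ a) oo fps_X ^ p" by (rule fps_compose_power[OF X0])
  finally have "((1 + fps_X :: 'a fps) ^ (p * a)) $ (p * b) = (((1 + fps_X) ^ a) oo fps_X ^ p) $ (p * b)" by simp
  also have "\<dots> = (\<Sum>i\<in>{0..p * b}. ((1 + fps_X) ^ a) $ i * (if i = b then 1 else 0))"
    unfolding fps_compose_nth power_mult[symmetric] fps_X_power_nth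
    using p0 by (intro sum.cong refl) auto
  also have "\<dots> = (\<Sum>i\<in>{0..p * b}. if i = b then ((1 + fps_X) ^ a) $ i else 0)"
    by (intro sum.cong) auto
  also have "\<dots> = ((1 + fps_X) ^ a) $ b" using p0 by (simp add: sum.delta)
  finally show ?thesis unfolding one_plus_X_power_nth .
qed

lemma choose_multiple_not_multiple:
  assumes "p dvd n" "\<not> p dvd j" shows "of_nat (n choose j) = (0::'a)"
proof (cases n)
  case 0
  then show ?thesis using assms by (cases j) auto
next
  case (Suc n')
  obtain j' where j: "j = Suc j'" using assms(2) by (cases j) auto
  have "j * (n choose j) = n * (n' choose j')" using times_binomial_minus1_eq[of j n] unfolding Suc j by simp
  then have "p dvd j * (n choose j)" using assms(1) by simp
  then have "p dvd (n choose j)" using p assms(2) prime_dvd_mult_iff by blast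
  then show ?thesis by (simp add: of_nat_eq_0_iff_p)
qed

lemma choose_pred_multiple:
  assumes "p dvd n" "n > 0" "j < p" shows "of_nat ((n - 1) choose j) = ((-1) ^ j :: 'a)"
  using assms(3)
proof (induction j)
  case (Suc j)
  have "n choose Suc j = ((n - 1) choose j) + ((n - 1) choose Suc j)"
    using assms(2) by (cases n) auto
  then have "of_nat (n choose Suc j) = (of_nat ((n - 1) choose j) :: 'a) + of_nat ((n - 1) choose Suc j)"
    by simp
  moreover have "\<not> p dvd Suc j" using Suc.prems by (auto dest: dvd_imp_le)
  ultimately show ?case using Suc choose_multiple_not_multiple[OF assms(1), of "Suc j"]
    by (simp add: eq_neg_iff_add_eq_0 add.commute)
qed simp

text \<open>
  The left side is the sum of \<open>C(1, l)\<close> over \<open>0 < l < p\<close> for the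
  integral polynomial \<open>C = ((x + y)\<^sup>p - x\<^sup>p - y\<^sup>p) / p\<close>. In
  the integers this sum telescopes to \<open>(p\<^sup>p - p) / p = p^(p - 1) - 1\<close>.
\<close>

lemma sum_choose_p_div_p:
  "(\<Sum>l\<in>{1..<p}. \<Sum>j\<in>{1..<p}. of_nat ((p choose j) div p) * of_nat l ^ (p - j)) = (-1 :: 'a)"
proof -
  define S where "S = (\<Sum>l\<in>{1..<p}. \<Sum>j\<in>{1..<p}. ((p choose j) div p) * l ^ (p - j))"
  have p2: "p \<ge> 2" by (rule prime_ge_2_nat[OF p])
  have inner: "(1 + l) ^ p = l ^ p + 1 + p * (\<Sum>j\<in>{1..<p}. ((p choose j) div p) * l ^ (p - j))" for l :: nat
  proof -
    have "(1 + l) ^ p = (\<Sum>k\<le>p. (p choose k) * l ^ (p - k))"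
      using binomial_ring[of 1 l p] by simp
    also have "{..p} = insert 0 (insert p {1..<p})" using p2 by auto
    also have "(\<Sum>k\<in>insert 0 (insert p {1..<p}). (p choose k) * l ^ (p - k)) =
        l ^ p + (1 + (\<Sum>k\<in>{1..<p}. (p choose k) * l ^ (p - k)))"
      using p2 by simp
    also have "(\<Sum>k\<in>{1..<p}. (p choose k) * l ^ (p - k)) = p * (\<Sum>j\<in>{1..<p}. ((p choose j) div p) * l ^ (p - j))"
      unfolding sum_distrib_left
    proof (rule sum.cong)
      fix k assume "k \<in> {1..<p}"
      then have "p dvd (p choose k)" using p by (intro dvd_choose_prime) auto
      then show "(p choose k) * l ^ (p - k) = p * ((p choose k) div p * l ^ (p - k))"
        by (simp add: mult.assoc[symmetric])
    qed simp
    finally show ?thesis by simp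
  qed
  \<comment> \<open>Multiplied by \<open>p\<close>, the partial sums telescope to
  \<open>m\<^sup>p - m\<close>; the summands are arranged to avoid subtraction.\<close>
  have tele: "m ^ p + p = 1 + m + p * (\<Sum>l\<in>{1..<m}. \<Sum>j\<in>{1..<p}. ((p choose j) div p) * l ^ (p - j)) + (p - 1) + (1 - 1)"
    if "m \<ge> 1" for m
    using that
  proof (induction m rule: nat_induct_at_least)
    case base
    then show ?case using p2 by simp
  next
    case (Suc m)
    then show ?case using inner[of m] by (simp add: distrib_left)
  qed
  from tele[of p] p2 have "p ^ p = p * (S + 1)" unfolding S_def[symmetric] by simp
  then have "p * p ^ (p - 1) = p * (S + 1)" using p2 by (cases p) auto
  then have "S + 1 = p ^ (p - 1)" using p2 by (metis mult_cancel1 not_numeral_le_zero)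
  then have "p dvd S + 1" using p2 by (cases "p - 1") auto
  then have "of_nat (S + 1) = (0::'a)" by (simp add: of_nat_eq_0_iff_p del: of_nat_add of_nat_Suc)
  then have "of_nat S = (-1::'a)" by (simp add: eq_neg_iff_add_eq_0 add.commute)
  then show ?thesis by (simp add: S_def)
qed

text \<open>
  Here \<open>c j\<close> is the coefficient of \<open>x^j y^(n - j)\<close> in a
  homogeneous symmetric 2-cocycle \<open>\<Gamma>\<close> of degree \<open>n\<close> over a
  field of characteristic \<open>p\<close>. By Lazard's lemma, \<open>\<Gamma>\<close> is a
  multiple of \<open>(x + y)^n - x^n - y^n\<close>, unless \<open>n\<close> is a power of
  \<open>p\<close>, when there is an additional cocycle, a Frobenius twist of \<open>((x +
  y)\<^sup>p - x\<^sup>p - y\<^sup>p) / p\<close>. The third hypothesis says that the sum of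
  \<open>\<Gamma>(1, l)\<close> over \<open>0 < l < p\<close> vanishes, and this rules out
  the additional cocycle. The cocycle condition with \<open>i = 1\<close> determines
  \<open>c j\<close> for \<open>j\<close> prime to \<open>p\<close> from \<open>c 1\<close>.
  If \<open>p\<close> divides \<open>n\<close> and \<open>n \<noteq> p\<close>, then
  \<open>c 1 = 0\<close>, so \<open>\<Gamma>\<close> is a polynomial in
  \<open>x\<^sup>p\<close> and \<open>y\<^sup>p\<close>, and the degree can be divided by
  \<open>p\<close>.
\<close>

lemma symmetric_cocycle_coboundary:
  fixes c :: "nat \<Rightarrow> 'a"
  assumes "\<And>i j. 1 \<le> i \<Longrightarrow> 1 \<le> j \<Longrightarrow> i + j < n \<Longrightarrow>
      c i * of_nat ((n - i) choose j) = c (i + j) * of_nat ((i + j) choose i)"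
    and "\<And>i. 0 < i \<Longrightarrow> i < n \<Longrightarrow> c (n - i) = c i"
    and "(\<Sum>l\<in>{1..<p}. \<Sum>j\<in>{1..<n}. c j * of_nat l ^ (n - j)) = 0"
  shows "\<exists>b. \<forall>j. 0 < j \<longrightarrow> j < n \<longrightarrow> c j = b * of_nat (n choose j)"
  using assms
proof (induction n arbitrary: c rule: less_induct)
  case (less n)
  note coc = less.prems(1) and c_sym = less.prems(2) and sum0 = less.prems(3)
  have p2: "p \<ge> 2" by (rule prime_ge_2_nat[OF p])
  have coc1: "c 1 * of_nat ((n - 1) choose (j - 1)) = c j * of_nat j" if "1 \<le> j" "j < n" for j
  proof (cases "j = 1")
    case False
    then show ?thesis using coc[of 1 "j - 1"] that by simp
  qed simp
  consider "\<not> p dvd n" | "n = p" | "p dvd n" "n \<noteq> p" by blast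
  then show ?case
  proof cases
    case 1
    have n0: "of_nat n \<noteq> (0::'a)" using 1 by (simp add: of_nat_eq_0_iff_p)
    define b where "b = c 1 / of_nat n"
    have "c j = b * of_nat (n choose j)" if j: "0 < j" "j < n" "\<not> p dvd j" for j
    proof -
      have "j * (n choose j) = n * ((n - 1) choose (j - 1))"
        using times_binomial_minus1_eq[of j n] j by simp
      then have eq: "of_nat j * of_nat (n choose j) = of_nat n * (of_nat ((n - 1) choose (j - 1)) :: 'a)"
        by (metis of_nat_mult)
      have "b * of_nat (n choose j) * of_nat j = c 1 / of_nat n * (of_nat j * of_nat (n choose j))"
        by (simp add: b_def)
      also have "\<dots> = c 1 * of_nat ((n - 1) choose (j - 1))" unfolding eq using n0 by simp
      also have "\<dots> = c j * of_nat j" using coc1[of j] j by simp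
      finally have "b * of_nat (n choose j) * of_nat j = c j * of_nat j" .
      moreover have "of_nat j \<noteq> (0::'a)" using j by (simp add: of_nat_eq_0_iff_p)
      ultimately have "b * of_nat (n choose j) = c j" by simp
      then show ?thesis by (rule sym)
    qed
    moreover have "c j = b * of_nat (n choose j)" if j: "0 < j" "j < n" "p dvd j" for j
    proof -
      have "\<not> p dvd n - j" using 1 j by (metis dvd_diffD1 less_imp_le_nat dvd_diff_nat dvd_diffD)
      then have "c (n - j) = b * of_nat (n choose (n - j))"
        using calculation[of "n - j"] j by simp
      then show ?thesis using c_sym[of j] j binomial_symmetric[of j n] by simp
    qed
    ultimately show ?thesis by blast
  next
    case 2
    have cj: "c j = c 1 * of_nat ((p choose j) div p)" if j: "1 \<le> j" "j < p" for j
    proof -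
      have "p dvd (p choose j)" using p j by (intro dvd_choose_prime) auto
      moreover have "j * (p choose j) = p * ((p - 1) choose (j - 1))"
        using times_binomial_minus1_eq[of j p] j by simp
      ultimately have "p * (j * ((p choose j) div p)) = p * ((p - 1) choose (j - 1))"
        by (metis dvd_mult_div_cancel mult.left_commute)
      then have "j * ((p choose j) div p) = (p - 1) choose (j - 1)" using p2 by simp
      then have "c j * of_nat j = c 1 * of_nat ((p choose j) div p) * of_nat j"
        using coc1[of j] j 2 by (metis mult.assoc mult.commute of_nat_mult)
      moreover have "\<not> p dvd j" using j by (auto dest: dvd_imp_le)
      ultimately show ?thesis by (simp add: of_nat_eq_0_iff_p)
    qed
    have "0 = (\<Sum>l\<in>{1..<p}. \<Sum>j\<in>{1..<p}. c j * of_nat l ^ (p - j))"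
      using sum0 unfolding 2 by (rule sym)
    also have "\<dots> = (\<Sum>l\<in>{1..<p}. \<Sum>j\<in>{1..<p}. c 1 * (of_nat ((p choose j) div p) * of_nat l ^ (p - j)))"
    proof (intro sum.cong refl)
      fix l j assume "j \<in> {1..<p}"
      then have "c j = c 1 * of_nat ((p choose j) div p)" by (intro cj) auto
      then show "c j * of_nat l ^ (p - j) = c 1 * (of_nat ((p choose j) div p) * of_nat l ^ (p - j))"
        by (simp only: mult.assoc)
    qed
    also have "\<dots> = c 1 * (\<Sum>l\<in>{1..<p}. \<Sum>j\<in>{1..<p}. of_nat ((p choose j) div p) * of_nat l ^ (p - j))"
      by (simp only: sum_distrib_left)
    finally have "c 1 = 0" unfolding sum_choose_p_div_p by simp
    then show ?thesis using cj 2 by (intro exI[of _ 0]) auto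
  next
    case 3
    show ?thesis
    proof (cases "n = 0")
      case False
      obtain n' where n': "n = p * n'" using 3 by blast
      have n'2: "n' \<ge> 2" using 3 False n' by (cases n'; cases "n' = 1") auto
      have np: "n > p" using mult_le_mono2[OF n'2, of p] n' p2 by linarith
      have "c 1 * of_nat ((n - 1) choose (p - 1)) = c p * of_nat p"
        using coc1[of p] p2 np by simp
      moreover have "of_nat ((n - 1) choose (p - 1)) \<noteq> (0::'a)"
        using choose_pred_multiple[OF 3(1), of "p - 1"] False p2 by simp
      moreover have "of_nat p = (0::'a)" by (simp add: of_nat_eq_0_iff_p)
      ultimately have c1: "c 1 = 0" by simp
      have c0: "c j = 0" if "0 < j" "j < n" "\<not> p dvd j" for j
        using coc1[of j] that c1 by (simp add: of_nat_eq_0_iff_p)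
      have "\<exists>b. \<forall>j. 0 < j \<longrightarrow> j < n' \<longrightarrow> c (p * j) = b * of_nat (n' choose j)"
      proof (rule less.IH)
        show "n' < n" using n' n'2 p2 by simp
        show "c (p * i) * of_nat ((n' - i) choose j) = c (p * (i + j)) * of_nat ((i + j) choose i)"
          if "1 \<le> i" "1 \<le> j" "i + j < n'" for i j
        proof -
          have "p * i + p * j < n" unfolding n' distrib_left[symmetric] using that p2 by simp
          then have "c (p * i) * of_nat ((p * (n' - i)) choose (p * j)) = c (p * (i + j)) * of_nat ((p * (i + j)) choose (p * i))"
            using coc[of "p * i" "p * j"] that p2 by (simp add: n' distrib_left right_diff_distrib')
          then show ?thesis unfolding lucas_multiple .
        qed
        show "c (p * (n' - i)) = c (p * i)" if "0 < i" "i < n'" for i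
          using c_sym[of "p * i"] that p2 by (simp add: n' right_diff_distrib')
        have "(\<Sum>j\<in>{1..<n}. c j * of_nat l ^ (n - j)) = (\<Sum>i\<in>{1..<n'}. c (p * i) * of_nat l ^ (n' - i))" for l
        proof -
          have "(\<Sum>j\<in>{1..<n}. c j * of_nat l ^ (n - j)) = (\<Sum>j\<in>(*) p ` {1..<n'}. c j * of_nat l ^ (n - j))"
          proof (rule sum.mono_neutral_right)
            show "(*) p ` {1..<n'} \<subseteq> {1..<n}" using p2 by (auto simp: n' Suc_le_eq)
            show "\<forall>j\<in>{1..<n} - (*) p ` {1..<n'}. c j * of_nat l ^ (n - j) = 0"
            proof
              fix j assume j: "j \<in> {1..<n} - (*) p ` {1..<n'}"
              have "\<not> p dvd j"
              proof
                assume "p dvd j"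
                then obtain i where "j = p * i" by blast
                then show False using j p2 by (auto simp: n' Suc_le_eq)
              qed
              then show "c j * of_nat l ^ (n - j) = 0" using c0[of j] j by simp
            qed
          qed simp
          also have "\<dots> = (\<Sum>i\<in>{1..<n'}. c (p * i) * of_nat l ^ (n - p * i))"
            using p2 by (subst sum.reindex) (auto simp: inj_on_def)
          also have "\<dots> = (\<Sum>i\<in>{1..<n'}. c (p * i) * of_nat l ^ (n' - i))"
            using frobenius_of_nat[of l 1]
            by (simp add: n' right_diff_distrib'[symmetric] power_mult)
          finally show ?thesis .
        qed
        then show "(\<Sum>l\<in>{1..<p}. \<Sum>i\<in>{1..<n'}. c (p * i) * of_nat l ^ (n' - i)) = 0"
          using sum0 by simp
      qed
      then obtain b where b: "\<And>j. 0 < j \<Longrightarrow> j < n' \<Longrightarrow> c (p * j) = b * of_nat (n' choose j)" by blast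
      have "c j = b * of_nat (n choose j)" if "0 < j" "j < n" for j
      proof (cases "p dvd j")
        case True
        then obtain i where i: "j = p * i" by blast
        then have "0 < i" "i < n'" using that p2 by (auto simp: n')
        then show ?thesis using b[of i] unfolding i n' lucas_multiple by simp
      next
        case False
        then show ?thesis using c0 that choose_multiple_not_multiple[OF 3(1) False] by simp
      qed
      then show ?thesis by blast
    qed simp
  qed
qed

end

section \<open>Formal group laws\<close>

text \<open>
  The axioms are imposed on arguments that are series in one variable, which avoids series
  in three variables. Over an infinite domain they amount to the usual identities, since the
  arguments \<open>x t\<close>, \<open>y t\<close>, \<open>z t\<close> with constants
  \<open>x\<close>, \<open>y\<close>, \<open>z\<close> detect every coefficient.
\<close>

definition is_fgl :: "'a::comm_ring_1 fps fps \<Rightarrow> bool" where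
  "is_fgl F \<longleftrightarrow> F $ 0 $ 0 = 0 \<and>
     (\<forall>u v w. u $ 0 = 0 \<longrightarrow> v $ 0 = 0 \<longrightarrow> w $ 0 = 0 \<longrightarrow>
        fps_eval2 F u v = fps_eval2 F v u \<and>
        fps_eval2 F (fps_eval2 F u v) w = fps_eval2 F u (fps_eval2 F v w) \<and>
        fps_eval2 F u 0 = u)"

primrec fgl_multiple :: "'a::comm_ring_1 fps fps \<Rightarrow> nat \<Rightarrow> 'a fps \<Rightarrow> 'a fps" where
  "fgl_multiple F 0 u = 0"
| "fgl_multiple F (Suc i) u = fps_eval2 F u (fgl_multiple F i u)"

context
  fixes F :: "'a::idom fps fps"
  assumes F: "is_fgl F"
begin

lemma fgl_0_0: "F $ 0 $ 0 = 0"
  using F by (simp add: is_fgl_def)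

lemma fgl_commute: "u $ 0 = 0 \<Longrightarrow> v $ 0 = 0 \<Longrightarrow> fps_eval2 F u v = fps_eval2 F v u"
  using F unfolding is_fgl_def by (metis fps_zero_nth)

lemma fgl_assoc:
  "u $ 0 = 0 \<Longrightarrow> v $ 0 = 0 \<Longrightarrow> w $ 0 = 0 \<Longrightarrow>
     fps_eval2 F (fps_eval2 F u v) w = fps_eval2 F u (fps_eval2 F v w)"
  using F unfolding is_fgl_def by blast

lemma fgl_zero_right: "u $ 0 = 0 \<Longrightarrow> fps_eval2 F u 0 = u"
  using F fps_zero_nth[of 0] unfolding is_fgl_def by blast

lemma fgl_zero_left: "u $ 0 = 0 \<Longrightarrow> fps_eval2 F 0 u = u"
  using fgl_commute[of 0 u] fgl_zero_right[of u] by simp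

lemma fgl_nth_x: "F $ n $ 0 = (if n = 1 then 1 else 0)"
proof -
  have "fps_eval2 F fps_X 0 $ n = (\<Sum>a\<le>n. \<Sum>b\<le>n. if b = 0 then (if a = n then F $ a $ b else 0) else 0)"
    unfolding fps_eval2_def fps_nth_Abs_fps
    by (intro sum.cong refl) (auto simp: power_0_left fps_X_power_nth)
  also have "\<dots> = F $ n $ 0" by (simp add: sum.delta)
  finally show ?thesis using fgl_zero_right[of fps_X] by (simp add: fps_X_def)
qed

lemma fgl_nth_y: "F $ 0 $ n = (if n = 1 then 1 else 0)"
proof -
  have "fps_eval2 F 0 fps_X $ n = (\<Sum>a\<le>n. \<Sum>b\<le>n. if a = 0 then (if b = n then F $ a $ b else 0) else 0)"
    unfolding fps_eval2_def fps_nth_Abs_fps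
    by (intro sum.cong refl) (auto simp: power_0_left fps_X_power_nth)
  also have "\<dots> = (\<Sum>a\<le>n. if a = 0 then (\<Sum>b\<le>n. if b = n then F $ a $ b else 0) else 0)"
    by (intro sum.cong) auto
  also have "\<dots> = F $ 0 $ n" by (simp add: sum.delta)
  finally show ?thesis using fgl_zero_left[of fps_X] by (simp add: fps_X_def)
qed

text \<open>
  Since \<open>F(x, 0) = x\<close>, all terms of \<open>F\<close> other than
  \<open>x\<close> itself and the powers of \<open>y\<close> are divisible by \<open>x
  y\<close>. In degrees up to \<open>m\<close> these see the first argument in degrees below
  \<open>m\<close> only.
\<close>

lemma fgl_eval_perturb:
  assumes a: "a $ 0 = 0" "a' $ 0 = 0" and b: "b $ 0 = 0"
    and eq: "\<And>k. k < m \<Longrightarrow> a' $ k = a $ k" and "k \<le> m"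
  shows "fps_eval2 F a' b $ k = fps_eval2 F a b $ k + (a' $ k - a $ k)"
proof -
  have pow: "(a' ^ i * b ^ j) $ k = (a ^ i * b ^ j) $ k" if "(i, j) \<noteq> (1, 0)" for i j
  proof (cases "j = 0")
    case True
    show ?thesis
    proof (cases "i = 0")
      case False
      then have "i \<ge> 2" using that True by (cases i) auto
      then have "(a' ^ i) $ k = (a ^ i) $ k"
        using a eq \<open>k \<le> m\<close> by (intro fps_power_nth_cong_below) auto
      then show ?thesis using True by simp
    qed simp
  next
    case False
    have "(a' ^ i) $ l * (b ^ j) $ (k - l) = (a ^ i) $ l * (b ^ j) $ (k - l)" if "l \<le> k" for l
    proof (cases "l = k")
      case True
      have "(b ^ j) $ 0 = 0" using b False by (intro fps_power_nth_below) auto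
      then show ?thesis using True by simp
    next
      case False
      then have "(a' ^ i) $ l = (a ^ i) $ l"
        using eq that \<open>k \<le> m\<close> by (intro fps_power_nth_cong) auto
      then show ?thesis by simp
    qed
    note summand = this
    show ?thesis unfolding fps_mult_nth by (rule sum.cong[OF refl]) (rule summand, simp)
  qed
  define N where "N = Suc k"
  have "fps_eval2 F a' b $ k - fps_eval2 F a b $ k =
      (\<Sum>i\<le>N. \<Sum>j\<le>N. F $ i $ j * ((a' ^ i * b ^ j) $ k - (a ^ i * b ^ j) $ k))"
    unfolding fps_eval2_nth[OF a(2) b, of k N F, unfolded N_def, OF le_SucI[OF order.refl], folded N_def]
      fps_eval2_nth[OF a(1) b, of k N F, unfolded N_def, OF le_SucI[OF order.refl], folded N_def]
    by (simp only: sum_subtractf[symmetric] right_diff_distrib)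
  also have "\<dots> = (\<Sum>i\<le>N. \<Sum>j\<le>N. if j = 0 then (if i = 1 then a' $ k - a $ k else 0) else 0)"
  proof (intro sum.cong refl)
    fix i j
    show "F $ i $ j * ((a' ^ i * b ^ j) $ k - (a ^ i * b ^ j) $ k) =
        (if j = 0 then (if i = 1 then a' $ k - a $ k else 0) else 0)"
      using pow[of i j] fgl_nth_x[of 1] by (cases "(i, j) = (1, 0)") auto
  qed
  also have "\<dots> = a' $ k - a $ k" by (simp add: sum.delta N_def)
  finally show ?thesis by (simp add: algebra_simps)
qed

lemma fgl_multiple_nth_0 [simp]: "fgl_multiple F i u $ 0 = 0"
  by (cases i) (simp_all add: fgl_0_0)

lemma fgl_multiple_eval:
  assumes u: "u $ 0 = 0" and v: "v $ 0 = 0"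
  shows "fgl_multiple F i (fps_eval2 F u v) = fps_eval2 F (fgl_multiple F i u) (fgl_multiple F i v)"
proof (induction i)
  case 0
  then show ?case by (simp add: fgl_zero_right)
next
  case (Suc i)
  let ?a = "fgl_multiple F i u" and ?b = "fgl_multiple F i v"
  have "fgl_multiple F (Suc i) (fps_eval2 F u v) = fps_eval2 F (fps_eval2 F u v) (fps_eval2 F ?a ?b)"
    by (simp add: Suc)
  also have "\<dots> = fps_eval2 F u (fps_eval2 F v (fps_eval2 F ?a ?b))"
    by (rule fgl_assoc) (simp_all add: u v fgl_0_0)
  also have "fps_eval2 F v (fps_eval2 F ?a ?b) = fps_eval2 F (fps_eval2 F v ?a) ?b"
    by (rule fgl_assoc[symmetric]) (simp_all add: v)
  also have "fps_eval2 F v ?a = fps_eval2 F ?a v" by (rule fgl_commute) (simp_all add: v)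
  also have "fps_eval2 F (fps_eval2 F ?a v) ?b = fps_eval2 F ?a (fps_eval2 F v ?b)"
    by (rule fgl_assoc) (simp_all add: v)
  also have "fps_eval2 F u (fps_eval2 F ?a (fps_eval2 F v ?b)) = fps_eval2 F (fps_eval2 F u ?a) (fps_eval2 F v ?b)"
    by (rule fgl_assoc[symmetric]) (simp_all add: u fgl_0_0)
  finally show ?case by simp
qed

end

lemma fps_eval2_compose:
  fixes F :: "'a::idom fps fps"
  assumes u: "u $ 0 = 0" and a: "a $ 0 = 0" "b $ 0 = 0"
  shows "fps_eval2 F a b oo u = fps_eval2 F (a oo u) (b oo u)"
proof (rule fps_ext)
  fix n
  have ab: "(a oo u) $ 0 = 0" "(b oo u) $ 0 = 0" using a by simp_all
  have "(fps_eval2 F a b oo u) $ n = (\<Sum>i\<in>{0..n}. (\<Sum>k\<le>n. \<Sum>l\<le>n. F $ k $ l * (a ^ k * b ^ l) $ i) * (u ^ i) $ n)"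
    unfolding fps_compose_nth by (intro sum.cong refl) (simp add: fps_eval2_nth[OF a, of _ n])
  also have "\<dots> = (\<Sum>i\<in>{0..n}. \<Sum>k\<le>n. \<Sum>l\<le>n. F $ k $ l * ((a ^ k * b ^ l) $ i * (u ^ i) $ n))"
    by (simp only: sum_distrib_right mult.assoc)
  also have "\<dots> = (\<Sum>k\<le>n. \<Sum>l\<le>n. \<Sum>i\<in>{0..n}. F $ k $ l * ((a ^ k * b ^ l) $ i * (u ^ i) $ n))"
    by (simp only: sum.swap[where A = "{0..n}" and B = "{..n}"])
  also have "\<dots> = (\<Sum>k\<le>n. \<Sum>l\<le>n. F $ k $ l * ((a ^ k * b ^ l) oo u) $ n)"
    by (simp only: sum_distrib_left[symmetric] fps_compose_nth)
  also have "\<dots> = fps_eval2 F (a oo u) (b oo u) $ n"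
    unfolding fps_eval2_def fps_nth_Abs_fps
    by (simp only: fps_compose_mult_distrib[OF u] fps_compose_power[OF u])
  finally show "(fps_eval2 F a b oo u) $ n = fps_eval2 F (a oo u) (b oo u) $ n" .
qed

lemma fgl_multiple_compose:
  fixes F :: "'a::idom fps fps"
  assumes F: "is_fgl F" and u: "u $ 0 = 0"
  shows "fgl_multiple F i fps_X oo u = fgl_multiple F i u"
  by (induction i) (simp_all add: fps_eval2_compose u fgl_multiple_nth_0[OF F])

text \<open>
  If \<open>D\<close> starts in degree \<open>m\<close> and the arguments start in degree
  \<open>r\<close>, then the value starts in degree \<open>r m\<close>, with the homogeneous
  part of degree \<open>m\<close> of \<open>D\<close> at the leading coefficients of the
  arguments. This is used for \<open>r = 1\<close> and for \<open>r = p^h\<close>.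
\<close>

lemma fps_eval2_leading:
  fixes D :: "'a::idom fps fps"
  assumes D: "\<And>i j. i + j < m \<Longrightarrow> D $ i $ j = 0" and r: "r > 0"
    and u: "\<And>k. k < r \<Longrightarrow> u $ k = 0" and v: "\<And>k. k < r \<Longrightarrow> v $ k = 0"
  shows "k < r * m \<Longrightarrow> fps_eval2 D u v $ k = 0"
    and "fps_eval2 D u v $ (r * m) = (\<Sum>i\<le>m. D $ i $ (m - i) * ((u $ r) ^ i * (v $ r) ^ (m - i)))"
proof -
  have uv: "u = fps_X ^ r * fps_shift r u" "v = fps_X ^ r * fps_shift r v"
    using u v by (auto simp: fps_eq_iff fps_X_power_mult_nth)
  have W: "(u ^ i * v ^ j) $ k = (if k < r * (i + j) then 0 else (fps_shift r u ^ i * fps_shift r v ^ j) $ (k - r * (i + j)))" for i j k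
  proof -
    have "u ^ i * v ^ j = fps_X ^ (r * (i + j)) * (fps_shift r u ^ i * fps_shift r v ^ j)"
      by (subst (1) uv(1), subst (1) uv(2)) (simp add: power_mult_distrib power_mult[symmetric] power_add distrib_left mult_ac)
    then show ?thesis by (simp add: fps_X_power_mult_nth)
  qed
  show "fps_eval2 D u v $ k = 0" if "k < r * m"
    unfolding fps_eval2_def fps_nth_Abs_fps
  proof (intro sum.neutral ballI)
    fix i j assume "i \<in> {..k}" "j \<in> {..k}"
    show "D $ i $ j * (u ^ i * v ^ j) $ k = 0"
    proof (cases "i + j < m")
      case False
      then have "r * m \<le> r * (i + j)" by simp
      with that have "k < r * (i + j)" by linarith
      then show ?thesis by (simp add: W)
    qed (simp add: D)
  qed
  have "fps_eval2 D u v $ (r * m) =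
      (\<Sum>i\<le>r * m. \<Sum>j\<le>r * m. if j = m - i then (if i \<le> m then D $ i $ (m - i) * ((u $ r) ^ i * (v $ r) ^ (m - i)) else 0) else 0)"
    unfolding fps_eval2_def fps_nth_Abs_fps
  proof (intro sum.cong refl)
    fix i j
    consider "i + j < m" | "i + j > m" | "i + j = m" by linarith
    then show "D $ i $ j * (u ^ i * v ^ j) $ (r * m) =
        (if j = m - i then (if i \<le> m then D $ i $ (m - i) * ((u $ r) ^ i * (v $ r) ^ (m - i)) else 0) else 0)"
    proof cases
      case 3
      then have "j = m - i" "i \<le> m" by auto
      then show ?thesis by (simp add: W fps_power_zeroth)
    next
      case 2
      then have "r * m < r * (i + j)" using r by simp
      then show ?thesis using 2 by (auto simp: W)
    qed (auto simp: D)
  qed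
  also have "\<dots> = (\<Sum>i\<le>r * m. if i \<le> m then D $ i $ (m - i) * ((u $ r) ^ i * (v $ r) ^ (m - i)) else 0)"
    using r by (intro sum.cong refl) (auto simp: sum.delta intro: order.trans[OF diff_le_self])
  also have "\<dots> = (\<Sum>i\<le>m. D $ i $ (m - i) * ((u $ r) ^ i * (v $ r) ^ (m - i)))"
    using r by (intro sum.mono_neutral_cong_right) auto
  finally show "fps_eval2 D u v $ (r * m) = (\<Sum>i\<le>m. D $ i $ (m - i) * ((u $ r) ^ i * (v $ r) ^ (m - i)))" .
qed

text \<open>
  The cocycle identity for the homogeneous polynomial with coefficients \<open>c\<close>,
  with its third variable set to \<open>1\<close>, is compared in \<open>x^i y^j\<close>;
  the powers of \<open>x + y\<close> and \<open>y + 1\<close> contribute the binomial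
  coefficients. The coefficients in question are those not met by the two remaining terms,
  as \<open>i, j, m - i - j > 0\<close>.
\<close>

lemma cocycle_coefficients:
  fixes c :: "nat \<Rightarrow> 'a::idom"
  assumes inf: "infinite (UNIV :: 'a set)"
    and coc: "\<And>x y. (\<Sum>k\<le>m. c k * (x ^ k * y ^ (m - k))) + (\<Sum>k\<le>m. c k * ((x + y) ^ k * 1 ^ (m - k))) =
       (\<Sum>k\<le>m. c k * (y ^ k * 1 ^ (m - k))) + (\<Sum>k\<le>m. c k * (x ^ k * (y + 1) ^ (m - k)))"
    and ij: "1 \<le> i" "1 \<le> j" "i + j < m"
  shows "c i * of_nat ((m - i) choose j) = c (i + j) * of_nat ((i + j) choose i)"
proof -
  define a where "a i j = (if j = m - i then c i else 0) + (if i + j \<le> m then c (i + j) * of_nat ((i + j) choose i) else 0)" for i j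
  define b where "b i j = (if i = 0 then c j else 0) + (if i + j \<le> m then c i * of_nat ((m - i) choose j) else 0)" for i j
  have A: "(\<Sum>i\<le>m. (\<Sum>j\<le>m. a i j * y ^ j) * x ^ i) =
     (\<Sum>k\<le>m. c k * (x ^ k * y ^ (m - k))) + (\<Sum>k\<le>m. c k * ((x + y) ^ k * 1 ^ (m - k)))" for x y
  proof -
    have "(\<Sum>i\<le>m. (\<Sum>j\<le>m. a i j * y ^ j) * x ^ i) =
      (\<Sum>i\<le>m. \<Sum>j\<le>m. if j = m - i then c i * (x ^ i * y ^ j) else 0) +
      (\<Sum>i\<le>m. \<Sum>j\<le>m. if i + j \<le> m then c (i + j) * of_nat ((i + j) choose i) * x ^ i * y ^ j else 0)"
      unfolding sum_distrib_right sum.distrib[symmetric] a_def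
      by (intro sum.cong refl) (auto simp: algebra_simps)
    also have "(\<Sum>i\<le>m. \<Sum>j\<le>m. if j = m - i then c i * (x ^ i * y ^ j) else 0) = (\<Sum>k\<le>m. c k * (x ^ k * y ^ (m - k)))"
      by (intro sum.cong refl) (simp add: sum.delta)
    also have "(\<Sum>i\<le>m. \<Sum>j\<le>m. if i + j \<le> m then c (i + j) * of_nat ((i + j) choose i) * x ^ i * y ^ j else 0) =
       (\<Sum>k\<le>m. \<Sum>i\<le>k. if i + (k - i) \<le> m then c (i + (k - i)) * of_nat ((i + (k - i)) choose i) * x ^ i * y ^ (k - i) else 0)"
      by (rule sum_square_eq_triangle) auto
    also have "\<dots> = (\<Sum>k\<le>m. c k * ((x + y) ^ k * 1 ^ (m - k)))"
      unfolding binomial_ring[of x y] by (intro sum.cong refl) (simp add: sum_distrib_left mult_ac)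
    finally show ?thesis .
  qed
  have B: "(\<Sum>i\<le>m. (\<Sum>j\<le>m. b i j * y ^ j) * x ^ i) =
     (\<Sum>k\<le>m. c k * (y ^ k * 1 ^ (m - k))) + (\<Sum>k\<le>m. c k * (x ^ k * (y + 1) ^ (m - k)))" for x y
  proof -
    have "(\<Sum>i\<le>m. (\<Sum>j\<le>m. b i j * y ^ j) * x ^ i) =
      (\<Sum>i\<le>m. if i = 0 then (\<Sum>j\<le>m. c j * y ^ j) else 0) +
      (\<Sum>i\<le>m. c i * (x ^ i * (\<Sum>j\<le>m. if j \<le> m - i then of_nat ((m - i) choose j) * y ^ j else 0)))"
      unfolding sum_distrib_right sum.distrib[symmetric] b_def
    proof (rule sum.cong)
      fix i assume "i \<in> {..m}"
      then show "(\<Sum>j\<le>m. ((if i = 0 then c j else 0) + (if i + j \<le> m then c i * of_nat ((m - i) choose j) else 0)) * y ^ j * x ^ i) =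
          (if i = 0 then \<Sum>j\<le>m. c j * y ^ j else 0) +
          c i * (x ^ i * (\<Sum>j\<le>m. if j \<le> m - i then of_nat ((m - i) choose j) * y ^ j else 0))"
        by (cases "i = 0") (auto simp: sum_distrib_left sum.distrib[symmetric] algebra_simps intro!: sum.cong)
    qed simp
    also have "(\<Sum>i\<le>m. if i = 0 then (\<Sum>j\<le>m. c j * y ^ j) else 0) = (\<Sum>k\<le>m. c k * (y ^ k * 1 ^ (m - k)))"
      by (simp add: sum.delta)
    also have "(\<Sum>i\<le>m. c i * (x ^ i * (\<Sum>j\<le>m. if j \<le> m - i then of_nat ((m - i) choose j) * y ^ j else 0))) =
        (\<Sum>k\<le>m. c k * (x ^ k * (y + 1) ^ (m - k)))"
    proof (intro sum.cong refl arg_cong2[of _ _ _ _ "(*)"])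
      fix i assume "i \<in> {..m}"
      have "(\<Sum>j\<le>m. if j \<le> m - i then of_nat ((m - i) choose j) * y ^ j else 0) = (\<Sum>j\<le>m - i. of_nat ((m - i) choose j) * y ^ j)"
        by (intro sum.mono_neutral_cong_right) auto
      also have "\<dots> = (y + 1) ^ (m - i)" unfolding binomial_ring[of y 1] by simp
      finally show "(\<Sum>j\<le>m. if j \<le> m - i then of_nat ((m - i) choose j) * y ^ j else 0) = (y + 1) ^ (m - i)" .
    qed
    finally show ?thesis .
  qed
  have eq: "(\<Sum>i\<le>m. (\<Sum>j\<le>m. a i j * y ^ j) * x ^ i) = (\<Sum>i\<le>m. (\<Sum>j\<le>m. b i j * y ^ j) * x ^ i)" for x y
    unfolding A B by (rule coc)
  have "(\<Sum>j\<le>m. a i j * y ^ j) = (\<Sum>j\<le>m. b i j * y ^ j)" for y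
    using ij by (intro power_sum_eqI_infinite[OF inf, where n = m and i = i
        and c = "\<lambda>i. \<Sum>j\<le>m. a i j * y ^ j" and d = "\<lambda>i. \<Sum>j\<le>m. b i j * y ^ j"])
      (rule eq, simp)
  then have "a i j = b i j"
    using ij by (intro power_sum_eqI_infinite[OF inf, where n = m and i = j and c = "a i" and d = "b i"]) simp_all
  moreover have "j \<noteq> m - i" using ij by simp
  ultimately show ?thesis using ij by (simp add: a_def b_def)
qed

section \<open>Strict isomorphisms between formal group laws of equal height\<close>

lemma infinite_UNIV_alg_closed: "infinite (UNIV :: 'a::alg_closed_field set)"
proof
  assume fin: "finite (UNIV :: 'a set)"
  define P :: "'a poly" where "P = (\<Prod>a\<in>UNIV. [:-a, 1:]) + 1"
  have "degree (\<Prod>a\<in>(UNIV :: 'a set). [:-a, 1:]) = card (UNIV :: 'a set)"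
    by (subst degree_prod_eq_sum_degree) auto
  moreover have "card (UNIV :: 'a set) > 0" using fin by (simp add: card_gt_0_iff)
  ultimately have "degree P > 0" unfolding P_def by (subst degree_add_eq_left) auto
  then obtain x where "poly P x = 0" using alg_closed_imp_poly_has_root by blast
  moreover have "poly (\<Prod>a\<in>(UNIV :: 'a set). [:-a, 1:]) x = 0"
    using fin by (simp add: poly_prod prod_zero_iff)
  ultimately show False by (simp add: P_def)
qed

lemma fps_power_mult_nth_cong:
  fixes a b :: "'a::comm_ring_1 fps"
  assumes "\<And>k. k \<le> n \<Longrightarrow> a $ k = a' $ k" "\<And>k. k \<le> n \<Longrightarrow> b $ k = b' $ k"
  shows "(a ^ i * b ^ j) $ n = (a' ^ i * b' ^ j) $ n"
  unfolding fps_mult_nth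
  by (intro sum.cong refl arg_cong2[of _ _ _ _ "(*)"] fps_power_nth_cong) (use assms in auto)

lemma fps_eval2_nth_cong:
  fixes a b :: "'a::comm_ring_1 fps"
  assumes "\<And>k. k \<le> n \<Longrightarrow> a $ k = a' $ k" "\<And>k. k \<le> n \<Longrightarrow> b $ k = b' $ k"
  shows "fps_eval2 F a b $ n = fps_eval2 F a' b' $ n"
  using fps_power_mult_nth_cong[of n a a' b b'] assms by (simp add: fps_eval2_def)

lemma fps_compose_nth_monomial:
  "(f oo (fps_const y * fps_X)) $ k = f $ k * y ^ k" for y :: "'a::comm_ring_1"
proof -
  have "(f oo (fps_const y * fps_X)) $ k = (\<Sum>i\<in>{0..k}. if i = k then f $ i * y ^ i else 0)"
    unfolding fps_compose_nth power_mult_distrib fps_const_power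
    by (intro sum.cong refl) (simp add: fps_X_power_nth)
  then show ?thesis by (simp add: sum.delta)
qed

lemma fps2_coeff_eq_0:
  fixes D :: "'a::idom fps fps"
  assumes "infinite (UNIV :: 'a set)"
    and "\<And>x y. fps_eval2 D (fps_const x * fps_X) (fps_const y * fps_X) $ (i + j) = 0"
  shows "D $ i $ j = 0"
proof -
  let ?n = "i + j"
  have "(\<Sum>i\<le>?n. D $ i $ (?n - i) * x ^ i) = (\<Sum>i\<le>?n. 0 * x ^ i)" for x
    using assms(2)[of x 1] unfolding fps_eval2_monomials_nth by simp
  then have "D $ i $ (?n - i) = 0"
    by (intro power_sum_eqI_infinite[OF assms(1), where n = ?n and i = i
          and c = "\<lambda>i. D $ i $ (?n - i)" and d = "\<lambda>i. 0"]) auto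
  then show ?thesis by simp
qed

text \<open>
  Let \<open>P = p^h\<close>. The two formal group laws have multiplication by
  \<open>p\<close> equal to \<open>T(x\<^sup>P)\<close> and \<open>x\<^sup>P\<close>, with
  \<open>T(x) = x + \<dots>\<close>. Any strict isomorphism \<open>\<psi>\<close> from
  \<open>F\<close> to \<open>H\<close> satisfies \<open>\<psi>(T(x\<^sup>P)) =
  \<psi>(x)\<^sup>P\<close>. The construction starts from a series with this property and
  keeps it while making the series a homomorphism in higher and higher degrees. It is this
  property that makes every obstruction a coboundary: it excludes the additional cocycle in
  degrees that are powers of \<open>p\<close>, and it forces the coefficients of the
  obstruction into the field of \<open>P\<close> elements, so that the correction preserves
  the property.
\<close>

context
  fixes p h :: nat and F H :: "'a::alg_closed_field fps fps" and T :: "'a fps"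
  assumes p: "prime p" and char: "CHAR('a) = p" and h: "h > 0"
    and F: "is_fgl F" and H: "is_fgl H"
    and T: "T $ 0 = 0" "T $ 1 = 1"
    and mult_F: "fgl_multiple F p fps_X = T oo fps_X ^ (p ^ h)"
    and mult_H: "fgl_multiple H p fps_X = fps_X ^ (p ^ h)"
begin

lemma P_ge_2: "(p ^ h) \<ge> 2"
  using prime_ge_2_nat[OF p] h self_le_power[of p h] by linarith

lemma X_P_nth_0: "(fps_X ^ (p ^ h)) $ 0 = (0::'a)"
  using prime_gt_0_nat[OF p] by (simp add: fps_X_power_nth)

lemma fps_frobenius_nth: "((f :: 'a fps) ^ (p ^ h)) $ n = (if (p ^ h) dvd n then (f $ (n div (p ^ h))) ^ (p ^ h) else 0)"
proof -
  have P0: "(p ^ h) > 0" using prime_gt_0_nat[OF p] by simp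
  have cut: "fps_cutoff (Suc n) f = (\<Sum>i\<le>n. fps_const (f $ i) * fps_X ^ i)"
    by (auto simp: fps_eq_iff fps_sum_nth fps_X_power_nth if_distrib sum.delta cong: if_cong)
  have "(f ^ (p ^ h)) $ n = (fps_cutoff (Suc n) f ^ (p ^ h)) $ n"
    by (rule fps_power_nth_cong) simp
  also have "fps_cutoff (Suc n) f ^ (p ^ h) = (\<Sum>i\<le>n. (fps_const (f $ i) * fps_X ^ i) ^ (p ^ h))"
    unfolding cut by (rule freshmans_dream_sum') (simp_all add: p char)
  also have "\<dots> $ n = (\<Sum>i\<le>n. if i = n div (p ^ h) then (if (p ^ h) dvd n then (f $ i) ^ (p ^ h) else 0) else 0)"
    unfolding fps_sum_nth
  proof (intro sum.cong refl)
    fix i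
    have "((fps_const (f $ i) * fps_X ^ i) ^ (p ^ h)) $ n = (f $ i) ^ (p ^ h) * (if n = i * (p ^ h) then 1 else 0)"
      unfolding power_mult_distrib fps_const_power power_mult[symmetric]
      by (simp add: fps_X_power_nth)
    then show "((fps_const (f $ i) * fps_X ^ i) ^ (p ^ h)) $ n =
        (if i = n div (p ^ h) then (if (p ^ h) dvd n then (f $ i) ^ (p ^ h) else 0) else 0)"
      using P0 by auto
  qed
  also have "\<dots> = (if (p ^ h) dvd n then (f $ (n div (p ^ h))) ^ (p ^ h) else 0)" by (simp add: sum.delta)
  finally show ?thesis .
qed

text \<open>
  Since \<open>\<psi>(x)\<^sup>P\<close> is obtained from \<open>\<psi>\<close> by raising
  the coefficients to the \<open>P\<close>-th power and inserting \<open>x\<^sup>P\<close>,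
  the condition on the coefficient \<open>c\<close> of \<open>x\<^sup>n\<close> is
  \<open>c\<^sup>P = c + s\<close> with \<open>s\<close> depending on lower coefficients,
  and this has a solution in an algebraically closed field.
\<close>

lemma exists_frobenius_equivariant:
  "\<exists>\<psi> :: 'a fps. \<psi> $ 0 = 0 \<and> \<psi> $ 1 = 1 \<and> \<psi> oo (T oo fps_X ^ (p ^ h)) = \<psi> ^ (p ^ h)"
proof -
  define R where "R f n c \<longleftrightarrow> (n = 0 \<longrightarrow> c = 0) \<and> (n = 1 \<longrightarrow> c = 1) \<and>
      c ^ (p ^ h) = c + (\<Sum>i<n. f $ i * (T ^ i) $ n)" for f :: "'a fps" and n and c
  have "\<exists>f. \<forall>n. R f n (f $ n)"
  proof (rule fps_coefficientwise_choice)
    fix f g :: "'a fps" and n c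
    assume "\<And>i. i < n \<Longrightarrow> f $ i = g $ i" "R f n c"
    then show "R g n c" by (simp add: R_def)
  next
    fix f :: "'a fps" and n :: nat
    consider "n = 0" | "n = 1" | "n \<ge> 2" by linarith
    then show "\<exists>c. R f n c"
    proof cases
      case 1
      then show ?thesis using P_ge_2 prime_gt_0_nat[OF p] by (auto simp: R_def zero_power)
    next
      case 2
      then show ?thesis by (auto simp: R_def)
    next
      case 3
      define s where "s = (\<Sum>i<n. f $ i * (T ^ i) $ n)"
      have "degree (Polynomial.monom 1 (p ^ h) + [:- s, - 1:] :: 'a poly) = (p ^ h)"
        using P_ge_2 by (subst degree_add_eq_left) (auto simp: degree_monom_eq)
      then have "degree (Polynomial.monom 1 (p ^ h) + [:- s, - 1:] :: 'a poly) > 0" using P_ge_2 by linarith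
      then obtain x where "poly (Polynomial.monom 1 (p ^ h) + [:- s, - 1:]) x = 0"
        using alg_closed_imp_poly_has_root by blast
      then have "x ^ (p ^ h) = x + s" by (simp add: poly_monom algebra_simps)
      then show ?thesis using 3 by (auto simp: R_def s_def)
    qed
  qed
  then obtain \<psi> where \<psi>: "\<And>n. R \<psi> n (\<psi> $ n)" by blast
  have "(\<psi> oo T) $ n = (\<psi> $ n) ^ (p ^ h)" for n
  proof -
    have "(T ^ n) $ n = 1" using startsby_zero_power_nth_same[OF T(1), of n] T(2) by simp
    moreover have "{0..n} = insert n {..<n}" by auto
    ultimately show ?thesis using \<psi>[of n] by (simp add: R_def fps_compose_nth)
  qed
  then have "(\<psi> oo T oo fps_X ^ (p ^ h)) $ n = (\<psi> ^ (p ^ h)) $ n" for n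
    using prime_gt_0_nat[OF p] unfolding fps_frobenius_nth
    by (simp add: fps_compose_X_power_nth)
  then have "\<psi> oo (T oo fps_X ^ (p ^ h)) = \<psi> ^ (p ^ h)"
    using T(1) by (simp add: fps_compose_assoc[OF X_P_nth_0] fps_eq_iff)
  moreover have "\<psi> $ 0 = 0" "\<psi> $ 1 = 1" using \<psi>[of 0] \<psi>[of 1] by (simp_all add: R_def)
  ultimately show ?thesis by blast
qed

text \<open>
  The failure \<open>\<psi>(F(x, y)) - H(\<psi>(x), \<psi>(y))\<close> of
  \<open>\<psi>\<close> to be a homomorphism.
\<close>

definition defect :: "'a fps \<Rightarrow> 'a fps fps" where
  "defect \<psi> = subst1 \<psi> F - subst2 H (subst1 \<psi> fps_x) (subst1 \<psi> fps_y)"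

lemma defect_eval:
  assumes "\<psi> $ 0 = 0" "u $ 0 = 0" "v $ 0 = 0"
  shows "fps_eval2 (defect \<psi>) u v = (\<psi> oo fps_eval2 F u v) - fps_eval2 H (\<psi> oo u) (\<psi> oo v)"
  unfolding defect_def using assms
  by (simp add: fps_eval2_diff fps_eval2_subst1 fps_eval2_subst2 fgl_0_0[OF F] fps_eval2_x fps_eval2_y)

definition approx_hom :: "nat \<Rightarrow> 'a fps \<Rightarrow> bool" where
  "approx_hom m \<psi> \<longleftrightarrow> \<psi> $ 0 = 0 \<and> \<psi> $ 1 = 1 \<and> \<psi> oo (T oo fps_X ^ (p ^ h)) = \<psi> ^ (p ^ h) \<and>
     (\<forall>x y k. k < m \<longrightarrow> fps_eval2 (defect \<psi>) (fps_const x * fps_X) (fps_const y * fps_X) $ k = 0)"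

text \<open>
  The leading form \<open>\<Gamma>\<close> of the defect, of degree \<open>m\<close>, is a
  symmetric 2-cocycle by associativity and commutativity of \<open>F\<close> and
  \<open>H\<close>. Comparing multiplication by \<open>p\<close> on both sides shows that
  the sum of \<open>\<Gamma>(1, l)\<close> over \<open>l < p\<close> vanishes, so
  \<open>\<Gamma>\<close> is \<open>b\<close> times \<open>(x + y)^m - x^m - y^m\<close>.
  Applying multiplication by \<open>p\<close> to the arguments of the defect raises it to
  its \<open>P\<close>-th power, hence \<open>\<Gamma>(x\<^sup>P, y\<^sup>P) = \<Gamma>(x,
  y)\<^sup>P\<close>, and \<open>b\<close> may be taken with \<open>b\<^sup>P = b\<close>.
  Finally \<open>\<psi> - b \<psi>^m\<close> has no defect in degree \<open>m\<close>.
\<close>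

lemma approx_hom_step:
  assumes \<psi>: "approx_hom m \<psi>" and m: "m \<ge> 2"
  shows "\<exists>b. approx_hom (Suc m) (\<psi> + fps_const b * \<psi> ^ m)"
proof -
  note inf = infinite_UNIV_alg_closed[where ?'a = 'a]
  have \<psi>01: "\<psi> $ 0 = 0" "\<psi> $ 1 = 1" and \<psi>_frob: "\<psi> oo (T oo fps_X ^ (p ^ h)) = \<psi> ^ (p ^ h)"
    using \<psi> by (auto simp: approx_hom_def)
  let ?D = "defect \<psi>"
  have D_low: "?D $ i $ j = 0" if "i + j < m" for i j
    using \<psi> that by (intro fps2_coeff_eq_0[OF inf]) (auto simp: approx_hom_def)
  have D_00: "?D $ 0 $ 0 = 0" using D_low[of 0 0] m by simp
  define c where "c j = ?D $ j $ (m - j)" for j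
  define \<Gamma> where "\<Gamma> x y = (\<Sum>j\<le>m. c j * (x ^ j * y ^ (m - j)))" for x y
  have D_m: "fps_eval2 ?D u v $ m = \<Gamma> (u $ 1) (v $ 1)" and D_less: "k < m \<Longrightarrow> fps_eval2 ?D u v $ k = 0"
    if "u $ 0 = 0" "v $ 0 = 0" for u v k
    using fps_eval2_leading[OF D_low, of m 1 u v] that by (auto simp: \<Gamma>_def c_def)
  have eval_F_1: "fps_eval2 F u v $ 1 = u $ 1 + v $ 1" if "u $ 0 = 0" "v $ 0 = 0" for u v
  proof -
    have "fps_eval2 F u v $ 1 = (\<Sum>a\<le>1. \<Sum>b\<le>1. F $ a $ b * (u ^ a * v ^ b) $ 1)"
      by (rule fps_eval2_nth) (use that in auto)
    then show ?thesis
      using that fgl_nth_x[OF F, of 0] fgl_nth_x[OF F, of 1] fgl_nth_y[OF F, of 1]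
      by (simp add: fps_mult_nth)
  qed
  have \<psi>_hom: "\<psi> oo fps_eval2 F u v = fps_eval2 H (\<psi> oo u) (\<psi> oo v) + fps_eval2 ?D u v"
    if "u $ 0 = 0" "v $ 0 = 0" for u v
    using defect_eval[OF \<psi>01(1) that] by simp

  have coc: "\<Gamma> x y + \<Gamma> (x + y) z = \<Gamma> y z + \<Gamma> x (y + z)" for x y z
  proof -
    define u where "u = fps_const x * (fps_X :: 'a fps)"
    define v where "v = fps_const y * (fps_X :: 'a fps)"
    define w where "w = fps_const z * (fps_X :: 'a fps)"
    have 0: "u $ 0 = 0" "v $ 0 = 0" "w $ 0 = 0" by (simp_all add: u_def v_def w_def)
    have 1: "u $ 1 = x" "v $ 1 = y" "w $ 1 = z" by (simp_all add: u_def v_def w_def)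
    have \<psi>0: "(\<psi> oo u) $ 0 = 0" "(\<psi> oo v) $ 0 = 0" "(\<psi> oo w) $ 0 = 0" using \<psi>01 by simp_all
    have "(\<psi> oo fps_eval2 F (fps_eval2 F u v) w) $ m =
        fps_eval2 H (\<psi> oo fps_eval2 F u v) (\<psi> oo w) $ m + \<Gamma> (x + y) z"
      using 0 1 by (simp add: \<psi>_hom fgl_0_0[OF F] D_m eval_F_1 del: One_nat_def)
    also have "fps_eval2 H (\<psi> oo fps_eval2 F u v) (\<psi> oo w) $ m =
        fps_eval2 H (fps_eval2 H (\<psi> oo u) (\<psi> oo v)) (\<psi> oo w) $ m + \<Gamma> x y"
      using 0 1 \<psi>01(1) D_m[of u v] D_less[of u v]
      by (subst fgl_eval_perturb[OF H, where a = "fps_eval2 H (\<psi> oo u) (\<psi> oo v)" and m = m])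
         (auto simp: \<psi>_hom fgl_0_0[OF H] fgl_0_0[OF F] D_00)
    finally have left: "(\<psi> oo fps_eval2 F (fps_eval2 F u v) w) $ m =
        fps_eval2 H (fps_eval2 H (\<psi> oo u) (\<psi> oo v)) (\<psi> oo w) $ m + \<Gamma> x y + \<Gamma> (x + y) z" .
    have "(\<psi> oo fps_eval2 F u (fps_eval2 F v w)) $ m =
        fps_eval2 H (\<psi> oo u) (\<psi> oo fps_eval2 F v w) $ m + \<Gamma> x (y + z)"
      using 0 1 by (simp add: \<psi>_hom fgl_0_0[OF F] D_m eval_F_1 del: One_nat_def)
    also have "fps_eval2 H (\<psi> oo u) (\<psi> oo fps_eval2 F v w) = fps_eval2 H (\<psi> oo fps_eval2 F v w) (\<psi> oo u)"
      using \<psi>01(1) by (intro fgl_commute[OF H]) simp_all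
    also have "fps_eval2 H (\<psi> oo fps_eval2 F v w) (\<psi> oo u) $ m =
        fps_eval2 H (fps_eval2 H (\<psi> oo v) (\<psi> oo w)) (\<psi> oo u) $ m + \<Gamma> y z"
      using 0 1 \<psi>01(1) D_m[of v w] D_less[of v w]
      by (subst fgl_eval_perturb[OF H, where a = "fps_eval2 H (\<psi> oo v) (\<psi> oo w)" and m = m])
         (auto simp: \<psi>_hom fgl_0_0[OF H] fgl_0_0[OF F] D_00)
    also have "fps_eval2 H (fps_eval2 H (\<psi> oo v) (\<psi> oo w)) (\<psi> oo u) =
        fps_eval2 H (fps_eval2 H (\<psi> oo u) (\<psi> oo v)) (\<psi> oo w)"
      using \<psi>0 fgl_assoc[OF H \<psi>0] fgl_commute[OF H \<psi>0(1), of "fps_eval2 H (\<psi> oo v) (\<psi> oo w)"]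
      by (simp add: fgl_0_0[OF H])
    finally have right: "(\<psi> oo fps_eval2 F u (fps_eval2 F v w)) $ m =
        fps_eval2 H (fps_eval2 H (\<psi> oo u) (\<psi> oo v)) (\<psi> oo w) $ m + \<Gamma> y z + \<Gamma> x (y + z)" .
    from left right show ?thesis unfolding fgl_assoc[OF F 0] by simp
  qed

  have \<Gamma>_sym: "\<Gamma> x y = \<Gamma> y x" for x y
  proof -
    define u where "u = fps_const x * (fps_X :: 'a fps)"
    define v where "v = fps_const y * (fps_X :: 'a fps)"
    have 0: "u $ 0 = 0" "v $ 0 = 0" by (simp_all add: u_def v_def)
    have 1: "u $ 1 = x" "v $ 1 = y" by (simp_all add: u_def v_def)
    have "fps_eval2 ?D u v = fps_eval2 ?D v u"
      using 0 \<psi>01(1) fgl_commute[OF F 0] fgl_commute[OF H, of "\<psi> oo u" "\<psi> oo v"]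
      by (simp add: defect_eval[OF \<psi>01(1)])
    then show ?thesis using D_m[OF 0] D_m[OF 0(2,1)] 1 by (simp del: One_nat_def)
  qed
  have \<Gamma>_0: "\<Gamma> x 0 = 0" for x
  proof -
    define u where "u = fps_const x * (fps_X :: 'a fps)"
    have 0: "u $ 0 = 0" "u $ 1 = x" by (simp_all add: u_def)
    have "fps_eval2 ?D u 0 = 0"
      using 0 \<psi>01(1) by (simp add: defect_eval[OF \<psi>01(1)] fgl_zero_right[OF F] fgl_zero_right[OF H])
    then show ?thesis using D_m[of u 0] 0 by (simp del: One_nat_def)
  qed
  have c_m: "c m = 0"
  proof -
    have "\<Gamma> 1 0 = (\<Sum>j\<le>m. if j = m then c j else 0)"
      unfolding \<Gamma>_def by (intro sum.cong refl) (auto simp: power_0_left)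
    then show ?thesis using \<Gamma>_0[of 1] by simp
  qed
  have c_sym: "c (m - j) = c j" if "j \<le> m" for j
  proof -
    have eq: "(\<Sum>j\<le>m. c (m - j) * x ^ j) = (\<Sum>j\<le>m. c j * x ^ j)" for x
    proof -
      have "(\<Sum>j\<le>m. c (m - j) * x ^ j) = (\<Sum>j\<le>m. c j * x ^ (m - j))"
        by (rule sum.reindex_bij_witness[of _ "\<lambda>j. m - j" "\<lambda>j. m - j"]) auto
      also have "\<dots> = \<Gamma> 1 x" by (simp add: \<Gamma>_def)
      also have "\<dots> = \<Gamma> x 1" by (rule \<Gamma>_sym)
      finally show ?thesis by (simp add: \<Gamma>_def)
    qed
    show ?thesis
      by (rule power_sum_eqI_infinite[OF inf, where n = m and i = j and c = "\<lambda>j. c (m - j)" and d = c])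
         (use that in \<open>auto simp: eq\<close>)
  qed
  have c_0: "c 0 = 0" using c_sym[of 0] c_m by simp

  \<comment> \<open>Each addition of \<open>x\<close> contributes the value of
  \<open>\<Gamma>\<close> at the leading coefficients \<open>1\<close> of \<open>x\<close>
  and \<open>i\<close> of the \<open>i\<close>-th multiple.\<close>
  have mult_defect: "(\<forall>k<m. (\<psi> oo fgl_multiple F i fps_X) $ k = fgl_multiple H i \<psi> $ k) \<and>
      (\<psi> oo fgl_multiple F i fps_X) $ m = fgl_multiple H i \<psi> $ m + (\<Sum>l<i. \<Gamma> 1 (of_nat l)) \<and>
      fgl_multiple F i fps_X $ 1 = of_nat i" for i
  proof (induction i)
    case 0
    then show ?case using \<psi>01 by simp
  next
    case (Suc i)
    let ?E = "fgl_multiple F i fps_X" and ?G = "fgl_multiple H i \<psi>"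
    have E0: "?E $ 0 = 0" by (rule fgl_multiple_nth_0[OF F])
    have G0: "?G $ 0 = 0" by (rule fgl_multiple_nth_0[OF H])
    have \<psi>E0: "(\<psi> oo ?E) $ 0 = 0" using \<psi>01 by simp
    have IH: "\<And>k. k < m \<Longrightarrow> (\<psi> oo ?E) $ k = ?G $ k"
      "(\<psi> oo ?E) $ m = ?G $ m + (\<Sum>l<i. \<Gamma> 1 (of_nat l))" "?E $ 1 = of_nat i"
      using Suc by auto
    have hom: "\<psi> oo fgl_multiple F (Suc i) fps_X = fps_eval2 H (\<psi> oo ?E) \<psi> + fps_eval2 ?D fps_X ?E"
      using \<psi>_hom[of fps_X ?E] E0 fgl_commute[OF H \<psi>01(1) \<psi>E0] by simp
    have per: "fps_eval2 H (\<psi> oo ?E) \<psi> $ k = fps_eval2 H ?G \<psi> $ k + ((\<psi> oo ?E) $ k - ?G $ k)" if "k \<le> m" for k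
      by (rule fgl_eval_perturb[OF H G0 \<psi>E0 \<psi>01(1) IH(1) that])
    have comm: "fgl_multiple H (Suc i) \<psi> = fps_eval2 H ?G \<psi>"
      using fgl_commute[OF H \<psi>01(1) G0] by simp
    show ?case
    proof (intro conjI allI impI)
      fix k assume "k < m"
      then show "(\<psi> oo fgl_multiple F (Suc i) fps_X) $ k = fgl_multiple H (Suc i) \<psi> $ k"
        unfolding hom comm using per[of k] IH(1)[of k] D_less[of fps_X ?E k] E0 by simp
    next
      have "fps_eval2 ?D fps_X ?E $ m = \<Gamma> 1 (of_nat i)"
        using D_m[of fps_X ?E] E0 IH(3) by (simp del: One_nat_def)
      then show "(\<psi> oo fgl_multiple F (Suc i) fps_X) $ m =
          fgl_multiple H (Suc i) \<psi> $ m + (\<Sum>l<Suc i. \<Gamma> 1 (of_nat l))"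
        unfolding hom comm using per[of m] IH(2) by simp
    next
      show "fgl_multiple F (Suc i) fps_X $ 1 = of_nat (Suc i)"
        using eval_F_1[of fps_X ?E] E0 IH(3) by (simp del: One_nat_def)
    qed
  qed
  have sum_p: "(\<Sum>l\<in>{1..<p}. \<Sum>j\<in>{1..<m}. c j * of_nat l ^ (m - j)) = 0"
  proof -
    have "fgl_multiple H p \<psi> = fps_X ^ (p ^ h) oo \<psi>"
      unfolding mult_H[symmetric] by (rule fgl_multiple_compose[OF H \<psi>01(1), symmetric])
    also have "\<dots> = \<psi> ^ (p ^ h)"
      using fps_compose_power[OF \<psi>01(1), of fps_X "p ^ h"] \<psi>01(1) by simp
    also have "\<dots> = \<psi> oo fgl_multiple F p fps_X" by (simp add: mult_F \<psi>_frob)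
    finally have "(\<Sum>l<p. \<Gamma> 1 (of_nat l)) = 0" using mult_defect[of p] by simp
    moreover have "{..<p} = insert 0 {1..<p}" using prime_gt_0_nat[OF p] by auto
    ultimately have "(\<Sum>l\<in>{1..<p}. \<Gamma> 1 (of_nat l)) = 0" using \<Gamma>_0[of 1] by simp
    moreover have "\<Gamma> 1 x = (\<Sum>j\<in>{1..<m}. c j * x ^ (m - j))" for x
    proof -
      have set: "{..m} = insert 0 (insert m {1..<m})" using m by auto
      show ?thesis unfolding \<Gamma>_def set using m c_0 c_m by simp
    qed
    ultimately show ?thesis by simp
  qed
  obtain b where b: "\<And>j. 0 < j \<Longrightarrow> j < m \<Longrightarrow> c j = b * of_nat (m choose j)"
  proof -
    have "\<exists>b. \<forall>j. 0 < j \<longrightarrow> j < m \<longrightarrow> c j = b * of_nat (m choose j)"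
    proof (rule symmetric_cocycle_coboundary[OF p char])
      show "c i * of_nat ((m - i) choose j) = c (i + j) * of_nat ((i + j) choose i)"
        if "1 \<le> i" "1 \<le> j" "i + j < m" for i j
        using cocycle_coefficients[OF inf _ that, of c] coc[of _ _ 1] unfolding \<Gamma>_def by blast
      show "c (m - i) = c i" if "0 < i" "i < m" for i using c_sym that by simp
    qed (rule sum_p)
    then show ?thesis using that by blast
  qed

  \<comment> \<open>Compare the leading terms of the defect at \<open>(T(u\<^sup>P),
  T(v\<^sup>P))\<close>, which are those of the formal multiples by \<open>p\<close>, with
  the \<open>P\<close>-th power of the defect at \<open>(u, v)\<close>, for \<open>u = x
  t\<close> and \<open>v = t\<close>.\<close>
  have c_P: "c j ^ (p ^ h) = c j" if "j \<le> m" for j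
  proof -
    have eq: "(\<Sum>j\<le>m. c j ^ (p ^ h) * (x ^ (p ^ h)) ^ j) = (\<Sum>j\<le>m. c j * (x ^ (p ^ h)) ^ j)" for x
    proof -
      define u where "u = fps_const x * (fps_X :: 'a fps)"
      define v where "v = fps_const 1 * (fps_X :: 'a fps)"
      let ?E = "T oo fps_X ^ (p ^ h)"
      have 0: "u $ 0 = 0" "v $ 0 = 0" "u $ 1 = x" "v $ 1 = 1" by (simp_all add: u_def v_def)
      have E0: "(?E oo w) $ 0 = 0" for w using T by simp
      have E_F: "?E oo fps_eval2 F u v = fps_eval2 F (?E oo u) (?E oo v)"
        using fgl_multiple_eval[OF F 0(1,2), of p] 0
        by (simp add: mult_F[symmetric] fgl_multiple_compose[OF F] fgl_0_0[OF F])
      have E_H: "fps_eval2 H a b ^ (p ^ h) = fps_eval2 H (a ^ (p ^ h)) (b ^ (p ^ h))" if ab: "a $ 0 = 0" "b $ 0 = 0" for a b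
      proof -
        have "fgl_multiple H p w = w ^ (p ^ h)" if "w $ 0 = 0" for w
          using fgl_multiple_compose[OF H that, of p] fps_compose_power[OF that, of fps_X "p ^ h"] that
          by (simp add: mult_H)
        then show ?thesis using fgl_multiple_eval[OF H ab, of p] ab by (simp add: fgl_0_0[OF H])
      qed
      have \<psi>E: "\<psi> oo (?E oo w) = (\<psi> oo w) ^ (p ^ h)" if "w $ 0 = 0" for w
        using that T fps_compose_power[OF that, of \<psi> "p ^ h"] \<psi>_frob by (simp add: fps_compose_assoc)
      have Fuv: "fps_eval2 F u v $ 0 = 0" by (simp add: fgl_0_0[OF F])
      have "fps_eval2 ?D (?E oo u) (?E oo v) =
          (\<psi> oo fps_eval2 F u v) ^ (p ^ h) - fps_eval2 H (\<psi> oo u) (\<psi> oo v) ^ (p ^ h)"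
        using \<psi>01(1) 0
        by (simp add: defect_eval[OF \<psi>01(1) E0 E0] E_F[symmetric] \<psi>E[OF Fuv] \<psi>E E_H del: fps_compose_power)
      also have "\<dots> = fps_eval2 ?D u v ^ (p ^ h)"
        unfolding defect_eval[OF \<psi>01(1) 0(1,2)] by (rule frobenius_fps_diff[OF p char, symmetric])
      finally have D_E: "fps_eval2 ?D (?E oo u) (?E oo v) $ ((p ^ h) * m) = (fps_eval2 ?D u v ^ (p ^ h)) $ ((p ^ h) * m)" by simp
      have P0: "(p ^ h) > 0" using prime_gt_0_nat[OF p] by simp
      have E_nth: "(?E oo (fps_const y * fps_X)) $ k = (if (p ^ h) dvd k then T $ (k div (p ^ h)) * y ^ k else 0)" for y k
      proof -
        have "(?E oo (fps_const y * fps_X)) $ k = ?E $ k * y ^ k"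
          by (simp add: fps_compose_nth_monomial)
        then show ?thesis using P0 by (simp add: fps_compose_X_power_nth)
      qed
      have E_low: "(?E oo u) $ k = 0" "(?E oo v) $ k = 0" if "k < (p ^ h)" for k
        unfolding u_def v_def E_nth using that T(1) by (auto simp: dvd_imp_le)
      have E_P: "(?E oo u) $ (p ^ h) = x ^ (p ^ h)" "(?E oo v) $ (p ^ h) = 1"
        unfolding u_def v_def E_nth using T(2) P0 by auto
      have "fps_eval2 ?D (?E oo u) (?E oo v) $ ((p ^ h) * m) = (\<Sum>j\<le>m. c j * (x ^ (p ^ h)) ^ j)"
        using fps_eval2_leading(2)[OF D_low P0 E_low, of m] E_P by (simp add: c_def)
      moreover have "(fps_eval2 ?D u v ^ (p ^ h)) $ ((p ^ h) * m) = (\<Gamma> x 1) ^ (p ^ h)"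
        unfolding fps_frobenius_nth using P0 D_m[OF 0(1,2)] 0 by simp
      moreover have "(\<Gamma> x 1) ^ (p ^ h) = (\<Sum>j\<le>m. (c j * (x ^ j * 1 ^ (m - j))) ^ (p ^ h))"
        unfolding \<Gamma>_def by (rule freshmans_dream_sum') (simp_all add: p char)
      ultimately show ?thesis using D_E
        by (simp add: power_mult_distrib power_mult[symmetric] mult.commute)
    qed
    have surj: "\<exists>x. y = x ^ (p ^ h)" for y :: 'a
    proof -
      have "degree (Polynomial.monom 1 (p ^ h) + [:- y:] :: 'a poly) = (p ^ h)"
        using P_ge_2 prime_gt_0_nat[OF p] by (subst degree_add_eq_left) (auto simp: degree_monom_eq)
      then have "degree (Polynomial.monom 1 (p ^ h) + [:- y:] :: 'a poly) > 0" using P_ge_2 by linarith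
      then obtain x where "poly (Polynomial.monom 1 (p ^ h) + [:- y:]) x = 0"
        using alg_closed_imp_poly_has_root by blast
      then show ?thesis by (intro exI[of _ x]) (simp add: poly_monom)
    qed
    have "(\<Sum>j\<le>m. c j ^ (p ^ h) * y ^ j) = (\<Sum>j\<le>m. c j * y ^ j)" for y
      using surj[of y] eq by auto
    then show ?thesis
      by (intro power_sum_eqI_infinite[OF inf, where n = m and i = j and c = "\<lambda>j. c j ^ (p ^ h)" and d = c] that)
  qed
  \<comment> \<open>If all the binomial coefficients vanish in the field, then
  \<open>b\<close> is arbitrary and is replaced by \<open>0\<close>.\<close>
  obtain b' where b': "b' ^ (p ^ h) = b'" "\<And>j. 0 < j \<Longrightarrow> j < m \<Longrightarrow> c j = b' * of_nat (m choose j)"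
  proof (cases "\<exists>j. 0 < j \<and> j < m \<and> of_nat (m choose j) \<noteq> (0::'a)")
    case True
    then obtain j where j: "0 < j" "j < m" "of_nat (m choose j) \<noteq> (0::'a)" by blast
    have "b ^ (p ^ h) * of_nat (m choose j) = b * of_nat (m choose j)"
      using c_P[of j] b[of j] j by (simp add: power_mult_distrib frobenius_of_nat[OF p char])
    then have "b ^ (p ^ h) = b" using j by simp
    then show ?thesis using b that by blast
  next
    case False
    have "(0::'a) ^ (p ^ h) = 0" using prime_gt_0_nat[OF p] by (simp add: zero_power)
    moreover have "c j = 0 * of_nat (m choose j)" if "0 < j" "j < m" for j
      using b[OF that] False that by auto
    ultimately show ?thesis using that by blast
  qed

  \<comment> \<open>Subtracting \<open>b' \<psi>^m\<close> rather than \<open>b' x^m\<close>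
  keeps the relation with multiplication by \<open>p\<close>, because \<open>b'\<close> is
  fixed by the \<open>P\<close>-th power.\<close>
  define \<psi>' where "\<psi>' = \<psi> + fps_const (- b') * \<psi> ^ m"
  have \<psi>_pow: "(\<psi> ^ m) $ k = 0" if "k < m" for k using fps_power_nth_below[OF \<psi>01(1) that] .
  have \<psi>'_low: "\<psi>' $ k = \<psi> $ k" if "k < m" for k using \<psi>_pow[OF that] by (simp add: \<psi>'_def)
  have \<psi>'01: "\<psi>' $ 0 = 0" "\<psi>' $ 1 = 1" using \<psi>'_low[of 0] \<psi>'_low[of 1] \<psi>01 m by simp_all
  have \<psi>'_compose: "\<psi>' oo u = (\<psi> oo u) + fps_const (- b') * (\<psi> oo u) ^ m" if "u $ 0 = 0" for u
    using that by (simp add: \<psi>'_def fps_compose_add_distrib fps_compose_mult_distrib fps_compose_power)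
  have pow_m: "((\<psi> oo u) ^ m) $ k = (if k = m then (u $ 1) ^ m else 0)" if "u $ 0 = 0" "k \<le> m" for u k
  proof -
    have \<psi>u: "(\<psi> oo u) $ 0 = 0" using \<psi>01 by simp
    have "(\<psi> oo u) $ 1 = u $ 1" using \<psi>01 that by (simp add: fps_compose_nth)
    then show ?thesis
      using that fps_power_nth_below[OF \<psi>u, of k m] startsby_zero_power_nth_same[OF \<psi>u, of m] by auto
  qed
  have "approx_hom (Suc m) \<psi>'"
    unfolding approx_hom_def
  proof (intro conjI allI impI)
    let ?E = "T oo fps_X ^ (p ^ h)"
    have E0: "?E $ 0 = 0" using T by simp
    have "(- b') ^ (p ^ h) = - b'"
      using frobenius_diff[OF p char, of 0 b' h] b'(1) prime_gt_0_nat[OF p] by (simp add: zero_power)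
    then have "(fps_const (- b') * \<psi> ^ m) ^ (p ^ h) = fps_const (- b') * (\<psi> ^ (p ^ h)) ^ m"
      unfolding power_mult_distrib fps_const_power by (simp add: power_mult[symmetric] mult.commute)
    then have "\<psi>' ^ (p ^ h) = \<psi> ^ (p ^ h) + fps_const (- b') * (\<psi> ^ (p ^ h)) ^ m"
      unfolding \<psi>'_def frobenius_fps_add[OF p char] by simp
    then show "\<psi>' oo ?E = \<psi>' ^ (p ^ h)" using \<psi>'_compose[OF E0] by (simp add: \<psi>_frob)
  next
    fix x y :: 'a and k :: nat assume "k < Suc m"
    then have k: "k \<le> m" by simp
    define u where "u = fps_const x * (fps_X :: 'a fps)"
    define v where "v = fps_const y * (fps_X :: 'a fps)"
    have 0: "u $ 0 = 0" "v $ 0 = 0" and 1: "u $ 1 = x" "v $ 1 = y" by (simp_all add: u_def v_def)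
    have 00: "(\<psi> oo w) $ 0 = 0" "(\<psi>' oo w) $ 0 = 0" for w using \<psi>01 \<psi>'01 by simp_all
    have F0: "fps_eval2 F u v $ 0 = 0" by (simp add: fgl_0_0[OF F])
    have diff: "(\<psi>' oo w) $ j - (\<psi> oo w) $ j = (if j = m then - b' * (w $ 1) ^ m else 0)" if "w $ 0 = 0" "j \<le> m" for w j
      using pow_m[OF that] by (simp add: \<psi>'_compose[OF that(1)])
    have same: "(\<psi>' oo w) $ j = (\<psi> oo w) $ j" if "w $ 0 = 0" "j < m" for w j
      using diff[of w j] that by simp
    have "fps_eval2 H (\<psi>' oo u) (\<psi>' oo v) $ k = fps_eval2 H (\<psi> oo u) (\<psi>' oo v) $ k + (if k = m then - b' * x ^ m else 0)"
      using fgl_eval_perturb[OF H 00(1) 00(2) 00(2) same[OF 0(1)] k] diff[OF 0(1) k] 1 by simp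
    also have "fps_eval2 H (\<psi> oo u) (\<psi>' oo v) = fps_eval2 H (\<psi>' oo v) (\<psi> oo u)"
      by (rule fgl_commute[OF H 00(1) 00(2)])
    also have "fps_eval2 H (\<psi>' oo v) (\<psi> oo u) $ k = fps_eval2 H (\<psi> oo v) (\<psi> oo u) $ k + (if k = m then - b' * y ^ m else 0)"
      using fgl_eval_perturb[OF H 00(1) 00(2) 00(1) same[OF 0(2)] k] diff[OF 0(2) k] 1 by simp
    also have "fps_eval2 H (\<psi> oo v) (\<psi> oo u) = fps_eval2 H (\<psi> oo u) (\<psi> oo v)"
      by (rule fgl_commute[OF H 00(1) 00(1)])
    finally have HH: "fps_eval2 H (\<psi>' oo u) (\<psi>' oo v) $ k = fps_eval2 H (\<psi> oo u) (\<psi> oo v) $ k +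
        (if k = m then - b' * y ^ m else 0) + (if k = m then - b' * x ^ m else 0)" .
    have FF: "(\<psi>' oo fps_eval2 F u v) $ k = (\<psi> oo fps_eval2 F u v) $ k + (if k = m then - b' * (x + y) ^ m else 0)"
      using diff[OF F0 k] eval_F_1[OF 0] 1 by (simp add: algebra_simps)
    have D': "fps_eval2 (defect \<psi>') u v $ k =
        fps_eval2 ?D u v $ k + (if k = m then - b' * ((x + y) ^ m - x ^ m - y ^ m) else 0)"
      unfolding defect_eval[OF \<psi>'01(1) 0] defect_eval[OF \<psi>01(1) 0] fps_sub_nth FF HH
      by (simp add: algebra_simps)
    show "fps_eval2 (defect \<psi>') (fps_const x * fps_X) (fps_const y * fps_X) $ k = 0"
    proof (cases "k = m")
      case True
      have set: "{..m} = insert 0 (insert m {1..<m})" using m by auto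
      have "\<Gamma> x y = (\<Sum>j\<in>{1..<m}. b' * (of_nat (m choose j) * x ^ j * y ^ (m - j)))"
        unfolding \<Gamma>_def set using m c_0 c_m b'(2) by (simp add: mult.assoc)
      also have "\<dots> = b' * (\<Sum>j\<in>{1..<m}. of_nat (m choose j) * x ^ j * y ^ (m - j))"
        by (simp only: sum_distrib_left)
      also have "(\<Sum>j\<in>{1..<m}. of_nat (m choose j) * x ^ j * y ^ (m - j)) = (x + y) ^ m - x ^ m - y ^ m"
        unfolding binomial_ring[of x y m] set using m by simp
      finally show ?thesis using D' D_m[OF 0] 1 True unfolding u_def v_def by simp
    next
      case False
      then show ?thesis using D' D_less[OF 0, of k] k unfolding u_def v_def by simp
    qed
  qed (use \<psi>'01 in auto)
  then show ?thesis unfolding \<psi>'_def by blast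
qed

text \<open>
  The approximations stabilise in every degree, and the limit has no defect at any point
  \<open>(x t, y t)\<close>.
\<close>

theorem exists_strict_iso: "\<exists>\<psi>. strict_fgl_iso F H \<psi>"
proof -
  note inf = infinite_UNIV_alg_closed[where ?'a = 'a]
  have base: "\<exists>\<psi>. approx_hom (0 + 2) \<psi>"
  proof -
    obtain \<psi> :: "'a fps" where \<psi>: "\<psi> $ 0 = 0" "\<psi> $ 1 = 1" "\<psi> oo (T oo fps_X ^ (p ^ h)) = \<psi> ^ (p ^ h)"
      using exists_frobenius_equivariant by blast
    have "fps_eval2 (defect \<psi>) (fps_const x * fps_X) (fps_const y * fps_X) $ k = 0" if "k < 2" for x y k
    proof -
      define u where "u = fps_const x * (fps_X :: 'a fps)"
      define v where "v = fps_const y * (fps_X :: 'a fps)"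
      have 0: "u $ 0 = 0" "v $ 0 = 0" by (simp_all add: u_def v_def)
      have e: "fps_eval2 G a b $ k = a $ k + b $ k" if "is_fgl G" "a $ 0 = 0" "b $ 0 = 0" for G and a b :: "'a fps"
      proof -
        have "fps_eval2 G a b $ k = fps_eval2 G 0 b $ k + (a $ k - 0 $ k)"
          using fgl_eval_perturb[OF that(1), where a = 0 and a' = a and b = b and m = 1 and k = k] that \<open>k < 2\<close> by auto
        then show ?thesis using fgl_zero_left[OF that(1,3)] by simp
      qed
      have psi: "(\<psi> oo w) $ k = w $ k" if "w $ 0 = 0" for w
        using \<psi> that \<open>k < 2\<close> by (cases k) (auto simp: fps_compose_nth less_Suc_eq)
      have "fps_eval2 (defect \<psi>) u v $ k = 0"
        using 0 \<psi>(1) by (simp add: defect_eval[OF \<psi>(1) 0] e[OF F] e[OF H] psi fgl_0_0[OF F])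
      then show ?thesis by (simp add: u_def v_def)
    qed
    then show ?thesis using \<psi> by (intro exI[of _ \<psi>]) (auto simp: approx_hom_def)
  qed
  have step: "\<exists>\<psi>'. approx_hom (Suc n + 2) \<psi>' \<and> (\<forall>k<n + 2. \<psi>' $ k = \<psi> $ k)" if ap: "approx_hom (n + 2) \<psi>" for \<psi> n
  proof -
    obtain b where "approx_hom (Suc (n + 2)) (\<psi> + fps_const b * \<psi> ^ (n + 2))"
      using approx_hom_step[OF ap] by auto
    moreover have "\<psi> $ 0 = 0" using ap by (simp add: approx_hom_def)
    ultimately show ?thesis
      by (intro exI[of _ "\<psi> + fps_const b * \<psi> ^ (n + 2)"]) (auto simp: fps_power_nth_below simp del: power_Suc power_Suc2)
  qed
  obtain f where f: "\<And>n. approx_hom (n + 2) (f n)" "\<And>n k. k < n + 2 \<Longrightarrow> f (Suc n) $ k = f n $ k"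
    using dependent_nat_choice[of "\<lambda>n. approx_hom (n + 2)" "\<lambda>n \<psi> \<psi>'. \<forall>k<n + 2. \<psi>' $ k = \<psi> $ k", OF base step]
    by blast
  \<comment> \<open>From the \<open>k\<close>-th approximation on, the coefficient of degree
  \<open>k\<close> does not change.\<close>
  define \<psi> where "\<psi> = Abs_fps (\<lambda>k. f k $ k)"
  have \<psi>_f: "\<psi> $ k = f n $ k" if "k \<le> n" for k n
    using that
  proof (induction n rule: dec_induct)
    case (step n)
    then show ?case using f(2)[of k n] by simp
  qed (simp add: \<psi>_def)
  have \<psi>01: "\<psi> $ 0 = 0" "\<psi> $ 1 = 1"
    using \<psi>_f[of 0 0] \<psi>_f[of 1 1] f(1)[of 0] f(1)[of 1] by (simp_all add: approx_hom_def)
  have "defect \<psi> = 0"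
  proof (rule fps2_eqI_points[OF inf])
    fix x y :: 'a
    define u where "u = fps_const x * (fps_X :: 'a fps)"
    define v where "v = fps_const y * (fps_X :: 'a fps)"
    have 0: "u $ 0 = 0" "v $ 0 = 0" by (simp_all add: u_def v_def)
    have "fps_eval2 (defect \<psi>) u v $ n = 0" for n
    proof -
      have f0: "f n $ 0 = 0" using f(1)[of n] by (simp add: approx_hom_def)
      have comp: "(\<psi> oo w) $ k = (f n oo w) $ k" if "k \<le> n" for w k
        unfolding fps_compose_nth
        by (intro sum.cong refl arg_cong2[of _ _ _ _ "(*)"] \<psi>_f) (use that in auto)
      have "fps_eval2 (defect \<psi>) u v $ n = fps_eval2 (defect (f n)) u v $ n"
        unfolding defect_eval[OF \<psi>01(1) 0] defect_eval[OF f0 0] fps_sub_nth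
        by (intro arg_cong2[of _ _ _ _ "(-)"] fps_eval2_nth_cong comp) auto
      also have "\<dots> = 0" using f(1)[of n] by (auto simp: approx_hom_def u_def v_def)
      finally show ?thesis .
    qed
    then show "fps_eval2 (defect \<psi>) (fps_const x * fps_X) (fps_const y * fps_X) =
        fps_eval2 0 (fps_const x * fps_X) (fps_const y * fps_X)"
      by (simp add: fps_eq_iff u_def v_def) (simp add: fps_eval2_def)
  qed
  then have "strict_fgl_iso F H \<psi>"
    using \<psi>01 by (simp add: strict_fgl_iso_def fgl_iso_def defect_def)
  then show ?thesis by blast
qed

end

section \<open>Formal modules of Lubin--Tate type\<close>

definition polys_over :: "'a::comm_ring_1 set \<Rightarrow> 'a poly set" where
  "polys_over A = {P. \<forall>i. poly.coeff P i \<in> A}"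

lemma is_subring_polys_over: "is_subring A \<Longrightarrow> is_subring (polys_over A)"
  unfolding is_subring_def[of "polys_over A"] unfolding polys_over_def
  by (auto simp: coeff_mult coeff_1 intro!: subring_sum subring_mult subring_add subring_uminus
      subring_1 subring_0)

text \<open>
  A common setting for the ring of integers of \<open>K\<close>, with \<open>Q =
  q\<^sup>n\<close>, and for the \<open>p\<close>-adic integers, with \<open>Q = p^(d
  n)\<close>: in both cases \<open>Q\<close>-th powers are the identity modulo the
  uniformizer. The formal module below has logarithm \<open>x + x\<^sup>Q / \<pi> +
  x^(Q\<^sup>2) / \<pi>\<^sup>2 + \<dots>\<close>.
\<close>

locale lubin_tate =
  fixes A :: "'K::field set" and \<pi> :: 'K and red :: "'K \<Rightarrow> 'L::field" and p s :: nat
  assumes red: "subring_hom A red" and \<pi>: "\<pi> \<in> A" "\<pi> \<noteq> 0" "red \<pi> = 0"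
    and p: "prime p" "cong_pow A \<pi> 1 (of_nat p) 0" and s: "s > 0"
    and frobenius: "a \<in> A \<Longrightarrow> cong_pow A \<pi> 1 (a ^ (p ^ s)) a"
    and infinite_K: "infinite (UNIV :: 'K set)"
begin

sublocale red: subring_hom A red by (rule red)

abbreviation Q where "Q \<equiv> p ^ s"

definition lg :: "'K fps" where "lg = lt_log (1 / \<pi>) Q"

lemma frobenius_lift_const: "frobenius_lift A \<pi> (1 / \<pi>) (\<lambda>x. x) p s"
  by unfold_locales (use red.subring \<pi> p s frobenius in auto)

lemma Q_ge_2: "Q \<ge> 2"
  using frobenius_lift.Q_ge_2[OF frobenius_lift_const] .

lemma lg_0_1: "lg $ 0 = 0" "lg $ 1 = 1"
  unfolding lg_def by (rule lt_log_nth_0_1[OF Q_ge_2])+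

abbreviation A_poly :: "'K poly set" where "A_poly \<equiv> polys_over A"

lemma A_poly_pCons: "pCons a P \<in> A_poly \<longleftrightarrow> a \<in> A \<and> P \<in> A_poly"
  by (auto simp: polys_over_def coeff_pCons split: nat.splits)

lemmas is_subring_A_poly = is_subring_polys_over[OF red.subring]

lemma subring_hom_pcompose: "subring_hom UNIV (\<lambda>P :: 'K poly. P \<circ>\<^sub>p R)"
  by unfold_locales (simp_all add: pcompose_add pcompose_mult pcompose_1)

lemma A_poly_const: "a \<in> A \<Longrightarrow> [:a:] \<in> A_poly"
  using subring_0[OF red.subring] by (simp add: polys_over_def coeff_pCons split: nat.splits)

lemma A_poly_X: "[:0, 1:] \<in> A_poly"
  using subring_0[OF red.subring] subring_1[OF red.subring]
  by (auto simp: polys_over_def coeff_pCons split: nat.splits)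

lemma A_poly_pcompose: "P \<in> A_poly \<Longrightarrow> P \<circ>\<^sub>p [:0, 1:] ^ Q \<in> A_poly"
proof (induction P)
  case (pCons a P)
  then show ?case
    unfolding pcompose_pCons A_poly_pCons
    by (intro subring_add[OF is_subring_A_poly] subring_mult[OF is_subring_A_poly]
        subring_power[OF is_subring_A_poly] A_poly_const A_poly_X) auto
qed (simp add: polys_over_def subring_0[OF red.subring])

lemma p_poly: obtains c where "c \<in> A_poly" "of_nat p = [:\<pi>:] * c"
proof -
  obtain c where "c \<in> A" "of_nat p = \<pi> * c" using p(2) by (auto simp: cong_pow_def)
  then show ?thesis by (intro that[of "[:c:]"] A_poly_const) (simp_all add: of_nat_poly)
qed

text \<open>
  On constants this is the hypothesis on \<open>A\<close>, the variable is mapped to its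
  \<open>Q\<close>-th power by definition, and \<open>Q\<close>-th powers are additive
  modulo \<open>\<pi>\<close>.
\<close>

lemma frobenius_poly: "P \<in> A_poly \<Longrightarrow> cong_pow A_poly [:\<pi>:] 1 (P ^ Q) (P \<circ>\<^sub>p [:0, 1:] ^ Q)"
proof (induction P)
  case 0
  have "(0 :: 'K poly) ^ Q = 0" using prime_gt_0_nat[OF p(1)] by (simp add: zero_power)
  then show ?case unfolding pcompose_0 by (simp only: cong_pow_refl[OF is_subring_A_poly A_poly_const[OF \<pi>(1)]])
next
  case (pCons a P)
  note S = is_subring_A_poly
  have w: "[:\<pi>:] \<in> A_poly" by (rule A_poly_const[OF \<pi>(1)])
  have a: "a \<in> A" and P: "P \<in> A_poly" using pCons.prems by (simp_all add: A_poly_pCons)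
  obtain c where c: "c \<in> A_poly" "of_nat p = [:\<pi>:] * c" by (rule p_poly)
  obtain d where "d \<in> A" "a ^ Q - a = \<pi> * d" using frobenius[OF a] by (auto simp: cong_pow_def)
  then have "cong_pow A_poly [:\<pi>:] 1 ([:a:] ^ Q) [:a:]"
    by (intro cong_powI[of "[:d:]"] A_poly_const) (simp_all add: poly_const_pow)
  moreover have "cong_pow A_poly [:\<pi>:] 1 (([:0, 1:] * P) ^ Q) ([:0, 1:] ^ Q * (P \<circ>\<^sub>p [:0, 1:] ^ Q))"
    unfolding power_mult_distrib
    by (intro cong_pow_mult[OF S w] cong_pow_refl[OF S w] pCons.IH P subring_power[OF S] A_poly_X A_poly_pcompose)
  moreover have "cong_pow A_poly [:\<pi>:] 1 (([:a:] + [:0, 1:] * P) ^ Q) ([:a:] ^ Q + ([:0, 1:] * P) ^ Q)"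
    by (intro cong_pow_prime_power_add[OF S w p(1) c] A_poly_const a subring_mult[OF S] A_poly_X P)
  ultimately have "cong_pow A_poly [:\<pi>:] 1 (([:a:] + [:0, 1:] * P) ^ Q) ([:a:] + [:0, 1:] ^ Q * (P \<circ>\<^sub>p [:0, 1:] ^ Q))"
    by (meson cong_pow_trans[OF S w] cong_pow_add[OF S w])
  moreover have "[:a:] + [:0, 1:] * P = pCons a P" by simp
  ultimately show ?case unfolding pcompose_pCons by (simp only:)
qed

lemma frobenius_lift_poly:
  "frobenius_lift A_poly [:\<pi>:] [:1 / \<pi>:] (\<lambda>P. P \<circ>\<^sub>p [:0, 1:] ^ Q) p s"
proof (intro frobenius_lift.intro)
  obtain c where c: "c \<in> A_poly" "of_nat p = [:\<pi>:] * c" by (rule p_poly)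
  then show "cong_pow A_poly [:\<pi>:] 1 (of_nat p) 0" by (intro cong_powI[of c]) simp_all
qed (use \<pi> p s in \<open>auto intro!: is_subring_A_poly A_poly_const subring_hom_pcompose A_poly_pcompose frobenius_poly
       simp: one_pCons simp del: One_nat_def\<close>)

section \<open>Integrality\<close>

lemma lg_poly: "map_coeffs1 (\<lambda>c. [:c:]) lg = lt_log [:1 / \<pi>:] Q"
proof -
  interpret c: subring_hom UNIV "\<lambda>c::'K. [:c:]" by (rule subring_hom_const_poly)
  show ?thesis by (simp add: fps_eq_iff lg_def lt_log_def c.hom_sum c.hom_power)
qed

definition fgl :: "'K fps fps" where "fgl = log_fgl lg"

definition act :: "'K \<Rightarrow> 'K fps" where "act a = log_action lg a"

lemma fgl_0_0': "fgl $ 0 $ 0 = 0"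
  unfolding fgl_def by (rule log_fgl_nth_0[OF lg_0_1])

lemma act_0: "act a $ 0 = 0"
  unfolding act_def by (rule log_action_nth_0[OF lg_0_1])

lemma lg_act: "lg oo act a = fps_const a * lg"
  unfolding act_def by (rule log_compose_log_action[OF lg_0_1])

text \<open>
  With \<open>y = s x\<close>, the homogenised formal group law \<open>E\<close> satisfies
  \<open>lg(E) = lg(x) + lg(s x)\<close>. Both \<open>x\<close> and \<open>s x\<close> are
  compatible with the Frobenius lift \<open>s \<mapsto> s\<^sup>Q\<close>, so the functional
  equation lemma applies with right side \<open>x + s x\<close>.
\<close>

theorem fgl_integral: "fgl \<in> fps_over (fps_over A)"
proof -
  interpret c: subring_hom UNIV "\<lambda>c::'K. [:c:]" by (rule subring_hom_const_poly)
  interpret fl: frobenius_lift A_poly "[:\<pi>:]" "[:1 / \<pi>:]" "\<lambda>P. P \<circ>\<^sub>p [:0, 1:] ^ Q" p s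
    by (rule frobenius_lift_poly)
  let ?l = "lt_log [:1 / \<pi>:] Q"
  define y where "y = (fps_const [:0, 1:] * fps_X :: 'K poly fps)"
  have y0: "y $ 0 = 0" by (simp add: y_def)
  have hom: "map_coeffs2 (\<lambda>c. [:c:]) fgl = log_fgl ?l"
    unfolding fgl_def lg_poly[symmetric]
    by (rule map_coeffs2_log_fgl[OF subring_hom_const_poly lg_0_1])
  have E: "homogenize fgl = fps_eval2 (log_fgl ?l) fps_X y"
    by (simp add: homogenize_def hom y_def)
  have l01: "?l $ 0 = 0" "?l $ 1 = 1" by (rule lt_log_nth_0_1[OF Q_ge_2])+
  have "?l oo homogenize fgl = (?l oo fps_X) + (?l oo y)"
    unfolding E by (rule log_compose_log_fgl[OF l01]) (simp_all add: y0)
  then have "(?l oo homogenize fgl) - fps_const [:1 / \<pi>:] * fl.twist (?l oo homogenize fgl) =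
      ((?l oo fps_X) - fps_const [:1 / \<pi>:] * fl.twist (?l oo fps_X)) +
      ((?l oo y) - fps_const [:1 / \<pi>:] * fl.twist (?l oo y))"
    by (simp only: fl.twist_add) (simp only: algebra_simps)
  also have "(?l oo fps_X) - fps_const [:1 / \<pi>:] * fl.twist (?l oo fps_X) = fps_X"
    by (rule fl.lg_minus_twist) (simp_all add: fl.twist_X)
  also have "(?l oo y) - fps_const [:1 / \<pi>:] * fl.twist (?l oo y) = y"
  proof (rule fl.lg_minus_twist[OF y0])
    have "[:0, 1:] \<circ>\<^sub>p [:0, 1:] ^ Q = ([:0, 1:] ^ Q :: 'K poly)" by (simp add: pcompose_pCons)
    then show "fl.twist y = y ^ Q"
      unfolding y_def fl.twist_mult fl.twist_const fl.twist_X power_mult_distrib fps_const_power by simp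
  qed
  finally have "(?l oo homogenize fgl) - fps_const [:1 / \<pi>:] * fl.twist (?l oo homogenize fgl) \<in> fps_over A_poly"
    using fl.X_mem fl.const_mem[OF A_poly_X]
    by (simp add: y_def subring_add[OF fl.R] subring_mult[OF fl.R])
  then have "homogenize fgl \<in> fps_over A_poly"
    by (rule fl.lg_inverse_integral[rotated]) (simp_all add: homogenize_nth_0 fgl_0_0')
  then have "poly.coeff (homogenize fgl $ n) j \<in> A" for n j
    by (simp add: fps_over_def polys_over_def)
  then have mem: "fgl $ (n - j) $ j \<in> A" if "j \<le> n" for n j
    unfolding coeff_homogenize[OF that, symmetric] .
  show ?thesis
    unfolding fps_over_def
  proof (intro CollectI allI)
    fix i j
    show "fgl $ i $ j \<in> A" using mem[of j "i + j"] by simp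
  qed
qed

text \<open>
  Here \<open>lg([a]) = a lg\<close>, and \<open>a lg\<close> satisfies the functional
  equation with right side \<open>a x\<close>.
\<close>

theorem act_integral: "a \<in> A \<Longrightarrow> act a \<in> fps_over A"
proof -
  assume a: "a \<in> A"
  interpret fl: frobenius_lift A \<pi> "1 / \<pi>" "\<lambda>x. x" p s by (rule frobenius_lift_const)
  have lg: "lg = lt_log (1 / \<pi>) Q" by (simp add: lg_def)
  have lgX: "lg - fps_const (1 / \<pi>) * fl.twist lg = fps_X"
    using fl.lg_minus_twist[of fps_X] fl.twist_X by (simp add: lg)
  have "(lg oo act a) - fps_const (1 / \<pi>) * fl.twist (lg oo act a) =
      fps_const a * (lg - fps_const (1 / \<pi>) * fl.twist lg)"
    by (simp only: lg_act fl.twist_mult fl.twist_const) (simp only: algebra_simps)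
  also have "\<dots> \<in> fps_over A"
    unfolding lgX by (intro subring_mult[OF fl.R] fl.const_mem[OF a] fl.X_mem)
  finally show ?thesis
    by (rule fl.lg_inverse_integral[rotated, folded lg]) (rule act_0)
qed

text \<open>
  From \<open>lg([\<pi>]) = \<pi> lg(x) = \<pi> x + lg(x\<^sup>Q)\<close>, the logarithms of
  \<open>[\<pi>]\<close> and \<open>x\<^sup>Q\<close> are congruent modulo
  \<open>\<pi>\<close>, hence so are the series themselves.
\<close>

theorem act_uniformizer: "map_coeffs1 red (act \<pi>) = fps_X ^ Q"
proof -
  interpret fl: frobenius_lift A \<pi> "1 / \<pi>" "\<lambda>x. x" p s by (rule frobenius_lift_const)
  have lg: "lg = lt_log (1 / \<pi>) Q" by (simp add: lg_def)
  have "lg oo fps_X = fps_X + fps_const (1 / \<pi>) * (lg oo fps_X ^ Q)"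
    unfolding lg by (rule lt_log_functional_equation[OF Q_ge_2]) simp
  then have "fps_const \<pi> * lg = fps_const \<pi> * (fps_X + fps_const (1 / \<pi>) * (lg oo fps_X ^ Q))"
    by simp
  also have "\<dots> = fps_const \<pi> * fps_X + (lg oo fps_X ^ Q)"
    using \<pi>(2) by (simp add: distrib_left fps_const_inverse_cancel)
  finally have eq: "(lg oo act \<pi>) $ n = \<pi> * fps_X $ n + (lg oo fps_X ^ Q) $ n" for n
    unfolding lg_act by simp
  have cong: "cong_pow A \<pi> 1 (act \<pi> $ n) ((fps_X ^ Q) $ n)" for n
  proof (rule fl.lg_cong_cancel)
    show "act \<pi> $ 0 = 0" by (rule act_0)
    show "act \<pi> \<in> fps_over A" by (rule act_integral[OF \<pi>(1)])
    show "(fps_X ^ Q) $ 0 = (0::'K)" by (rule fl.X_power_nth_0)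
    show "fps_X ^ Q \<in> fps_over A" by (intro subring_power[OF fl.R] fl.X_mem)
    show "cong_pow A \<pi> 1 ((fl.lg oo act \<pi>) $ n) ((fl.lg oo fps_X ^ Q) $ n)" for n
      using eq[of n] fl.X_mem unfolding lg by (intro cong_powI[of "fps_X $ n"]) (auto simp: fps_over_def)
  qed
  have "red (act \<pi> $ n) = red ((fps_X ^ Q) $ n)" for n
  proof -
    obtain c where c: "c \<in> A" "act \<pi> $ n - (fps_X ^ Q) $ n = \<pi> * c"
      using cong[of n] by (auto simp: cong_pow_def)
    have "act \<pi> $ n \<in> A" "(fps_X ^ Q) $ n \<in> A"
      using act_integral[OF \<pi>(1)] subring_power[OF fl.R fl.X_mem] by (auto simp: fps_over_def)
    then have "red (act \<pi> $ n) - red ((fps_X ^ Q) $ n) = red (act \<pi> $ n - (fps_X ^ Q) $ n)"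
      by (rule red.hom_diff[symmetric])
    also have "\<dots> = red \<pi> * red c" unfolding c(2) by (rule red.hom_mult[OF \<pi>(1) c(1)])
    finally show ?thesis using \<pi>(3) by simp
  qed
  then show ?thesis
    by (auto simp: fps_eq_iff fps_X_power_nth red.hom_0 red.hom_1)
qed

lemma act_mult: "act (a * b) = act a oo act b"
  unfolding act_def[of "a * b"]
proof (rule log_actionI[OF lg_0_1])
  show "(act a oo act b) $ 0 = 0" by (simp add: act_0)
  have "lg oo (act a oo act b) = (fps_const a * lg) oo act b"
    by (simp add: fps_compose_assoc act_0 lg_act)
  also have "\<dots> = fps_const a * (fps_const b * lg)"
    by (simp add: fps_compose_mult_distrib act_0 lg_act)
  finally show "lg oo (act a oo act b) = fps_const (a * b) * lg" by (simp add: mult_ac)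
qed

lemma act_1: "act 1 = fps_X"
  unfolding act_def by (rule log_actionI[OF lg_0_1]) simp_all

lemma act_Suc: "act (of_nat (Suc i)) = fps_eval2 fgl fps_X (act (of_nat i))"
  unfolding act_def[of "of_nat (Suc i)"]
proof (rule log_actionI[OF lg_0_1])
  show "fps_eval2 fgl fps_X (act (of_nat i)) $ 0 = 0" by (simp add: fgl_0_0')
  have "lg oo fps_eval2 fgl fps_X (act (of_nat i)) = (lg oo fps_X) + (lg oo act (of_nat i))"
    unfolding fgl_def by (rule log_compose_log_fgl[OF lg_0_1]) (simp_all add: act_0)
  also have "\<dots> = fps_const (of_nat (Suc i)) * lg"
    by (simp add: lg_act distrib_right flip: fps_const_add)
  finally show "lg oo fps_eval2 fgl fps_X (act (of_nat i)) = fps_const (of_nat (Suc i)) * lg" .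
qed

lemma act_0_eq: "act 0 = 0"
  unfolding act_def by (rule log_actionI[OF lg_0_1]) (simp_all add: lg_0_1)

lemma act_nth_1: "act a $ 1 = a"
proof -
  have "(lg oo act a) $ 1 = act a $ 1"
    using lg_0_1 by (simp add: fps_compose_nth)
  then show ?thesis unfolding lg_act using lg_0_1 by (simp del: One_nat_def)
qed

section \<open>Reduction\<close>

definition fgl_red :: "'L fps fps" where "fgl_red = map_coeffs2 red fgl"

definition act_red :: "'K \<Rightarrow> 'L fps" where "act_red a = map_coeffs1 red (act a)"

text \<open>
  The reduction map need not be onto the field \<open>'L\<close>, so arguments
  \<open>u\<close>, \<open>v\<close>, \<open>w\<close> over \<open>'L\<close> do not lift to
  \<open>A\<close>. Instead they are images of series whose coefficients are independent
  variables, over the ring of polynomials with coefficients in \<open>A\<close>. There the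
  identities hold because of the logarithm.
\<close>

theorem is_fgl_red: "is_fgl fgl_red"
  unfolding is_fgl_def
proof (intro conjI allI impI)
  show "fgl_red $ 0 $ 0 = 0" using fgl_0_0' by (simp add: fgl_red_def red.hom_0)
  fix u v w :: "'L fps" assume 0: "u $ 0 = 0" "v $ 0 = 0" "w $ 0 = 0"
  \<comment> \<open>The variables are indexed by pairs of a number \<open>0\<close>,
  \<open>1\<close> or \<open>2\<close> for the series and a degree; \<open>g\<close> assigns
  to them the coefficients of \<open>u\<close>, \<open>v\<close> and
  \<open>w\<close>.\<close>
  define g where "g i = (case prod_decode i of (c, n) \<Rightarrow> if c = 0 then u $ n else if c = 1 then v $ n else w $ n)" for i
  define \<chi> where "\<chi> = classifying_map red g"
  interpret \<chi>: subring_hom "coeffs_in A :: 'K vpoly set" \<chi>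
    unfolding \<chi>_def by (rule subring_hom_classifying_map[OF red])
  interpret vc: subring_hom UNIV "vconst :: 'K \<Rightarrow> 'K vpoly" by (rule subring_hom_vconst)
  define pt :: "nat \<Rightarrow> 'K vpoly fps" where "pt c = Abs_fps (\<lambda>n. if n = 0 then 0 else vvar (prod_encode (c, n)))" for c
  define G where "G = map_coeffs2 vconst fgl"
  let ?l = "map_coeffs1 vconst lg :: 'K vpoly fps"
  have l01: "?l $ 0 = 0" "?l $ 1 = 1" using lg_0_1 by (simp_all add: vc.hom_0 vc.hom_1 del: One_nat_def)
  have G: "G = log_fgl ?l"
    unfolding G_def fgl_def by (rule map_coeffs2_log_fgl[OF subring_hom_vconst lg_0_1])
  have G0: "G $ 0 $ 0 = 0" using fgl_0_0' by (simp add: G_def vc.hom_0)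
  have vvar_mem: "vvar i \<in> coeffs_in A" for i
    using subring_0[OF red.subring] subring_1[OF red.subring]
    by (simp add: vvar_def coeffs_in_def lookup_single when_def)
  have pt_mem: "pt c \<in> fps_over (coeffs_in A)" for c
    using vvar_mem subring_0[OF \<chi>.subring] by (simp add: fps_over_def pt_def)
  have \<chi>_pt: "map_coeffs1 \<chi> (pt c) = Abs_fps (\<lambda>n. if n = 0 then 0 else g (prod_encode (c, n)))" for c
    by (simp add: fps_eq_iff pt_def \<chi>.hom_0) (simp add: \<chi>_def classifying_map_vvar[OF red])
  have G_mem: "G \<in> fps_over (fps_over (coeffs_in A))"
    using fgl_integral subring_0[OF red.subring]
    by (simp add: G_def fps_over_def coeffs_in_def vconst_def lookup_single when_def)
  have \<chi>_G: "map_coeffs2 \<chi> G = fgl_red"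
    by (simp add: fps_eq_iff G_def fgl_red_def \<chi>_def classifying_map_vconst[OF red])
  have lG: "?l oo fps_eval2 G a b = (?l oo a) + (?l oo b)" if "a $ 0 = 0" "b $ 0 = 0" for a b
    unfolding G by (rule log_compose_log_fgl[OF l01 that])
  have fgl_G: "is_fgl G"
    unfolding is_fgl_def
  proof (intro conjI allI impI)
    fix a b c :: "'K vpoly fps" assume 0: "a $ 0 = 0" "b $ 0 = 0" "c $ 0 = 0"
    show "fps_eval2 G a b = fps_eval2 G b a"
      by (rule fps_compose_left_cancel[OF l01(2)]) (simp_all add: G0 lG 0)
    show "fps_eval2 G (fps_eval2 G a b) c = fps_eval2 G a (fps_eval2 G b c)"
      by (rule fps_compose_left_cancel[OF l01(2)]) (simp_all add: G0 lG 0)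
    show "fps_eval2 G a 0 = a"
      by (rule fps_compose_left_cancel[OF l01(2)]) (use l01 in \<open>simp_all add: G0 lG 0\<close>)
  qed (rule G0)
  have pt: "pt c $ 0 = 0" "map_coeffs1 \<chi> (pt 0) = u" "map_coeffs1 \<chi> (pt 1) = v" "map_coeffs1 \<chi> (pt 2) = w" for c
    unfolding \<chi>_pt using 0 by (auto simp: fps_eq_iff g_def pt_def)
  have hom: "map_coeffs1 \<chi> (fps_eval2 G a b) = fps_eval2 fgl_red (map_coeffs1 \<chi> a) (map_coeffs1 \<chi> b)"
    if "a \<in> fps_over (coeffs_in A)" "b \<in> fps_over (coeffs_in A)" for a b
    unfolding \<chi>_G[symmetric] by (rule \<chi>.map_coeffs1_eval2[OF G_mem that])
  have mem: "fps_eval2 G a b \<in> fps_over (coeffs_in A)"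
    if "a \<in> fps_over (coeffs_in A)" "b \<in> fps_over (coeffs_in A)" for a b
    by (rule fps_over_eval2[OF \<chi>.subring G_mem that])
  note hom_pt = hom[OF pt_mem pt_mem] hom[OF mem[OF pt_mem pt_mem] pt_mem] hom[OF pt_mem mem[OF pt_mem pt_mem]]
  show "fps_eval2 fgl_red u v = fps_eval2 fgl_red v u"
    using arg_cong[OF fgl_commute[OF fgl_G pt(1) pt(1), of 0 1], of "map_coeffs1 \<chi>"]
    unfolding hom_pt pt .
  show "fps_eval2 fgl_red (fps_eval2 fgl_red u v) w = fps_eval2 fgl_red u (fps_eval2 fgl_red v w)"
    using arg_cong[OF fgl_assoc[OF fgl_G pt(1) pt(1) pt(1), of 0 1 2], of "map_coeffs1 \<chi>"]
    unfolding hom_pt pt .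
  have z: "(0 :: 'K vpoly fps) \<in> fps_over (coeffs_in A)" "map_coeffs1 \<chi> 0 = 0"
    using subring_0[OF red.subring] by (auto simp: fps_over_def coeffs_in_def fps_eq_iff \<chi>.hom_0)
  show "fps_eval2 fgl_red u 0 = u"
    using arg_cong[OF fgl_zero_right[OF fgl_G pt(1), of 0], of "map_coeffs1 \<chi>"]
    unfolding hom[OF pt_mem z(1)] z(2) pt .
qed

lemma act_red_mult: "a \<in> A \<Longrightarrow> b \<in> A \<Longrightarrow> act_red (a * b) = act_red a oo act_red b"
  unfolding act_red_def act_mult by (intro red.map_coeffs1_compose act_integral)

lemma act_red_0: "act_red a $ 0 = 0"
  by (simp add: act_red_def act_0 red.hom_0)

lemma act_red_nth_1: "act_red a $ 1 = red a"
  by (simp add: act_red_def act_nth_1 del: One_nat_def)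

lemma act_red_uniformizer_power: "act_red (\<pi> ^ e) = fps_X ^ (Q ^ e)"
proof (induction e)
  case 0
  then show ?case by (simp add: act_red_def act_1 red.map_coeffs1_X)
next
  case (Suc e)
  have Q0: "Q ^ e > 0" using prime_gt_0_nat[OF p(1)] by simp
  then have X0: "(fps_X ^ (Q ^ e)) $ 0 = (0::'L)" by (simp add: fps_X_power_nth)
  have "act_red (\<pi> ^ Suc e) = act_red \<pi> oo act_red (\<pi> ^ e)"
    using \<pi>(1) subring_power[OF red.subring \<pi>(1)] by (simp add: act_red_mult)
  also have "\<dots> = fps_X ^ Q oo fps_X ^ (Q ^ e)"
    unfolding Suc by (simp add: act_red_def act_uniformizer)
  also have "\<dots> = (fps_X ^ (Q ^ e)) ^ Q"
    using fps_compose_power[OF X0, of fps_X Q] X0 by simp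
  also have "\<dots> = fps_X ^ (Q ^ Suc e)" by (simp only: power_mult[symmetric] power_Suc mult.commute)
  finally show ?case .
qed

lemma fgl_multiple_red: "fgl_multiple fgl_red i fps_X = act_red (of_nat i)"
proof (induction i)
  case 0
  have "act_red 0 = 0" by (simp add: act_red_def act_0_eq fps_eq_iff red.hom_0)
  then show ?case by simp
next
  case (Suc i)
  have X: "fps_X \<in> fps_over A"
    using act_integral[OF subring_1[OF red.subring]] by (simp add: act_1)
  have "act_red (of_nat (Suc i)) = fps_eval2 fgl_red (map_coeffs1 red fps_X) (act_red (of_nat i))"
    unfolding act_red_def act_Suc fgl_red_def
    by (rule red.map_coeffs1_eval2[OF fgl_integral X act_integral[OF subring_of_nat[OF red.subring]]])
  then show ?case by (simp add: Suc red.map_coeffs1_X)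
qed

end

section \<open>Rescaled formal group laws\<close>

lemma is_fgl_scale2:
  fixes F :: "'a::field fps fps"
  assumes c: "c \<noteq> 0" and F: "is_fgl F"
  shows "is_fgl (scale2 c F)"
proof -
  note ev = scale2_eval[OF c fgl_0_0[OF F]]
  show ?thesis
    unfolding is_fgl_def
  proof (intro conjI allI impI)
    show "scale2 c F $ 0 $ 0 = 0" by (simp add: scale2_def fgl_0_0[OF F])
    fix u v w :: "'a fps" assume "u $ 0 = 0" "v $ 0 = 0" "w $ 0 = 0"
    then have 0: "(fps_const c * u) $ 0 = 0" "(fps_const c * v) $ 0 = 0" "(fps_const c * w) $ 0 = 0" by simp_all
    show "fps_eval2 (scale2 c F) u v = fps_eval2 (scale2 c F) v u"
      unfolding ev using fgl_commute[OF F 0(1,2)] by simp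
    show "fps_eval2 (scale2 c F) (fps_eval2 (scale2 c F) u v) w = fps_eval2 (scale2 c F) u (fps_eval2 (scale2 c F) v w)"
      unfolding ev fps_const_inverse_cancel(1)[OF c] fgl_assoc[OF F 0] ..
    show "fps_eval2 (scale2 c F) u 0 = u"
      unfolding ev using fgl_zero_right[OF F 0(1)] by (simp add: fps_const_inverse_cancel(2)[OF c])
  qed
qed

lemma fgl_multiple_scale2:
  fixes F :: "'a::field fps fps"
  assumes c: "c \<noteq> 0" and F: "is_fgl F"
  shows "fgl_multiple (scale2 c F) i fps_X = scale1 c (fgl_multiple F i fps_X)"
proof -
  have eq: "fgl_multiple (scale2 c F) i u = fps_const (1 / c) * fgl_multiple F i (fps_const c * u)" for u
    by (induction i) (simp_all add: scale2_eval[OF c fgl_0_0[OF F]] fps_const_inverse_cancel(1)[OF c])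
  have cX: "(fps_const c * fps_X) $ 0 = (0 :: 'a)" by simp
  have "fgl_multiple (scale2 c F) i fps_X = scale1 c (fgl_multiple F i fps_X) oo fps_X"
    unfolding eq fgl_multiple_compose[OF F cX, symmetric]
    by (rule scale1_compose[OF c fgl_multiple_nth_0[OF F], symmetric])
  then show ?thesis by simp
qed

section \<open>Integral elements\<close>

definition integral_over :: "'a::comm_ring_1 set \<Rightarrow> 'a \<Rightarrow> bool" where
  "integral_over R x \<longleftrightarrow> (\<exists>P. lead_coeff P = 1 \<and> (\<forall>i. poly.coeff P i \<in> R) \<and> poly P x = 0)"

definition linear_span :: "'a::comm_ring_1 set \<Rightarrow> 'i set \<Rightarrow> ('i \<Rightarrow> 'a) \<Rightarrow> 'a set" where
  "linear_span R I m = {\<Sum>i\<in>I. c i * m i |c. \<forall>i\<in>I. c i \<in> R}"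

context
  fixes R :: "'a::field set"
  assumes R: "is_subring R"
begin

lemma linear_span_gen: "finite I \<Longrightarrow> i \<in> I \<Longrightarrow> m i \<in> linear_span R I m"
proof -
  assume "finite I" "i \<in> I"
  have "(\<Sum>j\<in>I. (if j = i then 1 else 0) * m j) = (\<Sum>j\<in>I. if j = i then m j else 0)"
    by (intro sum.cong) auto
  also have "\<dots> = m i" using \<open>finite I\<close> \<open>i \<in> I\<close> by simp
  finally have "m i = (\<Sum>j\<in>I. (if j = i then 1 else 0) * m j)" by (rule sym)
  then show ?thesis unfolding linear_span_def
    using subring_0[OF R] subring_1[OF R] by (intro CollectI exI[of _ "\<lambda>j. if j = i then 1 else 0"]) auto
qed

lemma linear_span_add:
  assumes "x \<in> linear_span R I m" "y \<in> linear_span R I m" shows "x + y \<in> linear_span R I m"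
proof -
  obtain c d where "x = (\<Sum>i\<in>I. c i * m i)" "y = (\<Sum>i\<in>I. d i * m i)" "\<forall>i\<in>I. c i \<in> R" "\<forall>i\<in>I. d i \<in> R"
    using assms by (auto simp: linear_span_def)
  then show ?thesis unfolding linear_span_def
    by (intro CollectI exI[of _ "\<lambda>i. c i + d i"]) (auto simp: distrib_right sum.distrib subring_add[OF R])
qed

lemma linear_span_scale:
  assumes "x \<in> linear_span R I m" "a \<in> R" shows "a * x \<in> linear_span R I m"
proof -
  obtain c where "x = (\<Sum>i\<in>I. c i * m i)" "\<forall>i\<in>I. c i \<in> R"
    using assms by (auto simp: linear_span_def)
  then show ?thesis unfolding linear_span_def using assms(2)
    by (intro CollectI exI[of _ "\<lambda>i. a * c i"]) (auto simp: sum_distrib_left mult.assoc subring_mult[OF R])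
qed

lemma linear_span_0: "0 \<in> linear_span R I m"
  unfolding linear_span_def using subring_0[OF R] by (intro CollectI exI[of _ "\<lambda>_. 0"]) auto

lemma linear_span_sum: "(\<And>x. x \<in> X \<Longrightarrow> f x \<in> linear_span R I m) \<Longrightarrow> sum f X \<in> linear_span R I m"
  by (induction X rule: infinite_finite_induct) (auto simp: linear_span_0 linear_span_add)

lemma linear_span_mult_closed:
  assumes "\<And>i. i \<in> I \<Longrightarrow> x * m i \<in> linear_span R I m" "y \<in> linear_span R I m"
  shows "x * y \<in> linear_span R I m"
proof -
  obtain c where c: "y = (\<Sum>i\<in>I. c i * m i)" "\<forall>i\<in>I. c i \<in> R"
    using assms by (auto simp: linear_span_def)
  have "x * y = (\<Sum>i\<in>I. c i * (x * m i))" unfolding c(1) by (simp add: sum_distrib_left mult_ac)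
  then show ?thesis using c(2) by (auto intro!: linear_span_sum linear_span_scale[OF assms(1)])
qed

text \<open>
  Multiplication by \<open>x\<close> on the finitely generated module is given by a matrix
  over \<open>R\<close>, of which the generators form an eigenvector for \<open>x\<close>;
  so \<open>x\<close> is a root of its monic characteristic polynomial.
\<close>

lemma integral_over_if_module:
  assumes I: "finite I" and i0: "i0 \<in> I" "m i0 \<noteq> 0"
    and x: "\<And>i. i \<in> I \<Longrightarrow> x * m i \<in> linear_span R I m"
  shows "integral_over R x"
proof -
  define n where "n = card I"
  obtain f where f: "bij_betw f {..<n} I"
    using ex_bij_betw_nat_finite[OF I] unfolding n_def atLeast0LessThan by blast
  have "\<forall>i\<in>I. \<exists>c. x * m i = (\<Sum>j\<in>I. c j * m j) \<and> (\<forall>j\<in>I. c j \<in> R)"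
    using x by (auto simp: linear_span_def)
  then obtain c where c: "\<And>i. i \<in> I \<Longrightarrow> x * m i = (\<Sum>j\<in>I. c i j * m j)"
    "\<And>i j. i \<in> I \<Longrightarrow> j \<in> I \<Longrightarrow> c i j \<in> R" by metis
  have fI: "f i \<in> I" if "i < n" for i using f that by (auto simp: bij_betw_def)
  define M where "M = Matrix.mat n n (\<lambda>(i, j). c (f i) (f j))"
  define v where "v = Matrix.vec n (\<lambda>i. m (f i))"
  have M: "M \<in> carrier_mat n n" by (simp add: M_def)
  have "M *\<^sub>v v = x \<cdot>\<^sub>v v"
  proof (rule eq_vecI)
    fix i assume "i < dim_vec (x \<cdot>\<^sub>v v)"
    then have i: "i < n" by (simp add: v_def)
    have "vec_index (M *\<^sub>v v) i = (\<Sum>j<n. c (f i) (f j) * m (f j))"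
      using i by (simp add: M_def v_def scalar_prod_def atLeast0LessThan)
    also have "\<dots> = (\<Sum>j\<in>I. c (f i) j * m j)"
      by (rule sum.reindex_bij_betw[OF f])
    also have "\<dots> = vec_index (x \<cdot>\<^sub>v v) i" using c(1)[OF fI[OF i]] i by (simp add: v_def)
    finally show "vec_index (M *\<^sub>v v) i = vec_index (x \<cdot>\<^sub>v v) i" .
  qed (simp add: M_def v_def)
  moreover have "v \<noteq> 0\<^sub>v n"
  proof
    assume v0: "v = 0\<^sub>v n"
    obtain k where "k < n" "f k = i0" using f i0(1) by (auto simp: bij_betw_def)
    then show False using i0(2) arg_cong[OF v0, of "\<lambda>v. vec_index v k"] by (simp add: v_def)
  qed
  ultimately have "eigenvalue M x"
    unfolding eigenvalue_def eigenvector_def by (intro exI[of _ v]) (simp add: M_def v_def)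
  then have root: "poly (char_poly M) x = 0" by (simp add: eigenvalue_root_char_poly[OF M])
  have poly: "char_poly M \<in> polys_over R"
  proof -
    note S = is_subring_polys_over[OF R]
    have entries: "char_poly_matrix M $$ (i, j) \<in> polys_over R" if "i < n" "j < n" for i j
      using that c(2)[OF fI[OF that(1)] fI[OF that(2)]] subring_0[OF R] subring_1[OF R] subring_uminus[OF R]
      by (auto simp: char_poly_matrix_def M_def polys_over_def coeff_pCons split: nat.splits)
    have sgn: "signof \<sigma> \<in> polys_over R" for \<sigma> :: "nat \<Rightarrow> nat"
      using subring_1[OF S] subring_uminus[OF S] by (auto simp: sign_def)
    have "Determinant.det (char_poly_matrix M) =
        (\<Sum>\<sigma> | \<sigma> permutes {0..<n}. signof \<sigma> * (\<Prod>i = 0..<n. char_poly_matrix M $$ (i, \<sigma> i)))"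
      by (rule det_def') (simp add: M_def)
    then show ?thesis unfolding char_poly_def
      by (auto intro!: subring_sum[OF S] subring_mult[OF S] subring_prod[OF S] sgn entries
          dest: permutes_in_image)
  qed
  show ?thesis
    unfolding integral_over_def using root poly degree_monic_char_poly[OF M]
    by (intro exI[of _ "char_poly M"]) (auto simp: polys_over_def)
qed

lemma integral_over_power_relation:
  assumes "integral_over R x"
  obtains r a where "r > 0" "\<And>i. a i \<in> R" "x ^ r = (\<Sum>i<r. a i * x ^ i)"
proof -
  obtain P where P: "lead_coeff P = 1" "\<And>i. poly.coeff P i \<in> R" "poly P x = 0"
    using assms by (auto simp: integral_over_def)
  have deg: "degree P > 0"
  proof (rule ccontr)
    assume "\<not> degree P > 0"
    then obtain c where "P = [:c:]" using degree_eq_zeroE by blast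
    then show False using P by simp
  qed
  have "(\<Sum>i\<le>degree P. poly.coeff P i * x ^ i) = 0" using P(3) by (simp add: poly_altdef)
  moreover have "{..degree P} = insert (degree P) {..<degree P}" by auto
  ultimately have "x ^ degree P = - (\<Sum>i<degree P. poly.coeff P i * x ^ i)"
    using P(1) by (simp add: eq_neg_iff_add_eq_0)
  also have "\<dots> = (\<Sum>i<degree P. - poly.coeff P i * x ^ i)" by (simp add: sum_negf)
  finally show ?thesis using that[of "degree P" "\<lambda>i. - poly.coeff P i"] deg P subring_uminus[OF R] by blast
qed

lemma integral_over_mem: "a \<in> R \<Longrightarrow> integral_over R a"
  unfolding integral_over_def using subring_0[OF R] subring_1[OF R] subring_uminus[OF R]
  by (intro exI[of _ "[:- a, 1:]"]) (auto simp: coeff_pCons split: nat.splits)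

text \<open>
  The products \<open>x^i y^j\<close> with bounded exponents span a module that is stable
  under \<open>x\<close> and \<open>y\<close>.
\<close>

lemma integral_over_add_mult:
  assumes x: "integral_over R x" and y: "integral_over R y"
  shows "integral_over R (x + y)" "integral_over R (x * y)"
proof -
  obtain r a where r: "r > 0" "\<And>i. a i \<in> R" "x ^ r = (\<Sum>i<r. a i * x ^ i)"
    using integral_over_power_relation[OF x] by blast
  obtain s b where s: "s > 0" "\<And>i. b i \<in> R" "y ^ s = (\<Sum>i<s. b i * y ^ i)"
    using integral_over_power_relation[OF y] by blast
  define I where "I = {..<r} \<times> {..<s}"
  define m where "m = (\<lambda>(i, j). x ^ i * y ^ j)"
  have I: "finite I" "(0, 0) \<in> I" "m (0, 0) \<noteq> 0" using r s by (auto simp: I_def m_def)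
  have gen: "x ^ i * y ^ j \<in> linear_span R I m" if "i < r" "j < s" for i j
    using linear_span_gen[OF I(1), of "(i, j)" m] that by (simp add: I_def m_def)
  have xm: "x * m k \<in> linear_span R I m" if k: "k \<in> I" for k
  proof -
    obtain i j where ij: "k = (i, j)" "i < r" "j < s" using k by (auto simp: I_def)
    show ?thesis
    proof (cases "Suc i < r")
      case True
      then show ?thesis using gen[of "Suc i" j] ij by (simp add: m_def mult.assoc)
    next
      case False
      then have "r = Suc i" using ij by simp
      then have "x * m k = x ^ r * y ^ j" by (simp add: ij m_def)
      also have "\<dots> = (\<Sum>i<r. a i * (x ^ i * y ^ j))" unfolding r(3) by (simp add: sum_distrib_right mult.assoc)
      finally show ?thesis using r(2) ij by (auto intro!: linear_span_sum linear_span_scale gen)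
    qed
  qed
  have ym: "y * m k \<in> linear_span R I m" if k: "k \<in> I" for k
  proof -
    obtain i j where ij: "k = (i, j)" "i < r" "j < s" using k by (auto simp: I_def)
    show ?thesis
    proof (cases "Suc j < s")
      case True
      then show ?thesis using gen[of i "Suc j"] ij by (simp add: m_def mult_ac)
    next
      case False
      then have "s = Suc j" using ij by simp
      then have "y * m k = x ^ i * y ^ s" by (simp add: ij m_def mult_ac)
      also have "\<dots> = (\<Sum>j<s. b j * (x ^ i * y ^ j))" unfolding s(3) by (simp add: sum_distrib_left mult_ac)
      finally show ?thesis using s(2) ij by (auto intro!: linear_span_sum linear_span_scale gen)
    qed
  qed
  show "integral_over R (x + y)"
    by (rule integral_over_if_module[where m = m, OF I]) (auto simp: distrib_right intro!: linear_span_add xm ym)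
  show "integral_over R (x * y)"
    by (rule integral_over_if_module[where m = m, OF I]) (auto simp: mult.assoc intro!: linear_span_mult_closed xm ym)
qed

lemma is_subring_integral_closure: "is_subring {x. integral_over R x}"
proof -
  have "integral_over R (- x)" if "integral_over R x" for x
    using integral_over_add_mult(2)[OF integral_over_mem[of "- 1"] that] subring_1[OF R] subring_uminus[OF R] by simp
  then show ?thesis
    unfolding is_subring_def using integral_over_add_mult integral_over_mem subring_1[OF R] by auto
qed

text \<open>
  Multiply the relation by the \<open>(n - 1)\<close>-st power of the leading coefficient.
\<close>

lemma integral_over_leading_coeff_multiple:
  assumes a: "\<And>i. i \<le> n \<Longrightarrow> a i \<in> R" and an: "a n \<noteq> 0" and x: "(\<Sum>i\<le>n. a i * x ^ i) = 0"
  shows "integral_over R (a n * x)"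
proof (cases "n = 0")
  case True
  then show ?thesis using an x by simp
next
  case False
  define P where "P = Polynomial.monom 1 n + (\<Sum>i<n. Polynomial.monom (a i * a n ^ (n - 1 - i)) i)"
  have coeff: "poly.coeff P i = (if i = n then 1 else if i < n then a i * a n ^ (n - 1 - i) else 0)" for i
  proof -
    have "poly.coeff P i = poly.coeff (Polynomial.monom 1 n) i +
        (\<Sum>k<n. poly.coeff (Polynomial.monom (a k * a n ^ (n - 1 - k)) k) i)"
      by (simp only: P_def coeff_add coeff_sum)
    also have "(\<Sum>k<n. poly.coeff (Polynomial.monom (a k * a n ^ (n - 1 - k)) k) i) =
        (\<Sum>k<n. if k = i then a i * a n ^ (n - 1 - i) else 0)"
      by (intro sum.cong refl) auto
    also have "\<dots> = (if i < n then a i * a n ^ (n - 1 - i) else 0)" by simp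
    finally show ?thesis by auto
  qed
  have deg: "degree P = n"
  proof (rule antisym)
    show "degree P \<le> n" by (rule degree_le) (simp add: coeff)
    show "n \<le> degree P" by (rule le_degree) (simp add: coeff)
  qed
  have "poly P (a n * x) = (a n * x) ^ n + (\<Sum>i<n. a i * a n ^ (n - 1 - i) * (a n * x) ^ i)"
    by (simp add: P_def poly_sum poly_monom)
  also have "(\<Sum>i<n. a i * a n ^ (n - 1 - i) * (a n * x) ^ i) = a n ^ (n - 1) * (\<Sum>i<n. a i * x ^ i)"
    unfolding sum_distrib_left
  proof (rule sum.cong)
    fix i assume "i \<in> {..<n}"
    then have "a n ^ (n - 1) = a n ^ (n - 1 - i) * a n ^ i" by (simp flip: power_add)
    then show "a i * a n ^ (n - 1 - i) * (a n * x) ^ i = a n ^ (n - 1) * (a i * x ^ i)"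
      by (simp add: power_mult_distrib mult_ac)
  qed simp
  also have "(a n * x) ^ n = a n ^ (n - 1) * (a n * x ^ n)"
    using False by (cases n) (simp_all add: power_mult_distrib mult_ac)
  also have "a n ^ (n - 1) * (a n * x ^ n) + a n ^ (n - 1) * (\<Sum>i<n. a i * x ^ i) = a n ^ (n - 1) * (\<Sum>i\<le>n. a i * x ^ i)"
    by (simp add: lessThan_Suc_atMost[symmetric] distrib_left)
  finally have "poly P (a n * x) = 0" using x by simp
  moreover have "poly.coeff P i \<in> R" for i
    using a subring_0[OF R] subring_1[OF R] by (auto simp: coeff intro!: subring_mult[OF R] subring_power[OF R])
  ultimately show ?thesis unfolding integral_over_def using deg coeff by (intro exI[of _ P]) auto
qed

end

section \<open>The p-adic integers\<close>

context
  fixes ty :: "'p::prime_card itself"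
begin

lemma Rep_padic_range: "Rep_padic_int (z :: 'p padic_int) n \<in> {0..<int CARD('p) ^ n}"
  and Rep_padic_Suc: "Rep_padic_int (z :: 'p padic_int) (Suc n) mod int CARD('p) ^ n = Rep_padic_int z n"
  using Rep_padic_int[of z] by auto

lemma Rep_padic_mod: "Rep_padic_int (z :: 'p padic_int) (n + k) mod int CARD('p) ^ n = Rep_padic_int z n"
proof (induction k)
  case 0
  then show ?case using Rep_padic_range[of z n] by simp
next
  case (Suc k)
  have "Rep_padic_int z (n + Suc k) mod int CARD('p) ^ n = (Rep_padic_int z (Suc (n + k)) mod int CARD('p) ^ (n + k)) mod int CARD('p) ^ n"
    by (simp add: mod_mod_cancel le_imp_power_dvd)
  then show ?case using Rep_padic_Suc[of z "n + k"] Suc by simp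
qed

lemma Rep_padic_add: "Rep_padic_int (x + y :: 'p padic_int) n = (Rep_padic_int x n + Rep_padic_int y n) mod int CARD('p) ^ n"
  by (simp add: plus_padic_int.rep_eq)

lemma Rep_padic_mult: "Rep_padic_int (x * y :: 'p padic_int) n = (Rep_padic_int x n * Rep_padic_int y n) mod int CARD('p) ^ n"
  by (simp add: times_padic_int.rep_eq)

lemma Rep_padic_diff: "Rep_padic_int (x - y :: 'p padic_int) n = (Rep_padic_int x n - Rep_padic_int y n) mod int CARD('p) ^ n"
  unfolding minus_padic_int_def Rep_padic_add uminus_padic_int.rep_eq by (simp add: mod_add_right_eq)

lemma Rep_padic_0: "Rep_padic_int (0 :: 'p padic_int) n = 0"
  by (simp add: zero_padic_int.rep_eq)

lemma Rep_padic_of_nat: "Rep_padic_int (of_nat k :: 'p padic_int) n = int k mod int CARD('p) ^ n"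
proof (induction k)
  case (Suc k)
  then show ?case by (simp add: Rep_padic_add one_padic_int.rep_eq mod_add_eq)
qed (simp add: Rep_padic_0)

lemma Rep_padic_of_int: "Rep_padic_int (of_int k :: 'p padic_int) n = k mod int CARD('p) ^ n"
proof -
  obtain a b where k: "k = int a - int b" by (metis int_diff_cases)
  have "(of_int k :: 'p padic_int) = of_nat a - of_nat b" by (simp add: k)
  then show ?thesis by (simp add: Rep_padic_diff Rep_padic_of_nat k mod_diff_eq)
qed

lemma padic_eqI: "(\<And>n. Rep_padic_int x n = Rep_padic_int y n) \<Longrightarrow> x = (y :: 'p padic_int)"
  by (simp add: Rep_padic_int_inject[symmetric] fun_eq_iff)

text \<open>
  The \<open>n\<close>-th component is the residue class modulo \<open>p\<^sup>n\<close>. If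
  it vanishes, then all components from the \<open>n\<close>-th on can be divided by
  \<open>p\<^sup>n\<close>, and the quotients form a coherent sequence again.
\<close>

lemma p_power_dvd_iff: "of_nat CARD('p) ^ n dvd (z :: 'p padic_int) \<longleftrightarrow> Rep_padic_int z n = 0"
proof
  assume "of_nat CARD('p) ^ n dvd z"
  then obtain w where w: "z = of_nat CARD('p) ^ n * w" by blast
  have "Rep_padic_int (of_nat CARD('p) ^ n :: 'p padic_int) n = 0"
    using Rep_padic_of_nat[of "CARD('p) ^ n" n] by simp
  then show "Rep_padic_int z n = 0" unfolding w Rep_padic_mult by simp
next
  assume z: "Rep_padic_int z n = 0"
  have p0: "int CARD('p) > 0" by (rule card_pos_int)
  define f where "f m = Rep_padic_int z (m + n) div int CARD('p) ^ n" for m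
  have dvd: "int CARD('p) ^ n dvd Rep_padic_int z (m + n)" for m
    using Rep_padic_mod[of z n m] z by (auto simp: add.commute mod_eq_0_iff_dvd)
  have f: "f m \<in> {0..<int CARD('p) ^ m} \<and> f (Suc m) mod int CARD('p) ^ m = f m" for m
  proof
    have "Rep_padic_int z (m + n) < int CARD('p) ^ m * int CARD('p) ^ n" "Rep_padic_int z (m + n) \<ge> 0"
      using Rep_padic_range[of z "m + n"] by (auto simp: power_add)
    moreover have "f m < int CARD('p) ^ m"
    proof (rule ccontr)
      assume "\<not> f m < int CARD('p) ^ m"
      then have "int CARD('p) ^ m * int CARD('p) ^ n \<le> f m * int CARD('p) ^ n"
        using p0 by (intro mult_right_mono) auto
      also have "\<dots> \<le> Rep_padic_int z (m + n)"
        using dvd[of m] by (simp add: f_def)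
      finally show False using \<open>Rep_padic_int z (m + n) < int CARD('p) ^ m * int CARD('p) ^ n\<close> by simp
    qed
    ultimately show "f m \<in> {0..<int CARD('p) ^ m}"
      using p0 by (auto simp: f_def pos_imp_zdiv_nonneg_iff)
    have "Rep_padic_int z (Suc m + n) mod (int CARD('p) ^ n * int CARD('p) ^ m) = Rep_padic_int z (m + n)"
      using Rep_padic_Suc[of z "m + n"] by (simp add: power_add mult.commute)
    then have "(Rep_padic_int z (Suc m + n) mod (int CARD('p) ^ n * int CARD('p) ^ m)) div int CARD('p) ^ n = f m" by (simp add: f_def)
    then show "f (Suc m) mod int CARD('p) ^ m = f m"
      using p0 by (simp add: f_def zmod_zmult2_eq div_mult_self2)
  qed
  define w :: "'p padic_int" where "w = Abs_padic_int f"
  have w: "Rep_padic_int w m = f m" for m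
    unfolding w_def by (subst Abs_padic_int_inverse) (use f in auto)
  have "z = of_nat CARD('p) ^ n * w"
  proof (rule padic_eqI)
    fix m
    have "Rep_padic_int (of_nat CARD('p) ^ n * w) m = (int CARD('p) ^ n * f m) mod int CARD('p) ^ m"
      using Rep_padic_of_nat[of "CARD('p) ^ n" m] by (simp add: Rep_padic_mult w mod_mult_left_eq)
    also have "int CARD('p) ^ n * f m = Rep_padic_int z (m + n)" using dvd by (simp add: f_def)
    also have "\<dots> mod int CARD('p) ^ m = Rep_padic_int z m" by (rule Rep_padic_mod)
    finally show "Rep_padic_int z m = Rep_padic_int (of_nat CARD('p) ^ n * w) m" by simp
  qed
  then show "of_nat CARD('p) ^ n dvd z" by simp
qed

lemma p_dvd_mult:
  assumes "of_nat CARD('p) dvd (z * w :: 'p padic_int)" shows "of_nat CARD('p) dvd z \<or> of_nat CARD('p) dvd w"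
proof -
  have "int CARD('p) dvd Rep_padic_int z 1 * Rep_padic_int w 1"
    using assms p_power_dvd_iff[of 1 "z * w"] by (simp add: Rep_padic_mult mod_eq_0_iff_dvd)
  then have "int CARD('p) dvd Rep_padic_int z 1 \<or> int CARD('p) dvd Rep_padic_int w 1"
    using prime_card_int[where 'a = 'p] by (simp add: prime_dvd_mult_iff)
  moreover have "Rep_padic_int x 1 = 0" if "int CARD('p) dvd Rep_padic_int x 1" for x :: "'p padic_int"
    using that Rep_padic_range[of x 1] by (auto dest: zdvd_imp_le)
  ultimately show ?thesis using p_power_dvd_iff[of 1 z] p_power_dvd_iff[of 1 w] by auto
qed

lemma p_not_dvd_1: "\<not> of_nat CARD('p) dvd (1 :: 'p padic_int)"
  using p_power_dvd_iff[of 1 1] prime_gt_1_int[OF prime_card_int[where 'a = 'p]]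
  by (simp add: one_padic_int.rep_eq)

lemma p_dvd_power: "of_nat CARD('p) dvd (z ^ n :: 'p padic_int) \<Longrightarrow> of_nat CARD('p) dvd z"
  by (induction n) (auto simp: p_not_dvd_1 dest: p_dvd_mult)

lemma padic_split: "\<exists>w. (z :: 'p padic_int) = of_int (Rep_padic_int z n) + of_nat CARD('p) ^ n * w"
proof -
  have "Rep_padic_int (z - of_int (Rep_padic_int z n)) n = 0"
    by (simp add: Rep_padic_diff Rep_padic_of_int mod_diff_right_eq)
  then obtain w where "z - of_int (Rep_padic_int z n) = of_nat CARD('p) ^ n * w"
    unfolding p_power_dvd_iff[symmetric] by blast
  then show ?thesis by (intro exI[of _ w]) (simp add: algebra_simps)
qed

lemma of_int_p_dvd: "of_nat CARD('p) dvd (of_int k :: 'p padic_int) \<longleftrightarrow> int CARD('p) dvd k"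
  using p_power_dvd_iff[of 1 "of_int k"] by (simp add: Rep_padic_of_int mod_eq_0_iff_dvd)

lemma padic_nonzero_not_dvd:
  assumes "(z :: 'p padic_int) \<noteq> 0" obtains n where "\<not> of_nat CARD('p) ^ n dvd z"
proof -
  have "\<exists>n. Rep_padic_int z n \<noteq> 0" using assms padic_eqI[of z 0] Rep_padic_0 by auto
  then show ?thesis using that p_power_dvd_iff[of _ z] by blast
qed

lemma padic_digits:
  assumes "\<And>i. c i \<in> {0..<int CARD('p)}"
  obtains z :: "'p padic_int" where "\<And>n. Rep_padic_int z n = (\<Sum>i<n. c i * int CARD('p) ^ i)"
proof -
  define f where "f n = (\<Sum>i<n. c i * int CARD('p) ^ i)" for n
  have p0: "int CARD('p) > 0" by (rule card_pos_int)
  have range: "f n \<in> {0..<int CARD('p) ^ n}" for n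
  proof (induction n)
    case (Suc n)
    have "c n * int CARD('p) ^ n \<le> (int CARD('p) - 1) * int CARD('p) ^ n" using assms[of n] p0 by (intro mult_right_mono) auto
    then have "f (Suc n) < int CARD('p) ^ Suc n" using Suc by (simp add: f_def algebra_simps)
    moreover have "f (Suc n) \<ge> 0" using Suc assms[of n] p0 by (simp add: f_def)
    ultimately show ?case by simp
  qed (simp add: f_def)
  have "f (Suc n) mod int CARD('p) ^ n = f n" for n
    using range[of n] by (simp add: f_def)
  then have f: "f \<in> {x. \<forall>n. x n \<in> {0..<int CARD('p) ^ n} \<and> x (Suc n) mod int CARD('p) ^ n = x n}" using range by auto
  show ?thesis
    by (rule that[of "Abs_padic_int f"]) (simp add: Abs_padic_int_inverse[OF f] f_def)
qed

end

section \<open>Complete residue systems\<close>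

text \<open>
  Complete residue systems allow \<open>A / J\<close> to be counted without forming the
  quotient ring.
\<close>

definition residue_system :: "'a::comm_ring_1 set \<Rightarrow> 'a set \<Rightarrow> 'a set \<Rightarrow> bool" where
  "residue_system A J S \<longleftrightarrow> finite S \<and> S \<subseteq> A \<and> (\<forall>a\<in>A. \<exists>!s. s \<in> S \<and> a - s \<in> J)"

lemma residue_system_card_le:
  assumes J: "\<And>x y. x \<in> J \<Longrightarrow> y \<in> J \<Longrightarrow> x - y \<in> J"
    and S: "residue_system A J S" and T: "residue_system A J T"
  shows "card S \<le> card T"
proof -
  define f where "f s = (THE t. t \<in> T \<and> s - t \<in> J)" for s
  have f: "f s \<in> T \<and> s - f s \<in> J" if "s \<in> S" for s
  proof -
    have "s \<in> A" using that S by (auto simp: residue_system_def)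
    then have "\<exists>!t. t \<in> T \<and> s - t \<in> J" using T by (simp add: residue_system_def)
    from theI'[OF this] show ?thesis by (simp add: f_def)
  qed
  have "inj_on f S"
  proof (rule inj_onI)
    fix s s' assume s: "s \<in> S" "s' \<in> S" "f s = f s'"
    then have "(s' - f s') - (s - f s) \<in> J" using J[OF conjunct2[OF f[OF s(2)]] conjunct2[OF f[OF s(1)]]] by simp
    then have "s' - s \<in> J" using s by simp
    moreover have "s' - s' \<in> J" using J[OF conjunct2[OF f[OF s(1)]] conjunct2[OF f[OF s(1)]]] by simp
    moreover have "s' \<in> A" using s S by (auto simp: residue_system_def)
    then have "\<exists>!t. t \<in> S \<and> s' - t \<in> J" using S by (simp add: residue_system_def)
    ultimately show "s = s'" using s by blast
  qed
  moreover have "f ` S \<subseteq> T" using f by auto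
  ultimately show ?thesis using T card_inj_on_le by (auto simp: residue_system_def)
qed

lemma residue_system_card_eq:
  assumes "\<And>x y. x \<in> J \<Longrightarrow> y \<in> J \<Longrightarrow> x - y \<in> J" "residue_system A J S" "residue_system A J T"
  shows "card S = card T"
  using residue_system_card_le[OF assms(1)] assms(2,3) by (metis antisym)

section \<open>The ring of integers of an extension of the p-adic numbers\<close>

locale padic_extension =
  fixes \<iota> :: "'p::prime_card padic \<Rightarrow> 'K::field" and d :: nat
  assumes ext: "padic_extension_of_degree \<iota> d"
begin

sublocale iota: field_hom \<iota>
  using ext by (simp add: padic_extension_of_degree_def)

abbreviation scl where "scl \<equiv> (\<lambda>a x. \<iota> a * x)"

sublocale V: vector_space scl
  by unfold_locales (simp_all add: iota.hom_add iota.hom_mult algebra_simps)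

lemma d_pos: "d > 0" and dim: "V.dim UNIV = d"
  using ext by (simp_all add: padic_extension_of_degree_def)

definition j :: "'p padic_int \<Rightarrow> 'K" where "j z = \<iota> (Fract z 1)"

lemma j_hom: "j 0 = 0" "j 1 = 1" "j (x + y) = j x + j y" "j (x * y) = j x * j y" "j (- x) = - j x"
  by (simp_all add: j_def Zero_fract_def[symmetric] One_fract_def[symmetric] iota.hom_add[symmetric]
      iota.hom_mult[symmetric] iota.hom_uminus[symmetric])

lemma j_of_nat: "j (of_nat n) = of_nat n"
  by (induction n) (simp_all add: j_hom)

lemma j_of_int: "j (of_int n) = of_int n"
  by (cases n) (simp_all add: j_of_nat j_hom del: of_nat_Suc)

lemma j_power: "j (x ^ n) = j x ^ n"
  by (induction n) (simp_all add: j_hom)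

lemma j_sum: "j (sum f X) = (\<Sum>x\<in>X. j (f x))"
  by (induction X rule: infinite_finite_induct) (simp_all add: j_hom)

lemma j_eq_0_iff: "j z = 0 \<longleftrightarrow> z = 0"
  by (simp add: j_def eq_fract Zero_fract_def)

lemma range_j: "\<iota> ` padic_integers = range j"
  by (auto simp: padic_integers_def j_def)

lemma subring_range_j: "is_subring (range j)"
  unfolding is_subring_def using j_hom by (metis (no_types, lifting) rangeE rangeI)

lemma pK_nonzero: "(of_nat CARD('p) :: 'K) \<noteq> 0"
proof -
  have "(of_nat CARD('p) :: 'p padic_int) \<noteq> 0"
  proof
    assume "(of_nat CARD('p) :: 'p padic_int) = 0"
    then have "Rep_padic_int (of_nat CARD('p) :: 'p padic_int) 2 = 0" by (simp add: Rep_padic_0)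
    moreover have "int CARD('p) mod int CARD('p) ^ 2 = int CARD('p)"
      using prime_gt_1_int[OF prime_card_int[where 'a = 'p]] by (simp add: power2_eq_square)
    ultimately show False using card_pos_int[where 'p = 'p] by (simp add: Rep_padic_of_nat)
  qed
  then show ?thesis by (simp add: j_of_nat[symmetric] j_eq_0_iff)
qed

definition A :: "'K set" where "A = ring_of_integers \<iota>"

lemma A_conv: "A = {x. integral_over (range j) x}"
  unfolding A_def ring_of_integers_def integral_over_def range_j ..

lemma subring_A: "is_subring A"
  unfolding A_conv by (rule is_subring_integral_closure[OF subring_range_j])

lemma j_mem: "j z \<in> A"
  unfolding A_conv by (auto intro: integral_over_mem[OF subring_range_j])

text \<open>
  Clearing denominators in an equation of integral dependence for \<open>z / p\<close> shows
  that \<open>p\<close> divides a power of \<open>z\<close>. This is the case of the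
  integral closedness of the \<open>p\<close>-adic integers that is needed.
\<close>

lemma p_dvd_if_div_integral:
  assumes "j z / (of_nat CARD('p)) \<in> A" shows "of_nat CARD('p) dvd z"
proof -
  let ?p = "of_nat CARD('p) :: 'p padic_int"
  obtain r a where r: "r > 0" "\<And>i. a i \<in> range j" "(j z / (of_nat CARD('p))) ^ r = (\<Sum>i<r. a i * (j z / (of_nat CARD('p))) ^ i)"
    using integral_over_power_relation[OF subring_range_j] assms unfolding A_conv by blast
  from r(2) have "\<forall>i. \<exists>b. a i = j b" by auto
  then obtain b where b: "\<And>i. a i = j (b i)" by metis
  have "j (z ^ r) = (of_nat CARD('p)) ^ r * (j z / (of_nat CARD('p))) ^ r"
    using pK_nonzero by (simp add: j_power power_divide)
  also have "\<dots> = (\<Sum>i<r. (of_nat CARD('p)) ^ r * (a i * (j z / (of_nat CARD('p))) ^ i))"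
    unfolding r(3) by (simp only: sum_distrib_left)
  also have "\<dots> = (\<Sum>i<r. j (b i * z ^ i * ?p ^ (r - i)))"
  proof (rule sum.cong)
    fix i assume "i \<in> {..<r}"
    then have pow: "(of_nat CARD('p) :: 'K) ^ r = (of_nat CARD('p)) ^ (r - i) * (of_nat CARD('p)) ^ i" by (simp flip: power_add)
    show "(of_nat CARD('p)) ^ r * (a i * (j z / (of_nat CARD('p))) ^ i) = j (b i * z ^ i * ?p ^ (r - i))"
      unfolding pow using pK_nonzero by (simp add: b j_hom j_power j_of_nat power_divide)
  qed simp
  also have "\<dots> = j (\<Sum>i<r. b i * z ^ i * ?p ^ (r - i))" by (simp add: j_sum)
  finally have "j (z ^ r - (\<Sum>i<r. b i * z ^ i * ?p ^ (r - i))) = 0"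
    by (simp only: diff_conv_add_uminus j_hom) simp
  then have eq: "z ^ r = (\<Sum>i<r. b i * z ^ i * ?p ^ (r - i))" by (simp add: j_eq_0_iff)
  have "?p dvd (\<Sum>i<r. b i * z ^ i * ?p ^ (r - i))"
    by (intro dvd_sum dvd_mult dvd_power) auto
  then have "?p dvd z ^ r" by (simp only: eq)
  then show ?thesis by (rule p_dvd_power)
qed

lemma p_nonunit: "1 / of_nat CARD('p) \<notin> A"
  using p_dvd_if_div_integral[of 1] p_not_dvd_1[where 'p = 'p] by (auto simp: j_hom)

lemma common_denominator:
  assumes "finite I"
  shows "\<exists>z. z \<noteq> 0 \<and> (\<forall>i\<in>I. \<exists>w. j z * \<iota> (u i) = j w)"
  using assms
proof (induction I)
  case empty
  then show ?case by (intro exI[of _ 1]) simp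
next
  case (insert i I)
  then obtain z where z: "z \<noteq> 0" "\<forall>i\<in>I. \<exists>w. j z * \<iota> (u i) = j w" by blast
  obtain a b where ab: "u i = Fract a b" "b \<noteq> 0" by (cases "u i") auto
  have "j b * \<iota> (u i) = j a"
    using ab by (simp add: j_def iota.hom_mult[symmetric] eq_fract)
  then have "j (b * z) * \<iota> (u i) = j (z * a)" by (simp add: j_hom)
  moreover have "\<exists>w. j (b * z) * \<iota> (u k) = j w" if k: "k \<in> I" for k
  proof -
    obtain w where "j z * \<iota> (u k) = j w" using z(2) k by blast
    then have "j (b * z) * \<iota> (u k) = j (b * w)" by (simp add: j_hom mult.assoc)
    then show ?thesis by blast
  qed
  ultimately show ?case using z(1) ab(2) by (intro exI[of _ "b * z"]) auto
qed

lemma finite_basis: obtains B where "finite B" "V.independent B" "V.span B = UNIV" "card B = d"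
proof -
  obtain B where B: "B \<subseteq> UNIV" "V.independent B" "UNIV \<subseteq> V.span B" "card B = V.dim UNIV"
    by (rule V.basis_exists)
  have "card B = d" using B(4) dim by (rule trans)
  moreover from this have "finite B" using d_pos by (intro card_ge_0_finite) (simp only:)
  moreover have "V.span B = UNIV" using B(3) by (rule top_le)
  ultimately show ?thesis by (intro that[OF _ B(2)])
qed

lemma independent_bound: "V.independent X \<Longrightarrow> finite X \<and> card X \<le> d"
proof -
  assume X: "V.independent X"
  obtain B where B: "finite B" "V.span B = UNIV" "card B = d" using finite_basis by blast
  then show ?thesis using V.independent_span_bound[OF B(1) X] by simp
qed

text \<open>
  The powers of \<open>x\<close> up to the \<open>d\<close>-th are linearly dependent, or
  two of them coincide.
\<close>

lemma algebraic_relation: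
  obtains u where "\<exists>i\<le>d. u i \<noteq> 0" "(\<Sum>i\<le>d. \<iota> (u i) * x ^ i) = 0"
proof (cases "inj_on (\<lambda>i. x ^ i) {..d}")
  case True
  let ?X = "(\<lambda>i. x ^ i) ` {..d}"
  have "card ?X = Suc d" using True by (simp add: card_image)
  then have "V.dependent ?X" using independent_bound[of ?X] by auto
  then obtain u where u: "\<exists>v\<in>?X. u v \<noteq> 0" "(\<Sum>v\<in>?X. \<iota> (u v) * v) = 0"
    by (auto simp: V.dependent_finite)
  have "(\<Sum>i\<le>d. \<iota> (u (x ^ i)) * x ^ i) = 0" using u(2) by (simp add: sum.reindex[OF True])
  then show ?thesis using u(1) by (intro that[of "\<lambda>i. u (x ^ i)"]) auto
next
  case False
  then obtain k l where kl: "k \<le> d" "l \<le> d" "k \<noteq> l" "x ^ k = x ^ l" by (auto simp: inj_on_def)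
  define u :: "nat \<Rightarrow> 'p padic" where "u i = (if i = k then 1 else if i = l then - 1 else 0)" for i
  have "(\<Sum>i\<le>d. \<iota> (u i) * x ^ i) = (\<Sum>i\<in>{k, l}. \<iota> (u i) * x ^ i)"
    using kl by (intro sum.mono_neutral_right) (auto simp: u_def)
  also have "\<dots> = 0" using kl by (simp add: u_def iota.hom_uminus)
  finally show ?thesis using kl by (intro that[of u]) (auto simp: u_def)
qed

text \<open>
  Clear denominators in an algebraic relation for \<open>x\<close>; the product of its
  leading coefficient and \<open>x\<close> is integral.
\<close>

lemma integral_multiple: "\<exists>z. z \<noteq> 0 \<and> j z * x \<in> A"
proof -
  obtain u where u: "\<exists>i\<le>d. u i \<noteq> 0" "(\<Sum>i\<le>d. \<iota> (u i) * x ^ i) = 0" by (rule algebraic_relation)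
  obtain z0 where z0: "z0 \<noteq> 0" "\<forall>i\<in>{..d}. \<exists>w. j z0 * \<iota> (u i) = j w"
    using common_denominator[of "{..d}" u] by auto
  then obtain w where w: "\<And>i. i \<le> d \<Longrightarrow> j z0 * \<iota> (u i) = j (w i)" by (metis atMost_iff)
  define n where "n = (GREATEST i. i \<le> d \<and> u i \<noteq> 0)"
  have n: "n \<le> d \<and> u n \<noteq> 0"
    unfolding n_def by (rule GreatestI_ex_nat[of "\<lambda>i. i \<le> d \<and> u i \<noteq> 0" d]) (use u(1) in auto)
  have above: "u i = 0" if "i > n" "i \<le> d" for i
    using Greatest_le_nat[of "\<lambda>i. i \<le> d \<and> u i \<noteq> 0" i d] that unfolding n_def[symmetric] by auto
  have "(\<Sum>i\<le>n. j (w i) * x ^ i) = (\<Sum>i\<le>d. j z0 * (\<iota> (u i) * x ^ i))"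
    using n above w by (intro sum.mono_neutral_cong_left) (auto simp: mult.assoc[symmetric])
  also have "\<dots> = 0" by (simp only: sum_distrib_left[symmetric] u(2)) simp
  finally have rel: "(\<Sum>i\<le>n. j (w i) * x ^ i) = 0" .
  have wn: "j (w n) \<noteq> 0" using w[of n] n z0(1) by (metis iota.hom_0_iff j_eq_0_iff mult_eq_0_iff)
  have "integral_over (range j) (j (w n) * x)"
    by (rule integral_over_leading_coeff_multiple[OF subring_range_j _ wn rel]) auto
  then show ?thesis using wn by (intro exI[of _ "w n"]) (auto simp: A_conv j_hom)
qed

text \<open>
  If \<open>x \<noteq> 0\<close> were divisible by all powers of \<open>p\<close>, then so
  would be a nonzero \<open>p\<close>-adic integer \<open>z\<close> for which \<open>z /
  x\<close> is integral.
\<close>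

lemma A_separated:
  assumes "\<And>m. \<exists>a\<in>A. x = (of_nat CARD('p)) ^ m * a" shows "x = 0"
proof (rule ccontr)
  assume x: "x \<noteq> 0"
  obtain z where z: "z \<noteq> 0" "j z * (1 / x) \<in> A" using integral_multiple by blast
  obtain n where "\<not> of_nat CARD('p) ^ n dvd z" using padic_nonzero_not_dvd[OF z(1)] by blast
  then obtain N where N: "of_nat CARD('p) ^ N dvd z" "\<not> of_nat CARD('p) ^ Suc N dvd z"
    using ex_least_nat_less[of "\<lambda>n. \<not> of_nat CARD('p) ^ n dvd z" n] by auto
  from N(1) obtain z' where z': "z = of_nat CARD('p) ^ N * z'" by blast
  obtain a where a: "a \<in> A" "x = (of_nat CARD('p)) ^ Suc N * a" using assms by blast
  have "(j z * (1 / x)) * a = j z' / (of_nat CARD('p))"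
    using x pK_nonzero a(2) by (simp add: z' j_hom j_power j_of_nat field_simps)
  moreover have "(j z * (1 / x)) * a \<in> A" by (rule subring_mult[OF subring_A z(2) a(1)])
  ultimately have "of_nat CARD('p) dvd z'" by (intro p_dvd_if_div_integral) simp
  then show False using N(2) by (simp add: z' mult.commute mult_dvd_mono)
qed

section \<open>The ring of integers modulo p\<close>

text \<open>
  These are the finite subsets of \<open>A\<close> whose classes in \<open>A / p A\<close>
  are distinct and linearly independent over the field of \<open>p\<close> elements.
\<close>

definition indep_mod_p :: "'K set \<Rightarrow> bool" where
  "indep_mod_p X \<longleftrightarrow> finite X \<and> X \<subseteq> A \<and>
     (\<forall>c :: 'K \<Rightarrow> int. (\<Sum>x\<in>X. of_int (c x) * x) \<in> principal_ideal A (of_nat CARD('p)) \<longrightarrow> (\<forall>x\<in>X. int CARD('p) dvd c x))"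

lemma ideal_mem: "x \<in> principal_ideal A a \<longleftrightarrow> (\<exists>b\<in>A. x = a * b)"
  by (auto simp: principal_ideal_def)

lemma ideal_multI: "b \<in> A \<Longrightarrow> a * b \<in> principal_ideal A a"
  unfolding ideal_mem by blast

lemma ideal_diff: "x \<in> principal_ideal A a \<Longrightarrow> y \<in> principal_ideal A a \<Longrightarrow> x - y \<in> principal_ideal A a"
  unfolding ideal_mem by (metis subring_diff[OF subring_A] right_diff_distrib)

lemma ideal_mult: "x \<in> principal_ideal A a \<Longrightarrow> y \<in> A \<Longrightarrow> y * x \<in> principal_ideal A a"
  unfolding ideal_mem by (metis subring_mult[OF subring_A] mult.left_commute)

lemma ideal_0: "0 \<in> principal_ideal A a"
  unfolding ideal_mem using subring_0[OF subring_A] by (intro bexI[of _ 0]) auto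

lemma ideal_add: "x \<in> principal_ideal A a \<Longrightarrow> y \<in> principal_ideal A a \<Longrightarrow> x + y \<in> principal_ideal A a"
  unfolding ideal_mem by (metis subring_add[OF subring_A] distrib_left)

lemma ideal_sum: "(\<And>x. x \<in> X \<Longrightarrow> f x \<in> principal_ideal A a) \<Longrightarrow> sum f X \<in> principal_ideal A a"
  by (induction X rule: infinite_finite_induct) (auto simp: ideal_0 ideal_add)

lemma indep_mod_pD:
  "indep_mod_p X \<Longrightarrow> (\<Sum>x\<in>X. of_int (c x) * x) \<in> principal_ideal A (of_nat CARD('p)) \<Longrightarrow>
     x \<in> X \<Longrightarrow> int CARD('p) dvd c x"
  unfolding indep_mod_p_def by blast

text \<open>
  A linear relation can be scaled to have \<open>p\<close>-adic integer coefficients not all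
  divisible by \<open>p\<close>, and is then nontrivial modulo \<open>p\<close>. So there
  are at most \<open>d\<close> elements that are independent modulo \<open>p\<close>.
\<close>

lemma indep_mod_p_independent:
  assumes X: "indep_mod_p X" shows "V.independent X"
proof
  assume "V.dependent X"
  have fin: "finite X" and XA: "X \<subseteq> A" using X by (auto simp: indep_mod_p_def)
  obtain u where u: "\<exists>v\<in>X. u v \<noteq> 0" "(\<Sum>v\<in>X. \<iota> (u v) * v) = 0"
    using \<open>V.dependent X\<close> V.dependent_finite[OF fin] by auto
  obtain z0 where z0: "z0 \<noteq> 0" "\<forall>v\<in>X. \<exists>w. j z0 * \<iota> (u v) = j w"
    using common_denominator[OF fin, of u] by auto
  then obtain w where w: "\<And>v. v \<in> X \<Longrightarrow> j z0 * \<iota> (u v) = j (w v)" by metis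
  have rel: "(\<Sum>v\<in>X. j (w v) * v) = 0"
  proof -
    have "(\<Sum>v\<in>X. j (w v) * v) = (\<Sum>v\<in>X. j z0 * (\<iota> (u v) * v))"
      by (intro sum.cong refl) (simp add: w[symmetric] mult.assoc)
    also have "\<dots> = 0" by (simp only: sum_distrib_left[symmetric] u(2)) simp
    finally show ?thesis .
  qed
  obtain v0 where v0: "v0 \<in> X" "w v0 \<noteq> 0"
    using u(1) w z0(1) by (metis iota.hom_0_iff j_eq_0_iff mult_eq_0_iff)
  obtain n where n: "\<not> of_nat CARD('p) ^ n dvd w v0" using padic_nonzero_not_dvd[OF v0(2)] by blast
  let ?Q = "\<lambda>n. \<exists>v\<in>X. \<not> of_nat CARD('p) ^ n dvd w v"
  obtain N where N: "\<not> ?Q N" "?Q (Suc N)"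
    using ex_least_nat_less[of ?Q n] n v0 by auto
  then have "\<forall>v\<in>X. \<exists>y. w v = of_nat CARD('p) ^ N * y" by (auto simp: dvd_def)
  then obtain y where y: "\<And>v. v \<in> X \<Longrightarrow> w v = of_nat CARD('p) ^ N * y v" by metis
  have "(of_nat CARD('p)) ^ N * (\<Sum>v\<in>X. j (y v) * v) = (\<Sum>v\<in>X. j (w v) * v)"
    unfolding sum_distrib_left by (intro sum.cong refl) (simp add: y j_hom j_power j_of_nat mult.assoc)
  then have rel': "(\<Sum>v\<in>X. j (y v) * v) = 0" using rel pK_nonzero by simp
  have "\<forall>v. \<exists>t. y v = of_int (Rep_padic_int (y v) 1) + of_nat CARD('p) ^ 1 * t"
    using padic_split by blast
  then obtain t where t: "\<And>v. y v = of_int (Rep_padic_int (y v) 1) + of_nat CARD('p) * t v"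
    by (metis power_one_right)
  define c where "c v = Rep_padic_int (y v) 1" for v
  have jy: "j (y v) = of_int (c v) + (of_nat CARD('p)) * j (t v)" for v
    unfolding c_def by (subst t) (simp add: j_hom j_of_int j_of_nat)
  have "(\<Sum>v\<in>X. of_int (c v) * v) = (\<Sum>v\<in>X. j (y v) * v) - (\<Sum>v\<in>X. (of_nat CARD('p)) * (j (t v) * v))"
    unfolding sum_subtractf[symmetric] by (intro sum.cong refl) (simp add: jy algebra_simps)
  also have "\<dots> = (of_nat CARD('p)) * (- (\<Sum>v\<in>X. j (t v) * v))" unfolding rel' by (simp add: sum_distrib_left)
  finally have "(\<Sum>v\<in>X. of_int (c v) * v) \<in> principal_ideal A (of_nat CARD('p))"
    unfolding ideal_mem using XA
    by (intro bexI[of _ "- (\<Sum>v\<in>X. j (t v) * v)"])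
       (auto intro!: subring_uminus[OF subring_A] subring_sum[OF subring_A] subring_mult[OF subring_A] j_mem)
  then have "\<forall>v\<in>X. int CARD('p) dvd c v" using X by (simp add: indep_mod_p_def)
  then have "of_nat CARD('p) dvd y v" if "v \<in> X" for v
    using that t[of v] by (metis c_def dvd_add dvd_triv_left of_int_p_dvd)
  then have "of_nat CARD('p) ^ Suc N dvd w v" if "v \<in> X" for v
    using that y[OF that] by (simp add: mult.commute mult_dvd_mono)
  then show False using N(2) by blast
qed

lemma maximal_indep_mod_p:
  obtains X where "indep_mod_p X" "\<And>Y. indep_mod_p Y \<Longrightarrow> card Y \<le> card X"
proof -
  have "indep_mod_p {}" by (simp add: indep_mod_p_def)
  moreover have "\<forall>Y. indep_mod_p Y \<longrightarrow> card Y < Suc d"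
    using independent_bound indep_mod_p_independent by (auto simp: less_Suc_eq_le)
  ultimately have "\<exists>X. indep_mod_p X \<and> (\<forall>Y. indep_mod_p Y \<longrightarrow> card Y \<le> card X)"
    by (intro ex_has_greatest_nat) auto
  then show ?thesis using that by blast
qed

lemma prime_p_int: "prime (int CARD('p))"
  by (rule prime_card_int)

text \<open>
  By maximality, adjoining \<open>a\<close> destroys independence, and in the resulting
  relation the coefficient of \<open>a\<close> is invertible modulo \<open>p\<close>.
\<close>

lemma reduce_mod_p:
  assumes X: "indep_mod_p X" and max: "\<And>Y. indep_mod_p Y \<Longrightarrow> card Y \<le> card X" and a: "a \<in> A"
  shows "\<exists>c :: 'K \<Rightarrow> int. (\<forall>x. c x \<in> {0..<int CARD('p)}) \<and> a - (\<Sum>x\<in>X. of_int (c x) * x) \<in> principal_ideal A (of_nat CARD('p))"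
proof -
  have fin: "finite X" and XA: "X \<subseteq> A" using X by (auto simp: indep_mod_p_def)
  have "\<exists>c :: 'K \<Rightarrow> int. a - (\<Sum>x\<in>X. of_int (c x) * x) \<in> principal_ideal A (of_nat CARD('p))"
  proof (cases "a \<in> X")
    case True
    have "(\<Sum>x\<in>X. of_int (if x = a then 1 else 0) * x) = (\<Sum>x\<in>X. if x = a then x else 0)"
      by (intro sum.cong) auto
    then have "a - (\<Sum>x\<in>X. of_int (if x = a then 1 else 0) * x) = 0" using fin True by simp
    then show ?thesis using ideal_0 by (intro exI[of _ "\<lambda>x. if x = a then 1 else 0"]) (simp only:)
  next
    case False
    have "card (insert a X) > card X" using fin False by simp
    then have "\<not> indep_mod_p (insert a X)" using max[of "insert a X"] by auto
    then obtain c :: "'K \<Rightarrow> int" where c: "(\<Sum>x\<in>insert a X. of_int (c x) * x) \<in> principal_ideal A (of_nat CARD('p))"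
      "\<exists>x\<in>insert a X. \<not> int CARD('p) dvd c x"
      using fin XA a by (auto simp: indep_mod_p_def)
    have sum: "(\<Sum>x\<in>insert a X. of_int (c x) * x) = of_int (c a) * a + (\<Sum>x\<in>X. of_int (c x) * x)"
      using fin False by simp
    have ca: "\<not> int CARD('p) dvd c a"
    proof
      assume "int CARD('p) dvd c a"
      then obtain k where k: "c a = int CARD('p) * k" by blast
      have "of_int (c a) * a \<in> principal_ideal A (of_nat CARD('p))"
        unfolding ideal_mem using a subring_of_int[OF subring_A]
        by (intro bexI[of _ "of_int k * a"] subring_mult[OF subring_A]) (auto simp: k)
      then have "(\<Sum>x\<in>X. of_int (c x) * x) \<in> principal_ideal A (of_nat CARD('p))"
        using ideal_diff[OF c(1)] unfolding sum by fastforce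
      then have "\<forall>x\<in>X. int CARD('p) dvd c x" using X by (simp add: indep_mod_p_def)
      then show False using c(2) \<open>int CARD('p) dvd c a\<close> by auto
    qed
    then have "coprime (int CARD('p)) (c a)" by (rule prime_imp_coprime[OF prime_p_int])
    then have "gcd (c a) (int CARD('p)) = 1" by (metis coprime_imp_gcd_eq_1 gcd.commute)
    then obtain t s where ts: "t * c a + s * int CARD('p) = 1"
      using bezout_int[of "c a" "int CARD('p)"] by metis
    have "a - (\<Sum>x\<in>X. of_int (- t * c x) * x) =
        of_int t * (\<Sum>x\<in>insert a X. of_int (c x) * x) + (of_nat CARD('p)) * (of_int s * a)"
    proof -
      have "of_int t * (\<Sum>x\<in>insert a X. of_int (c x) * x) + (of_nat CARD('p)) * (of_int s * a) =
          of_int (t * c a + s * int CARD('p)) * a + of_int t * (\<Sum>x\<in>X. of_int (c x) * x)"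
        unfolding sum by (simp add: algebra_simps)
      moreover have "(\<Sum>x\<in>X. of_int (- t * c x) * x) = - (of_int t * (\<Sum>x\<in>X. of_int (c x) * x))"
        by (simp add: sum_distrib_left sum_negf mult.assoc)
      ultimately show ?thesis unfolding ts by simp
    qed
    moreover have "of_int t * (\<Sum>x\<in>insert a X. of_int (c x) * x) + (of_nat CARD('p)) * (of_int s * a) \<in> principal_ideal A (of_nat CARD('p))"
      by (intro ideal_add[OF ideal_mult[OF c(1) subring_of_int[OF subring_A]]] ideal_multI
          subring_mult[OF subring_A] subring_of_int[OF subring_A] a)
    ultimately show ?thesis by (intro exI[of _ "\<lambda>x. - t * c x"]) simp
  qed
  then obtain c :: "'K \<Rightarrow> int" where c: "a - (\<Sum>x\<in>X. of_int (c x) * x) \<in> principal_ideal A (of_nat CARD('p))" by blast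
  define c' where "c' x = c x mod int CARD('p)" for x
  have eq: "a - (\<Sum>x\<in>X. of_int (c' x) * x) =
      (a - (\<Sum>x\<in>X. of_int (c x) * x)) + (\<Sum>x\<in>X. (of_nat CARD('p)) * (of_int (c x div int CARD('p)) * x))"
  proof -
    have "of_int (c x) * x = of_int (c' x) * x + (of_nat CARD('p)) * (of_int (c x div int CARD('p)) * x)" for x :: 'K
    proof -
      have "c x = c' x + int CARD('p) * (c x div int CARD('p))" by (simp add: c'_def)
      then have "(of_int (c x) :: 'K) = of_int (c' x) + (of_nat CARD('p)) * of_int (c x div int CARD('p))"
        by (metis of_int_add of_int_mult of_int_of_nat_eq)
      then show ?thesis by (simp add: distrib_right mult.assoc)
    qed
    then have "(\<Sum>x\<in>X. of_int (c x) * x) = (\<Sum>x\<in>X. of_int (c' x) * x) + (\<Sum>x\<in>X. (of_nat CARD('p)) * (of_int (c x div int CARD('p)) * x))"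
      by (simp add: sum.distrib)
    then show ?thesis by simp
  qed
  have mem: "(\<Sum>x\<in>X. (of_nat CARD('p)) * (of_int (c x div int CARD('p)) * x)) \<in> principal_ideal A (of_nat CARD('p))"
    using XA by (intro ideal_sum ideal_multI subring_mult[OF subring_A] subring_of_int[OF subring_A]) auto
  have "a - (\<Sum>x\<in>X. of_int (c' x) * x) \<in> principal_ideal A (of_nat CARD('p))"
    unfolding eq by (rule ideal_add[OF c mem])
  moreover have "\<forall>x. c' x \<in> {0..<int CARD('p)}" using card_pos_int[where 'p = 'p] by (simp add: c'_def)
  ultimately show ?thesis by blast
qed

text \<open>
  Let \<open>X\<close> be a maximal set that is independent modulo \<open>p\<close>.
  Combinations of \<open>X\<close> with coefficients in \<open>{0..<p}\<close> represent
  \<open>A / p A\<close>. To see that \<open>X\<close> has \<open>d\<close> elements, expand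
  an element of \<open>A\<close> repeatedly modulo \<open>p\<close>: the digits are
  collected into \<open>p\<close>-adic coefficients, so \<open>X\<close> spans
  \<open>A\<close> over the \<open>p\<close>-adic integers, because \<open>A\<close> is
  separated. As \<open>A\<close> spans the field, \<open>X\<close> is a basis of the field.
\<close>

lemma residue_system_p:
  obtains S where "residue_system A (principal_ideal A (of_nat CARD('p))) S" "card S = CARD('p) ^ d"
proof -
  obtain X where X: "indep_mod_p X" and max: "\<And>Y. indep_mod_p Y \<Longrightarrow> card Y \<le> card X"
    using maximal_indep_mod_p by blast
  have fin: "finite X" and XA: "X \<subseteq> A" using X by (auto simp: indep_mod_p_def)
  have p0: "int CARD('p) > 0" by (rule card_pos_int)
  let ?P = "X \<rightarrow>\<^sub>E {0..<int CARD('p)}"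
  define f where "f c = (\<Sum>x\<in>X. of_int (c x) * x)" for c :: "'K \<Rightarrow> int"
  have f_A: "f c \<in> A" for c
    unfolding f_def using XA by (auto intro!: subring_sum[OF subring_A] subring_mult[OF subring_A] subring_of_int[OF subring_A])
  have uniq: "c = c'" if "c \<in> ?P" "c' \<in> ?P" "f c - f c' \<in> principal_ideal A (of_nat CARD('p))" for c c'
  proof (rule PiE_ext[OF that(1,2)])
    fix x assume x: "x \<in> X"
    have "f c - f c' = (\<Sum>x\<in>X. of_int (c x - c' x) * x)"
      by (simp add: f_def left_diff_distrib sum_subtractf)
    then have "(\<Sum>x\<in>X. of_int (c x - c' x) * x) \<in> principal_ideal A (of_nat CARD('p))"
      using that(3) by (simp only:)
    then have "int CARD('p) dvd c x - c' x" by (rule indep_mod_pD[OF X _ x])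
    then have "c x mod int CARD('p) = c' x mod int CARD('p)" by (simp add: mod_eq_dvd_iff)
    moreover have "c x \<in> {0..<int CARD('p)}" "c' x \<in> {0..<int CARD('p)}" using that(1,2) x by auto
    ultimately show "c x = c' x" by simp
  qed
  have inj: "inj_on f ?P" using uniq ideal_0 by (intro inj_onI) auto
  have "residue_system A (principal_ideal A (of_nat CARD('p))) (f ` ?P)"
    unfolding residue_system_def
  proof (intro conjI ballI)
    show "finite (f ` ?P)" using fin by (intro finite_imageI finite_PiE) auto
    show "f ` ?P \<subseteq> A" using f_A by auto
    fix a assume a: "a \<in> A"
    obtain c :: "'K \<Rightarrow> int" where c: "\<forall>x. c x \<in> {0..<int CARD('p)}" "a - f c \<in> principal_ideal A (of_nat CARD('p))"
      using reduce_mod_p[OF X max a] by (auto simp: f_def)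
    define c' where "c' = restrict c X"
    have c': "c' \<in> ?P" "f c' = f c" using c(1) by (auto simp: c'_def f_def)
    show "\<exists>!s. s \<in> f ` ?P \<and> a - s \<in> principal_ideal A (of_nat CARD('p))"
    proof (rule ex1I[of _ "f c'"])
      show "f c' \<in> f ` ?P \<and> a - f c' \<in> principal_ideal A (of_nat CARD('p))"
        using imageI[OF c'(1), of f] c(2) unfolding c'(2) by blast
      fix s assume s: "s \<in> f ` ?P \<and> a - s \<in> principal_ideal A (of_nat CARD('p))"
      then obtain e where e: "e \<in> ?P" "s = f e" by auto
      have "(a - f c') - (a - s) \<in> principal_ideal A (of_nat CARD('p))"
        using ideal_diff[OF c(2) conjunct2[OF s]] unfolding c'(2) .
      then have "f e - f c' \<in> principal_ideal A (of_nat CARD('p))" by (simp add: e(2))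
      then show "s = f c'" using uniq[OF e(1) c'(1)] e by simp
    qed
  qed
  moreover have "card (f ` ?P) = CARD('p) ^ card X"
    using fin by (simp add: card_image[OF inj] card_PiE)
  moreover have "card X = d"
  proof -
    have "a \<in> V.span X" if a: "a \<in> A" for a
    proof -
      have "\<forall>b\<in>A. \<exists>c r. (\<forall>x. c x \<in> {0..<int CARD('p)}) \<and> r \<in> A \<and> b = (\<Sum>x\<in>X. of_int (c x) * x) + (of_nat CARD('p)) * r"
      proof
        fix b assume "b \<in> A"
        from reduce_mod_p[OF X max this] obtain c :: "'K \<Rightarrow> int" and r where
          "\<forall>x. c x \<in> {0..<int CARD('p)}" "r \<in> A" "b - (\<Sum>x\<in>X. of_int (c x) * x) = (of_nat CARD('p)) * r"
          by (auto simp: ideal_mem)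
        then show "\<exists>c r. (\<forall>x. c x \<in> {0..<int CARD('p)}) \<and> r \<in> A \<and> b = (\<Sum>x\<in>X. of_int (c x) * x) + (of_nat CARD('p)) * r"
          by (intro exI[of _ c] exI[of _ r]) (auto simp: algebra_simps)
      qed
      \<comment> \<open>\<open>C b\<close> is the digit vector of \<open>b\<close>, and
      \<open>R b\<close> the quotient of the remainder by \<open>p\<close>.\<close>
      from bchoice[OF this] obtain C where "\<forall>b\<in>A. \<exists>r. (\<forall>x. C b x \<in> {0..<int CARD('p)}) \<and> r \<in> A \<and>
          b = (\<Sum>x\<in>X. of_int (C b x) * x) + (of_nat CARD('p)) * r" by (rule exE)
      from bchoice[OF this] obtain R where R: "\<forall>b\<in>A. (\<forall>x. C b x \<in> {0..<int CARD('p)}) \<and> R b \<in> A \<and>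
          b = (\<Sum>x\<in>X. of_int (C b x) * x) + (of_nat CARD('p)) * R b" by (rule exE)
      have CR: "\<And>b x. b \<in> A \<Longrightarrow> C b x \<in> {0..<int CARD('p)}" "\<And>b. b \<in> A \<Longrightarrow> R b \<in> A"
        "\<And>b. b \<in> A \<Longrightarrow> b = (\<Sum>x\<in>X. of_int (C b x) * x) + (of_nat CARD('p)) * R b"
        using R by blast+
      have RA: "(R ^^ n) a \<in> A" for n by (induction n) (simp_all add: a CR(2))
      have expand: "a = (\<Sum>x\<in>X. of_int (\<Sum>i<n. C ((R ^^ i) a) x * int CARD('p) ^ i) * x) + (of_nat CARD('p)) ^ n * (R ^^ n) a" for n
      proof (induction n)
        case (Suc n)
        have "(of_nat CARD('p)) ^ n * (R ^^ n) a = (\<Sum>x\<in>X. of_int (C ((R ^^ n) a) x * int CARD('p) ^ n) * x) + (of_nat CARD('p)) ^ Suc n * (R ^^ Suc n) a"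
          by (subst CR(3)[OF RA[of n]]) (simp add: distrib_left sum_distrib_left mult_ac)
        with Suc show ?case by (simp add: distrib_right sum.distrib add.assoc)
      qed simp
      have "\<forall>x. \<exists>z :: 'p padic_int. \<forall>n. Rep_padic_int z n = (\<Sum>i<n. C ((R ^^ i) a) x * int CARD('p) ^ i)"
      proof
        fix x
        show "\<exists>z :: 'p padic_int. \<forall>n. Rep_padic_int z n = (\<Sum>i<n. C ((R ^^ i) a) x * int CARD('p) ^ i)"
          by (rule padic_digits[where c = "\<lambda>i. C ((R ^^ i) a) x", OF CR(1)[OF RA]]) blast
      qed
      then obtain z :: "'K \<Rightarrow> 'p padic_int" where z: "\<And>x n. Rep_padic_int (z x) n = (\<Sum>i<n. C ((R ^^ i) a) x * int CARD('p) ^ i)"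
        by metis
      have "a - (\<Sum>x\<in>X. j (z x) * x) = 0"
      proof (rule A_separated)
        fix n
        have "\<forall>x. \<exists>t. z x = of_int (Rep_padic_int (z x) n) + of_nat CARD('p) ^ n * t"
          using padic_split by blast
        then obtain t where t: "\<And>x. z x = of_int (Rep_padic_int (z x) n) + of_nat CARD('p) ^ n * t x" by metis
        have jz: "j (z x) = of_int (\<Sum>i<n. C ((R ^^ i) a) x * int CARD('p) ^ i) + (of_nat CARD('p)) ^ n * j (t x)" for x
          by (subst t) (simp only: z j_hom j_of_int j_power j_of_nat)
        have "(\<Sum>x\<in>X. j (z x) * x) = (\<Sum>x\<in>X. of_int (\<Sum>i<n. C ((R ^^ i) a) x * int CARD('p) ^ i) * x) + (of_nat CARD('p)) ^ n * (\<Sum>x\<in>X. j (t x) * x)"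
          unfolding jz distrib_right sum.distrib by (simp add: sum_distrib_left mult.assoc)
        then have "a - (\<Sum>x\<in>X. j (z x) * x) = (of_nat CARD('p)) ^ n * ((R ^^ n) a - (\<Sum>x\<in>X. j (t x) * x))"
          by (subst expand[of n]) (simp add: right_diff_distrib)
        moreover have "(R ^^ n) a - (\<Sum>x\<in>X. j (t x) * x) \<in> A"
          using XA by (intro subring_diff[OF subring_A] RA)
            (auto intro!: subring_sum[OF subring_A] subring_mult[OF subring_A] j_mem)
        ultimately show "\<exists>b\<in>A. a - (\<Sum>x\<in>X. j (z x) * x) = (of_nat CARD('p)) ^ n * b" by blast
      qed
      then have "a = (\<Sum>x\<in>X. \<iota> (Fract (z x) 1) * x)" by (simp add: j_def)
      also have "\<dots> \<in> V.span X" by (intro V.span_sum V.span_scale V.span_base)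
      finally show ?thesis .
    qed
    note A_span = this
    have "x \<in> V.span X" for x
    proof -
      obtain z where z: "z \<noteq> 0" "j z * x \<in> A" using integral_multiple by blast
      have sp: "\<iota> (inverse (Fract z 1)) * (j z * x) \<in> V.span X"
        by (rule V.span_scale[OF A_span[OF z(2)]])
      have inv: "\<iota> (inverse (Fract z 1)) = inverse (j z)"
        unfolding j_def by (rule iota.hom_inverse)
      have one: "inverse (j z) * (j z * x) = x" using z(1) j_eq_0_iff[of z] by simp
      show ?thesis using sp unfolding inv one .
    qed
    then have "V.span X = V.span UNIV" by auto
    then show ?thesis using V.dim_eq_card[OF _ indep_mod_p_independent[OF X], of UNIV] dim by simp
  qed
  ultimately show ?thesis using that by metis
qed

end

section \<open>Automorphism groups and closedness\<close>

lemma fps_compose_nth_cong: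
  fixes f u :: "'a::comm_ring_1 fps"
  assumes "\<And>i. i \<le> n \<Longrightarrow> f $ i = f' $ i" "\<And>i. i \<le> n \<Longrightarrow> u $ i = u' $ i"
  shows "(f oo u) $ n = (f' oo u') $ n"
  unfolding fps_compose_nth
  by (intro sum.cong refl arg_cong2[of _ _ _ _ "(*)"] fps_power_nth_cong) (use assms in auto)

lemma fps_inv_nth_0: "fps_inv f $ 0 = 0"
  by (simp add: fps_inv_def)

lemma fps_inv_nth_1:
  fixes f :: "'a::field fps"
  assumes "f $ 0 = 0" "f $ 1 \<noteq> 0" shows "fps_inv f $ 1 \<noteq> 0"
proof
  assume "fps_inv f $ 1 = 0"
  then have "(fps_inv f oo f) $ 1 = 0" by (simp add: fps_compose_nth fps_inv_nth_0)
  then show False using fps_inv[OF assms] by simp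
qed

context
  fixes ty :: "'a::alg_closed_field itself"
begin

text \<open>
  An algebraically closed field is infinite, so two series in two variables agree if they
  agree at all pairs of one-variable arguments.
\<close>

lemma fgl_iso_iff_points:
  fixes F G :: "'a fps fps"
  assumes "F $ 0 $ 0 = 0" "G $ 0 $ 0 = 0"
  shows "fgl_iso F G f \<longleftrightarrow> f $ 0 = 0 \<and> f $ 1 \<noteq> 0 \<and>
    (\<forall>u v. u $ 0 = 0 \<longrightarrow> v $ 0 = 0 \<longrightarrow> f oo fps_eval2 F u v = fps_eval2 G (f oo u) (f oo v))"
proof -
  have "subst1 f F = subst2 G (subst1 f fps_x) (subst1 f fps_y) \<longleftrightarrow>
    (\<forall>u v. u $ 0 = 0 \<longrightarrow> v $ 0 = 0 \<longrightarrow> f oo fps_eval2 F u v = fps_eval2 G (f oo u) (f oo v))"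
    if f0: "f $ 0 = 0"
  proof -
    have ev: "fps_eval2 (subst1 f F) u v = f oo fps_eval2 F u v"
      "fps_eval2 (subst2 G (subst1 f fps_x) (subst1 f fps_y)) u v = fps_eval2 G (f oo u) (f oo v)"
      if "u $ 0 = 0" "v $ 0 = 0" for u v
      using that f0 assms by (simp_all add: fps_eval2_subst1 fps_eval2_subst2 fps_eval2_x fps_eval2_y)
    show ?thesis
    proof (intro iffI allI impI)
      fix u v :: "'a fps"
      assume "subst1 f F = subst2 G (subst1 f fps_x) (subst1 f fps_y)" and 0: "u $ 0 = 0" "v $ 0 = 0"
      from arg_cong[OF this(1), of "\<lambda>F. fps_eval2 F u v"]
      show "f oo fps_eval2 F u v = fps_eval2 G (f oo u) (f oo v)" unfolding ev[OF 0] .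
    next
      assume *: "\<forall>u v. u $ 0 = 0 \<longrightarrow> v $ 0 = 0 \<longrightarrow> f oo fps_eval2 F u v = fps_eval2 G (f oo u) (f oo v)"
      show "subst1 f F = subst2 G (subst1 f fps_x) (subst1 f fps_y)"
      proof (rule fps2_eqI_points[OF infinite_UNIV_alg_closed])
        fix x y :: 'a
        have 0: "(fps_const x * fps_X) $ 0 = 0" "(fps_const y * fps_X) $ 0 = 0" by simp_all
        show "fps_eval2 (subst1 f F) (fps_const x * fps_X) (fps_const y * fps_X) =
            fps_eval2 (subst2 G (subst1 f fps_x) (subst1 f fps_y)) (fps_const x * fps_X) (fps_const y * fps_X)"
          unfolding ev[OF 0] using * 0 by blast
      qed
    qed
  qed
  then show ?thesis unfolding fgl_iso_def by blast
qed

lemma fgl_iso_nth: "fgl_iso F G f \<Longrightarrow> f $ 0 = 0" "fgl_iso F G f \<Longrightarrow> f $ 1 \<noteq> 0"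
  by (simp_all add: fgl_iso_def)

lemma fgl_iso_compose:
  fixes F G H :: "'a fps fps"
  assumes 0: "F $ 0 $ 0 = 0" "G $ 0 $ 0 = 0" "H $ 0 $ 0 = 0"
    and f: "fgl_iso F G f" and g: "fgl_iso G H g"
  shows "fgl_iso F H (g oo f)"
  unfolding fgl_iso_iff_points[OF 0(1,3)]
proof (intro conjI allI impI)
  have f0: "f $ 0 = 0" "f $ 1 \<noteq> 0" and g0: "g $ 0 = 0" "g $ 1 \<noteq> 0"
    using f g by (simp_all add: fgl_iso_def)
  show "(g oo f) $ 0 = 0" using g0 by simp
  show "(g oo f) $ 1 \<noteq> 0" using f0 g0 by (simp add: fps_compose_nth)
  fix u v :: "'a fps" assume uv: "u $ 0 = 0" "v $ 0 = 0"
  have "(g oo f) oo fps_eval2 F u v = g oo (f oo fps_eval2 F u v)"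
    using f0 0 by (simp add: fps_compose_assoc)
  also have "f oo fps_eval2 F u v = fps_eval2 G (f oo u) (f oo v)"
    using f uv unfolding fgl_iso_iff_points[OF 0(1,2)] by blast
  also have "g oo \<dots> = fps_eval2 H (g oo (f oo u)) (g oo (f oo v))"
  proof -
    have "(f oo u) $ 0 = 0" "(f oo v) $ 0 = 0" using f0 by simp_all
    then show ?thesis using g unfolding fgl_iso_iff_points[OF 0(2,3)] by blast
  qed
  also have "\<dots> = fps_eval2 H ((g oo f) oo u) ((g oo f) oo v)"
    using f0 uv by (simp add: fps_compose_assoc)
  finally show "(g oo f) oo fps_eval2 F u v = fps_eval2 H ((g oo f) oo u) ((g oo f) oo v)" .
qed

lemma fgl_iso_inverse:
  fixes F G :: "'a fps fps"
  assumes 0: "F $ 0 $ 0 = 0" "G $ 0 $ 0 = 0" and f: "fgl_iso F G f"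
  shows "fgl_iso G F (fps_inv f)"
  unfolding fgl_iso_iff_points[OF 0(2,1)]
proof (intro conjI allI impI)
  have f0: "f $ 0 = 0" "f $ 1 \<noteq> 0" using f by (simp_all add: fgl_iso_def)
  let ?g = "fps_inv f"
  show g0: "?g $ 0 = 0" by (rule fps_inv_nth_0)
  show "?g $ 1 \<noteq> 0" by (rule fps_inv_nth_1[OF f0])
  fix u v :: "'a fps" assume uv: "u $ 0 = 0" "v $ 0 = 0"
  have fg: "f oo (?g oo w) = w" "?g oo (f oo w) = w" if "w $ 0 = 0" for w
    using that f0 g0 by (simp_all add: fps_compose_assoc fps_inv fps_inv_right)
  have guv: "(?g oo u) $ 0 = 0" "(?g oo v) $ 0 = 0" using g0 by simp_all
  have "f oo fps_eval2 F (?g oo u) (?g oo v) = fps_eval2 G (f oo (?g oo u)) (f oo (?g oo v))"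
    using f guv unfolding fgl_iso_iff_points[OF 0] by blast
  also have "\<dots> = fps_eval2 G u v" by (simp only: fg uv)
  finally have "?g oo fps_eval2 G u v = ?g oo (f oo fps_eval2 F (?g oo u) (?g oo v))" by simp
  also have "\<dots> = fps_eval2 F (?g oo u) (?g oo v)" using 0 by (intro fg) simp
  finally show "?g oo fps_eval2 G u v = fps_eval2 F (?g oo u) (?g oo v)" .
qed

lemma fgl_aut_X: "F $ 0 $ 0 = 0 \<Longrightarrow> fps_X \<in> fgl_aut (F :: 'a fps fps)"
  unfolding fgl_aut_def by (auto simp: fgl_iso_iff_points)

context
  fixes F H :: "'a fps fps" and act :: "'b \<Rightarrow> 'a fps" and A :: "'b set" and \<phi> :: "'a fps"
  assumes F: "F $ 0 $ 0 = 0" and H: "H $ 0 $ 0 = 0" and act: "\<And>a. act a $ 0 = 0" and \<phi>: "fgl_iso F H \<phi>"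
begin

text \<open>
  Abbreviations for the two theorems below: \<open>M\<close> is the automorphism group of
  the formal module, and \<open>\<psi>\<close> the inverse of the given isomorphism.
\<close>

private definition "M = formal_module_aut A F act"
private definition "\<psi> = fps_inv \<phi>"

private lemma \<phi>0: "\<phi> $ 0 = 0" "\<psi> $ 0 = 0" "fgl_iso H F \<psi>"
  using \<phi> fgl_iso_inverse[OF F H \<phi>] by (simp_all add: fgl_iso_def \<psi>_def fps_inv_nth_0)

private lemma \<phi>\<psi>: "\<phi> oo \<psi> = fps_X" "\<psi> oo \<phi> = fps_X"
  using \<phi> by (simp_all add: fgl_iso_def \<psi>_def fps_inv fps_inv_right)

private lemma cancel: "u $ 0 = 0 \<Longrightarrow> \<phi> oo (\<psi> oo u) = u" "u $ 0 = 0 \<Longrightarrow> \<psi> oo (\<phi> oo u) = u"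
  using \<phi>0 \<phi>\<psi> by (simp_all add: fps_compose_assoc)

private lemma conj_eq: "f $ 0 = 0 \<Longrightarrow> conjugate_by \<phi> f = \<phi> oo (f oo \<psi>)"
  using \<phi>0 by (simp add: conjugate_by_def \<psi>_def[symmetric] fps_compose_assoc)

private lemma M_D: "f \<in> M \<Longrightarrow> f $ 0 = 0" "f \<in> M \<Longrightarrow> fgl_iso F F f" "f \<in> M \<Longrightarrow> f $ 1 \<noteq> 0"
  "f \<in> M \<Longrightarrow> a \<in> A \<Longrightarrow> f oo act a = act a oo f"
  by (auto simp: M_def formal_module_aut_def fgl_aut_def fgl_iso_def)

private lemma M_I: "fgl_iso F F f \<Longrightarrow> (\<And>a. a \<in> A \<Longrightarrow> f oo act a = act a oo f) \<Longrightarrow> f \<in> M"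
  by (auto simp: M_def formal_module_aut_def fgl_aut_def)

private lemma conj_aut: "fgl_iso F F f \<Longrightarrow> conjugate_by \<phi> f \<in> fgl_aut H"
  using fgl_iso_compose[OF H F H fgl_iso_compose[OF H F F \<phi>0(3)] \<phi>, of f]
  by (simp add: conj_eq fgl_iso_nth(1) fgl_aut_def)

private lemma conj_mult:
  assumes "f $ 0 = 0" "g $ 0 = 0"
  shows "conjugate_by \<phi> f oo conjugate_by \<phi> g = conjugate_by \<phi> (f oo g)"
proof -
  have "conjugate_by \<phi> f oo conjugate_by \<phi> g = \<phi> oo (f oo (\<psi> oo (\<phi> oo (g oo \<psi>))))"
    using assms \<phi>0 by (simp add: conj_eq fps_compose_assoc)
  also have "\<psi> oo (\<phi> oo (g oo \<psi>)) = g oo \<psi>" using assms by (intro cancel) simp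
  finally show ?thesis using assms \<phi>0 by (simp add: conj_eq fps_compose_assoc)
qed

private lemma M_compose:
  assumes f: "f \<in> M" and g: "g \<in> M" shows "f oo g \<in> M"
proof (rule M_I)
  show "fgl_iso F F (f oo g)" by (rule fgl_iso_compose[OF F F F M_D(2)[OF g] M_D(2)[OF f]])
  fix a assume a: "a \<in> A"
  have "f oo g oo act a = f oo (g oo act a)" using M_D(1)[OF g] act by (simp add: fps_compose_assoc)
  also have "\<dots> = (f oo act a) oo g"
    unfolding M_D(4)[OF g a] using M_D(1)[OF g] act by (simp add: fps_compose_assoc)
  also have "\<dots> = act a oo (f oo g)"
    unfolding M_D(4)[OF f a] using M_D(1)[OF g] M_D(1)[OF f] by (simp add: fps_compose_assoc)
  finally show "f oo g oo act a = act a oo (f oo g)" .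
qed

private lemma M_inverse:
  assumes f: "f \<in> M" shows "fps_inv f \<in> M"
proof (rule M_I)
  show "fgl_iso F F (fps_inv f)" by (rule fgl_iso_inverse[OF F F M_D(2)[OF f]])
  let ?g = "fps_inv f"
  have f0: "f $ 0 = 0" "f $ 1 \<noteq> 0" and g0: "?g $ 0 = 0" using M_D[OF f] by (simp_all add: fps_inv_nth_0)
  fix a assume a: "a \<in> A"
  have "?g oo act a = ?g oo (act a oo (f oo ?g))" using f0 by (simp add: fps_inv_right)
  also have "\<dots> = ?g oo ((act a oo f) oo ?g)" using f0 g0 by (simp add: fps_compose_assoc)
  also have "\<dots> = (?g oo f) oo (act a oo ?g)"
    unfolding M_D(4)[OF f a, symmetric] using f0 g0 act by (simp add: fps_compose_assoc)
  also have "\<dots> = act a oo ?g" using f0 act by (simp add: fps_inv)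
  finally show "?g oo act a = act a oo ?g" .
qed

private lemma M_X: "fps_X \<in> M"
  using act fgl_aut_X[OF F] by (intro M_I) (auto simp: fgl_aut_def)

private lemma conj_X: "conjugate_by \<phi> fps_X = fps_X"
  using \<phi>0 \<phi>\<psi> by (simp add: conj_eq)

theorem conjugate_formal_module_aut_subgroup:
  "subgroup (conjugate_by \<phi> ` formal_module_aut A F act) (fgl_aut_group H)"
  unfolding M_def[symmetric]
proof
  show "conjugate_by \<phi> ` M \<subseteq> carrier (fgl_aut_group H)"
    using conj_aut M_D by (auto simp: fgl_aut_group_def)
  show "\<one>\<^bsub>fgl_aut_group H\<^esub> \<in> conjugate_by \<phi> ` M"
    using M_X conj_X by (auto simp: fgl_aut_group_def intro!: image_eqI[of _ _ fps_X])
  fix x assume "x \<in> conjugate_by \<phi> ` M"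
  then obtain f where f: "f \<in> M" "x = conjugate_by \<phi> f" by auto
  have f0: "f $ 0 = 0" "f $ 1 \<noteq> 0" using M_D[OF f(1)] by simp_all
  {
    fix y assume "y \<in> conjugate_by \<phi> ` M"
    then obtain g where g: "g \<in> M" "y = conjugate_by \<phi> g" by auto
    show "x \<otimes>\<^bsub>fgl_aut_group H\<^esub> y \<in> conjugate_by \<phi> ` M"
      using conj_mult[OF f0(1) M_D(1)[OF g(1)]] M_compose[OF f(1) g(1)] f g by (auto simp: fgl_aut_group_def)
  }
  let ?y = "conjugate_by \<phi> (fps_inv f)"
  have y: "?y \<in> fgl_aut H" "x oo ?y = fps_X" "?y oo x = fps_X"
    using conj_aut[OF M_D(2)[OF M_inverse[OF f(1)]]] f0 conj_X
    by (simp_all add: f conj_mult fps_inv_nth_0 fps_inv fps_inv_right)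
  have x0: "x $ 0 = 0" "?y $ 0 = 0"
    using conj_aut[OF M_D(2)[OF f(1)]] y(1) by (auto simp: f fgl_aut_def fgl_iso_def)
  have "inv\<^bsub>fgl_aut_group H\<^esub> x = ?y"
    unfolding m_inv_def
  proof (rule the_equality)
    show "?y \<in> carrier (fgl_aut_group H) \<and> x \<otimes>\<^bsub>fgl_aut_group H\<^esub> ?y = \<one>\<^bsub>fgl_aut_group H\<^esub> \<and>
        ?y \<otimes>\<^bsub>fgl_aut_group H\<^esub> x = \<one>\<^bsub>fgl_aut_group H\<^esub>"
      using y by (simp add: fgl_aut_group_def)
    fix z assume z: "z \<in> carrier (fgl_aut_group H) \<and> x \<otimes>\<^bsub>fgl_aut_group H\<^esub> z = \<one>\<^bsub>fgl_aut_group H\<^esub> \<and>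
        z \<otimes>\<^bsub>fgl_aut_group H\<^esub> x = \<one>\<^bsub>fgl_aut_group H\<^esub>"
    then have z0: "z $ 0 = 0" "x oo z = fps_X" by (auto simp: fgl_aut_group_def fgl_aut_def fgl_iso_def)
    have "?y = ?y oo (x oo z)" using z0 by simp
    also have "\<dots> = (?y oo x) oo z" by (rule fps_compose_assoc[OF z0(1) x0(1)])
    also have "\<dots> = z" using y(3) z0 by simp
    finally show "z = ?y" by simp
  qed
  then show "inv\<^bsub>fgl_aut_group H\<^esub> x \<in> conjugate_by \<phi> ` M" using M_inverse[OF f(1)] by simp
qed

private lemma mem_conj_iff:
  assumes g: "g \<in> fgl_aut H"
  shows "g \<in> conjugate_by \<phi> ` M \<longleftrightarrow> (\<forall>a\<in>A. (\<psi> oo (g oo \<phi>)) oo act a = act a oo (\<psi> oo (g oo \<phi>)))"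
proof -
  have giso: "fgl_iso H H g" and g0: "g $ 0 = 0" using g by (auto simp: fgl_aut_def fgl_iso_def)
  let ?f = "\<psi> oo (g oo \<phi>)"
  have f: "fgl_iso F F ?f"
    by (rule fgl_iso_compose[OF F H F fgl_iso_compose[OF F H H \<phi> giso] \<phi>0(3)])
  have conj: "conjugate_by \<phi> ?f = g"
  proof -
    have "conjugate_by \<phi> ?f = \<phi> oo ((\<psi> oo (g oo \<phi>)) oo \<psi>)" using \<phi>0 by (simp add: conj_eq)
    also have "\<dots> = \<phi> oo (\<psi> oo (g oo (\<phi> oo \<psi>)))" using \<phi>0 g0 by (simp add: fps_compose_assoc)
    also have "\<dots> = g" using g0 by (simp add: \<phi>\<psi> cancel)
    finally show ?thesis .
  qed
  show ?thesis
  proof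
    assume "g \<in> conjugate_by \<phi> ` M"
    then obtain h where h: "h \<in> M" "g = conjugate_by \<phi> h" by auto
    have h0: "h $ 0 = 0" by (rule M_D(1)[OF h(1)])
    have "?f = \<psi> oo (\<phi> oo (h oo (\<psi> oo \<phi>)))" using \<phi>0 h0 by (simp add: h conj_eq fps_compose_assoc)
    also have "\<dots> = h" using h0 by (simp add: \<phi>\<psi> cancel)
    finally show "\<forall>a\<in>A. ?f oo act a = act a oo ?f" using M_D(4)[OF h(1)] by simp
  next
    assume "\<forall>a\<in>A. ?f oo act a = act a oo ?f"
    then have "?f \<in> M" by (intro M_I f) simp
    then show "g \<in> conjugate_by \<phi> ` M" using conj by (metis imageI)
  qed
qed

text \<open>
  Membership means that the automorphism \<open>\<psi> g \<phi>\<close> of \<open>F\<close>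
  commutes with every \<open>[a]\<close>. If this fails for some \<open>a\<close>, it fails
  in some degree \<open>N\<close>, and then it fails for all \<open>g\<close> with the same
  truncation at \<open>N\<close>. So the complement is open.
\<close>

theorem conjugate_formal_module_aut_closed:
  "closedin (fgl_aut_topology H) (conjugate_by \<phi> ` formal_module_aut A F act)"
proof -
  let ?S = "conjugate_by \<phi> ` M"
  define tr where "tr = (\<lambda>(f :: 'a fps) a. fps_cutoff (Suc a) f)"
  define X where "X = (\<lambda>a. discrete_topology (fps_cutoff (Suc a) ` fgl_aut H))"
  let ?T = "product_topology X UNIV"
  have topo: "fgl_aut_topology H = pullback_topology (fgl_aut H) tr ?T"
    by (simp add: fgl_aut_topology_def tr_def X_def)
  have tr_mem: "tr f \<in> topspace ?T" if "f \<in> fgl_aut H" for f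
    using that by (auto simp: tr_def X_def topspace_product_topology)
  have top: "topspace (fgl_aut_topology H) = fgl_aut H"
    unfolding topo topspace_pullback_topology using tr_mem by auto
  have S: "?S \<subseteq> fgl_aut H" using conj_aut M_D(2) by auto
  have "\<exists>N. \<forall>g\<in>fgl_aut H. fps_cutoff (Suc N) g = fps_cutoff (Suc N) f \<longrightarrow> g \<notin> ?S"
    if f: "f \<in> fgl_aut H - ?S" for f
  proof -
    let ?c = "\<lambda>g. \<psi> oo (g oo \<phi>)"
    obtain a where a: "a \<in> A" "?c f oo act a \<noteq> act a oo ?c f" using f mem_conj_iff[of f] by auto
    then obtain N where N: "(?c f oo act a) $ N \<noteq> (act a oo ?c f) $ N" by (auto simp: fps_eq_iff)
    have "g \<notin> ?S" if g: "g \<in> fgl_aut H" "fps_cutoff (Suc N) g = fps_cutoff (Suc N) f" for g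
    proof
      assume "g \<in> ?S"
      then have comm: "?c g oo act a = act a oo ?c g" using mem_conj_iff[OF g(1)] a(1) by blast
      have "g $ i = f $ i" if "i \<le> N" for i
        using g(2) that unfolding fps_cutoff_eq_fps_cutoff_iff by simp
      then have c: "?c g $ i = ?c f $ i" if "i \<le> N" for i
        using that by (intro fps_compose_nth_cong) auto
      have "(?c f oo act a) $ N = (?c g oo act a) $ N" by (rule fps_compose_nth_cong) (simp_all add: c)
      also have "\<dots> = (act a oo ?c f) $ N" unfolding comm by (rule fps_compose_nth_cong) (simp_all add: c)
      finally show False using N by simp
    qed
    then show ?thesis by blast
  qed
  then have "\<forall>f\<in>fgl_aut H - ?S. \<exists>N. \<forall>g\<in>fgl_aut H. fps_cutoff (Suc N) g = fps_cutoff (Suc N) f \<longrightarrow> g \<notin> ?S"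
    by blast
  from bchoice[OF this] obtain N where
    N: "\<forall>f\<in>fgl_aut H - ?S. \<forall>g\<in>fgl_aut H. fps_cutoff (Suc (N f)) g = fps_cutoff (Suc (N f)) f \<longrightarrow> g \<notin> ?S"
    by (rule exE)
  define U where "U = (\<Union>f\<in>fgl_aut H - ?S. {w \<in> topspace ?T. w (N f) \<in> {fps_cutoff (Suc (N f)) f}})"
  have "openin ?T U"
    unfolding U_def
  proof (intro openin_Union, clarify)
    fix f assume f: "f \<in> fgl_aut H" "f \<notin> ?S"
    have "openin (X (N f)) {fps_cutoff (Suc (N f)) f}" using f by (auto simp: X_def)
    then show "openin ?T {w \<in> topspace ?T. w (N f) \<in> {fps_cutoff (Suc (N f)) f}}"
      by (rule openin_continuous_map_preimage[OF continuous_map_product_projection[OF UNIV_I]])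
  qed
  moreover have "fgl_aut H - ?S = tr -` U \<inter> fgl_aut H"
  proof (intro equalityI subsetI)
    fix f assume f: "f \<in> fgl_aut H - ?S"
    then have "tr f \<in> {w \<in> topspace ?T. w (N f) \<in> {fps_cutoff (Suc (N f)) f}}"
      using tr_mem[of f] by (simp add: tr_def)
    then show "f \<in> tr -` U \<inter> fgl_aut H" using f unfolding U_def by blast
  next
    fix g assume g: "g \<in> tr -` U \<inter> fgl_aut H"
    then obtain f where "f \<in> fgl_aut H - ?S" "fps_cutoff (Suc (N f)) g = fps_cutoff (Suc (N f)) f"
      by (auto simp: U_def tr_def)
    then show "g \<in> fgl_aut H - ?S" using N g by blast
  qed
  ultimately have "openin (fgl_aut_topology H) (fgl_aut H - ?S)"
    unfolding topo openin_pullback_topology by blast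
  then show ?thesis unfolding closedin_def top M_def[symmetric] using S by simp
qed

end

end

section \<open>The residue field and the ramification degree\<close>

context padic_extension
begin

context
  fixes \<pi> :: 'K and e :: nat and red :: "'K \<Rightarrow> 'L::alg_closed_field"
  assumes \<pi>: "uniformizer A \<pi>" and e: "ramification_degree A CARD('p) \<pi> e"
    and red: "residue_map A \<pi> red"
begin

lemma \<pi>_mem: "\<pi> \<in> A"
  using \<pi> by (simp add: uniformizer_def)

text \<open>
  The number \<open>p\<close> is not a unit of \<open>A\<close>, and the uniformizer
  generates the ideal of non-units.
\<close>

lemma p_mem_ideal: "of_nat CARD('p) \<in> principal_ideal A \<pi>"
proof -
  have "\<not> (\<exists>b\<in>A. of_nat CARD('p) * b = 1)"
  proof
    assume "\<exists>b\<in>A. of_nat CARD('p) * b = 1"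
    then obtain b where b: "b \<in> A" "of_nat CARD('p) * b = 1" by blast
    then have "b = 1 / of_nat CARD('p)" using pK_nonzero by (simp add: field_simps)
    then show False using b(1) p_nonunit by simp
  qed
  then show ?thesis using \<pi> subring_of_nat[OF subring_A] by (auto simp: uniformizer_def)
qed

lemma \<pi>_nonzero: "\<pi> \<noteq> 0"
  using p_mem_ideal pK_nonzero by (auto simp: ideal_mem)

lemma subring_hom_red: "subring_hom A red"
  using red subring_A by (simp add: subring_hom_def residue_map_def)

interpretation red: subring_hom A red by (rule subring_hom_red)

lemma red_eq_0_iff: "a \<in> A \<Longrightarrow> red a = 0 \<longleftrightarrow> a \<in> principal_ideal A \<pi>"
  using red by (auto simp: residue_map_def)

lemma red_eq_iff: "a \<in> A \<Longrightarrow> b \<in> A \<Longrightarrow> red a = red b \<longleftrightarrow> a - b \<in> principal_ideal A \<pi>"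
  using red_eq_0_iff[of "a - b"] red.hom_diff[of a b] subring_diff[OF subring_A, of a b] by simp

lemma p_ideal_subset: "principal_ideal A (of_nat CARD('p)) \<subseteq> principal_ideal A \<pi>"
proof
  fix x assume "x \<in> principal_ideal A (of_nat CARD('p))"
  then obtain b where "b \<in> A" "x = of_nat CARD('p) * b" by (auto simp: ideal_mem)
  then show "x \<in> principal_ideal A \<pi>" using ideal_mult[OF p_mem_ideal, of b] by (simp add: mult.commute)
qed

lemma finite_residue_field: "finite (red ` A)"
proof -
  obtain S where S: "residue_system A (principal_ideal A (of_nat CARD('p))) S" using residue_system_p by blast
  have "red ` A \<subseteq> red ` S"
  proof
    fix y assume "y \<in> red ` A"
    then obtain a where a: "a \<in> A" "y = red a" by auto
    then obtain s where s: "s \<in> S" "a - s \<in> principal_ideal A (of_nat CARD('p))"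
      using S unfolding residue_system_def by blast
    then have "red a = red s" using a(1) S p_ideal_subset by (subst red_eq_iff) (auto simp: residue_system_def)
    then show "y \<in> red ` S" using a s by auto
  qed
  moreover have "finite S" using S by (simp add: residue_system_def)
  ultimately show ?thesis using finite_subset by blast
qed

text \<open>
  Representatives modulo \<open>\<pi>^(i + 1)\<close> are \<open>s + \<pi> t\<close>, with
  \<open>s\<close> from a set of lifts of the residue field and \<open>t\<close>
  representing \<open>A\<close> modulo \<open>\<pi>^i\<close>.
\<close>

lemma residue_system_uniformizer_power:
  "\<exists>S. residue_system A (principal_ideal A (\<pi> ^ i)) S \<and> card S = card (red ` A) ^ i"
proof (induction i)
  case 0
  have "a \<in> principal_ideal A (\<pi> ^ 0)" if "a \<in> A" for a using that by (auto simp: ideal_mem)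
  then show ?case using subring_0[OF subring_A] by (intro exI[of _ "{0}"]) (auto simp: residue_system_def)
next
  case (Suc i)
  then obtain T where T: "residue_system A (principal_ideal A (\<pi> ^ i)) T" "card T = card (red ` A) ^ i" by blast
  have TA: "finite T" "T \<subseteq> A" using T by (auto simp: residue_system_def)
  obtain s where s: "\<And>k. k \<in> red ` A \<Longrightarrow> s k \<in> A \<and> red (s k) = k"
  proof -
    have "\<forall>k\<in>red ` A. \<exists>a. a \<in> A \<and> red a = k" by auto
    from bchoice[OF this] show ?thesis using that by blast
  qed
  define f where "f = (\<lambda>(k, t). s k + \<pi> * t)"
  let ?D = "red ` A \<times> T"
  have f_A: "f x \<in> A" if "x \<in> ?D" for x
    using that s TA \<pi>_mem by (auto simp: f_def intro!: subring_add[OF subring_A] subring_mult[OF subring_A])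
  have key: "k = k' \<and> t = t'"
    if "k \<in> red ` A" "t \<in> T" "k' \<in> red ` A" "t' \<in> T" "a \<in> A"
      "a - f (k, t) \<in> principal_ideal A (\<pi> ^ Suc i)" "a - f (k', t') \<in> principal_ideal A (\<pi> ^ Suc i)"
    for a k t k' t'
  proof -
    note diff = that(6,7)
    obtain c where c: "c \<in> A" "a - (s k + \<pi> * t) = \<pi> ^ Suc i * c" using diff(1) by (auto simp: ideal_mem f_def)
    obtain c' where c': "c' \<in> A" "a - (s k' + \<pi> * t') = \<pi> ^ Suc i * c'" using diff(2) by (auto simp: ideal_mem f_def)
    have tA: "t \<in> A" "t' \<in> A" using that TA by auto
    define b where "b = t + \<pi> ^ i * c"
    define b' where "b' = t' + \<pi> ^ i * c'"
    have bA: "b \<in> A" "b' \<in> A"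
      unfolding b_def b'_def
      by (intro subring_add[OF subring_A] subring_mult[OF subring_A] subring_power[OF subring_A] tA c c' \<pi>_mem)+
    have as: "a - s k = \<pi> * b" "a - s k' = \<pi> * b'"
      using c(2) c'(2) by (simp_all add: b_def b'_def algebra_simps)
    have "red a = red (s k)" "red a = red (s k')"
      unfolding red_eq_iff[OF that(5) conjunct1[OF s[OF that(1)]]] red_eq_iff[OF that(5) conjunct1[OF s[OF that(3)]]] as
      by (rule ideal_multI[OF bA(1)] ideal_multI[OF bA(2)])+
    then have k: "k = k'" using s[OF that(1)] s[OF that(3)] by simp
    then have "\<pi> * b = \<pi> * b'" unfolding as[symmetric] by simp
    then have bb: "b = b'" using \<pi>_nonzero by simp
    have "b - t \<in> principal_ideal A (\<pi> ^ i)"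
      using ideal_multI[OF c(1), of "\<pi> ^ i"] by (simp add: b_def)
    moreover have "b - t' \<in> principal_ideal A (\<pi> ^ i)"
      unfolding bb using ideal_multI[OF c'(1), of "\<pi> ^ i"] by (simp add: b'_def)
    moreover have "\<exists>!t. t \<in> T \<and> b - t \<in> principal_ideal A (\<pi> ^ i)"
      using T(1) bA(1) by (simp add: residue_system_def)
    ultimately have "t = t'" using that(2,4) by (metis (full_types))
    with k show ?thesis by simp
  qed
  have inj: "inj_on f ?D"
  proof (rule inj_onI)
    fix x y assume xy: "x \<in> ?D" "y \<in> ?D" "f x = f y"
    obtain k t k' t' where kt: "x = (k, t)" "y = (k', t')" by (cases x, cases y)
    have "f x - f (k, t) \<in> principal_ideal A (\<pi> ^ Suc i)" "f x - f (k', t') \<in> principal_ideal A (\<pi> ^ Suc i)"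
      using xy(3) kt ideal_0 by simp_all
    then have "k = k' \<and> t = t'" using xy kt by (intro key[OF _ _ _ _ f_A[OF xy(1)]]) auto
    then show "x = y" using kt by simp
  qed
  have "residue_system A (principal_ideal A (\<pi> ^ Suc i)) (f ` ?D)"
    unfolding residue_system_def
  proof (intro conjI ballI)
    show "finite (f ` ?D)" using finite_residue_field TA by simp
    show "f ` ?D \<subseteq> A" using f_A by auto
    fix a assume a: "a \<in> A"
    let ?k = "red a"
    have k: "?k \<in> red ` A" using a by simp
    have "red a = red (s ?k)" using s[OF k] by simp
    then have "a - s ?k \<in> principal_ideal A \<pi>"
      using red_eq_iff[OF a conjunct1[OF s[OF k]]] by blast
    then obtain b where b: "b \<in> A" "a - s ?k = \<pi> * b" unfolding ideal_mem by blast
    obtain t where t: "t \<in> T" "b - t \<in> principal_ideal A (\<pi> ^ i)"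
      using T(1) b(1) unfolding residue_system_def by blast
    then obtain c where c: "c \<in> A" "b - t = \<pi> ^ i * c" by (auto simp: ideal_mem)
    have "a - f (?k, t) = \<pi> * (b - t)" using b(2) by (simp add: f_def algebra_simps)
    also have "\<dots> = \<pi> ^ Suc i * c" unfolding c(2) by simp
    finally have ft: "a - f (?k, t) \<in> principal_ideal A (\<pi> ^ Suc i)" using ideal_multI[OF c(1), of "\<pi> ^ Suc i"] by simp
    show "\<exists>!x. x \<in> f ` ?D \<and> a - x \<in> principal_ideal A (\<pi> ^ Suc i)"
    proof (rule ex1I[of _ "f (?k, t)"])
      show "f (?k, t) \<in> f ` ?D \<and> a - f (?k, t) \<in> principal_ideal A (\<pi> ^ Suc i)" using k t(1) ft by blast
      fix x assume x: "x \<in> f ` ?D \<and> a - x \<in> principal_ideal A (\<pi> ^ Suc i)"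
      then obtain k' t' where kt: "k' \<in> red ` A" "t' \<in> T" "x = f (k', t')" by auto
      have "?k = k' \<and> t = t'" by (rule key[OF k t(1) kt(1,2) a ft]) (use x kt in simp)
      then show "x = f (?k, t)" using kt by simp
    qed
  qed
  moreover have "card (f ` ?D) = card (red ` A) ^ Suc i"
    using T(2) by (simp add: card_image[OF inj] card_cartesian_product)
  ultimately show ?case by blast
qed

text \<open>
  Both sides count \<open>A\<close> modulo the ideal generated by \<open>p\<close>, which is
  also generated by \<open>\<pi>^e\<close>.
\<close>

theorem residue_degree: "card (red ` A) ^ e = CARD('p) ^ d"
proof -
  obtain S where S: "residue_system A (principal_ideal A (of_nat CARD('p))) S" "card S = CARD('p) ^ d"
    using residue_system_p by blast
  obtain T where T: "residue_system A (principal_ideal A (\<pi> ^ e)) T" "card T = card (red ` A) ^ e"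
    using residue_system_uniformizer_power by blast
  have "principal_ideal A (of_nat CARD('p)) = principal_ideal A (\<pi> ^ e)"
    using e by (simp add: ramification_degree_def)
  then have "residue_system A (principal_ideal A (of_nat CARD('p))) T" using T(1) by simp
  from residue_system_card_eq[OF ideal_diff S(1) this] show ?thesis using S(2) T(2) by simp
qed

text \<open>
  The product over the nonzero elements of the finite residue field is unchanged when each
  of them is multiplied by \<open>x \<noteq> 0\<close>.
\<close>

lemma residue_field_power:
  assumes "x \<in> red ` A" shows "x ^ card (red ` A) = x"
proof (cases "x = 0")
  case True
  have "card (red ` A) > 0" using assms finite_residue_field by (auto simp: card_gt_0_iff)
  then show ?thesis using True by (simp add: zero_power)
next
  case False
  let ?k = "red ` A"
  let ?u = "?k - {0}"
  have zero: "0 \<in> ?k" using red.hom_0 subring_0[OF subring_A] by (metis imageI)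
  have fin: "finite ?u" using finite_residue_field by simp
  have closed: "x * y \<in> ?k" if "y \<in> ?k" for y
    using that assms subring_mult[OF subring_A] by (auto simp: red.hom_mult[symmetric])
  have "(*) x ` ?u = ?u"
  proof (rule card_subset_eq[OF fin])
    show "(*) x ` ?u \<subseteq> ?u" using closed False by auto
    show "card ((*) x ` ?u) = card ?u" using False by (intro card_image inj_onI) auto
  qed
  then have "\<Prod>?u = (\<Prod>y\<in>(*) x ` ?u. y)" by simp
  also have "\<dots> = (\<Prod>y\<in>?u. x * y)" using False by (subst prod.reindex) (auto simp: inj_on_def)
  also have "\<dots> = x ^ card ?u * \<Prod>?u" by (simp add: prod.distrib)
  finally have "x ^ card ?u = 1" using fin by (simp add: prod_zero_iff)
  moreover have "card ?k = Suc (card ?u)" using zero finite_residue_field by (metis card_Suc_Diff1)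
  ultimately show ?thesis by simp
qed

lemma residue_card_prime_power:
  obtains f where "f > 0" "card (red ` A) = CARD('p) ^ f"
proof -
  have p: "prime CARD('p)" by (rule prime_card)
  let ?q = "card (red ` A)"
  have pd: "1 < CARD('p) ^ d" by (rule one_less_power[OF prime_gt_1_nat[OF p] d_pos])
  have "e \<noteq> 0" using residue_degree pd by (metis less_irrefl power_0)
  then have "?q dvd ?q ^ e" by (simp add: dvd_power)
  then have "?q dvd CARD('p) ^ d" by (simp only: residue_degree)
  then obtain f where f: "?q = CARD('p) ^ f" using divides_primepow_nat[OF p] by blast
  have "f \<noteq> 0"
  proof
    assume "f = 0"
    then have "1 = CARD('p) ^ d" using f residue_degree by simp
    then show False using pd by linarith
  qed
  then show ?thesis using that f by simp
qed

lemma infinite_K: "infinite (UNIV :: 'K set)"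
proof -
  have nz: "(of_nat n :: 'K) \<noteq> 0" if "n > 0" for n
  proof
    assume "(of_nat n :: 'K) = 0"
    then have "(of_nat n :: 'p padic_int) = 0" using j_of_nat[of n] j_eq_0_iff by simp
    then have "int n mod int CARD('p) ^ n = 0" using Rep_padic_of_nat[of n n, where 'p = 'p] by (simp add: Rep_padic_0)
    moreover have "n < CARD('p) ^ n" using prime_gt_1_nat[OF prime_card[where 'a = 'p]] by (simp add: power_gt_expt)
    then have "int n < int CARD('p) ^ n" by (metis of_nat_less_iff of_nat_power)
    ultimately show False using that by simp
  qed
  have "inj (of_nat :: nat \<Rightarrow> 'K)"
  proof (rule injI)
    fix a b :: nat assume eq: "(of_nat a :: 'K) = of_nat b"
    show "a = b"
    proof (rule ccontr)
      assume "a \<noteq> b"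
      then consider "a < b" | "b < a" by linarith
      then show False using nz[of "b - a"] nz[of "a - b"] eq by cases (auto simp: of_nat_diff)
    qed
  qed
  then show ?thesis using infinite_UNIV_nat finite_subset[OF subset_UNIV] finite_imageD by blast
qed

lemma lubin_tate_ring_of_integers:
  assumes "n > 0" "card (red ` A) = CARD('p) ^ f" "f > 0"
  shows "lubin_tate A \<pi> red CARD('p) (f * n)"
proof (rule lubin_tate.intro)
  show "subring_hom A red" by (rule subring_hom_red)
  show "\<pi> \<in> A" "\<pi> \<noteq> 0" by (rule \<pi>_mem \<pi>_nonzero)+
  show "red \<pi> = 0" using red_eq_0_iff[OF \<pi>_mem] ideal_multI[OF subring_1[OF subring_A], of \<pi>] by simp
  show "prime CARD('p)" by (rule prime_card)
  obtain c where "c \<in> A" "(of_nat CARD('p) :: 'K) = \<pi> * c" using p_mem_ideal by (auto simp: ideal_mem)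
  then show "cong_pow A \<pi> 1 (of_nat CARD('p)) 0" by (intro cong_powI[of c]) simp_all
  show "0 < f * n" using assms by simp
  show "infinite (UNIV :: 'K set)" by (rule infinite_K)
  fix a assume a: "a \<in> A"
  have aA: "a ^ m \<in> A" for m by (rule subring_power[OF subring_A a])
  have "red a ^ (card (red ` A) ^ m) = red a" for m
  proof (induction m)
    case (Suc m)
    have "red a ^ (card (red ` A) ^ Suc m) = (red a ^ (card (red ` A) ^ m)) ^ card (red ` A)"
      by (simp only: power_mult[symmetric] power_Suc mult.commute)
    also have "\<dots> = red a" unfolding Suc by (rule residue_field_power) (use a in simp)
    finally show ?case .
  qed simp
  from this[of n] have "red (a ^ (CARD('p) ^ (f * n))) = red a"
    using a by (simp add: red.hom_power assms(2) power_mult)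
  then have "a ^ (CARD('p) ^ (f * n)) - a \<in> principal_ideal A \<pi>" using red_eq_iff[OF aA a] by blast
  then show "cong_pow A \<pi> 1 (a ^ (CARD('p) ^ (f * n))) a" by (auto simp: cong_pow_def ideal_mem)
qed

lemma red_of_p: "red (of_nat CARD('p)) = 0"
  using red_eq_0_iff[OF subring_of_nat[OF subring_A]] p_mem_ideal by blast

lemma CHAR_residue: "CHAR('L) = CARD('p)"
proof -
  have "of_nat CARD('p) = (0::'L)" using red_of_p by (simp only: red.hom_of_nat)
  then have "CHAR('L) dvd CARD('p)" by (simp only: of_nat_eq_0_iff_char_dvd)
  moreover have "CHAR('L) \<noteq> 1" by (metis of_nat_1 of_nat_CHAR zero_neq_one)
  ultimately show ?thesis using prime_card[where 'a = 'p] by (auto simp: prime_nat_iff)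
qed

text \<open>
  Modulo \<open>p\<close>, a \<open>p\<close>-adic integer is a natural number, for which
  this is Fermat's little theorem; that in turn is taken from the residue field, which has
  characteristic \<open>p\<close>.
\<close>

lemma padic_int_frobenius: "of_nat CARD('p) dvd ((z :: 'p padic_int) ^ (CARD('p) ^ m) - z)"
proof (induction m)
  case (Suc m)
  let ?p = "CARD('p)"
  have one: "of_nat ?p dvd ((y :: 'p padic_int) ^ ?p - y)" for y
  proof -
    define l where "l = nat (Rep_padic_int y 1)"
    have l: "Rep_padic_int y 1 = int l" using Rep_padic_range[of y 1] by (simp add: l_def)
    obtain t where "y = of_int (Rep_padic_int y 1) + of_nat ?p ^ 1 * t" using padic_split by blast
    then have y: "y = of_nat l + of_nat ?p * t" by (simp only: l power_one_right of_int_of_nat_eq)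
    have "(of_int (int l ^ ?p - int l) :: 'L) = 0"
      using frobenius_of_nat[OF prime_card CHAR_residue, of l 1] by simp
    then have "int ?p dvd int l ^ ?p - int l" by (simp only: of_int_eq_0_iff_char_dvd CHAR_residue)
    then have "of_nat ?p dvd (of_int (int l ^ ?p - int l) :: 'p padic_int)" by (simp only: of_int_p_dvd)
    then have "of_nat ?p dvd ((of_nat l :: 'p padic_int) ^ ?p - of_nat l)" by simp
    moreover have "of_nat ?p dvd y ^ ?p - of_nat l ^ ?p"
    proof -
      have "y - of_nat l dvd y ^ ?p - of_nat l ^ ?p" by (simp add: power_diff_sumr2)
      moreover have "of_nat ?p dvd y - of_nat l" by (simp add: y)
      ultimately show ?thesis by (rule dvd_trans[rotated])
    qed
    moreover have "of_nat ?p dvd of_nat l - y" by (simp add: y)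
    ultimately have "of_nat ?p dvd (y ^ ?p - of_nat l ^ ?p) + (of_nat l ^ ?p - of_nat l) + (of_nat l - y)"
      by (intro dvd_add)
    then show ?thesis by simp
  qed
  have "of_nat ?p dvd ((z ^ (?p ^ m)) ^ ?p - z ^ (?p ^ m)) + (z ^ (?p ^ m) - z)"
    by (intro dvd_add one Suc)
  then show ?case by (simp add: power_mult[symmetric] mult.commute)
qed simp

lemma lubin_tate_padic_integers:
  assumes "m > 0"
  shows "lubin_tate (padic_integers :: 'p padic set) (of_nat CARD('p)) (\<lambda>x. red (\<iota> x)) CARD('p) m"
proof -
  have mem: "Fract z 1 \<in> padic_integers" for z :: "'p padic_int" by (simp add: padic_integers_def)
  have of_nat: "(of_nat k :: 'p padic) = Fract (of_nat k) 1" for k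
    by (induction k) (simp_all add: Zero_fract_def One_fract_def add_fract[of 1 1, simplified])
  have sub: "is_subring (padic_integers :: 'p padic set)"
    unfolding is_subring_def padic_integers_def by (auto simp: One_fract_def)
  have red_j: "red (\<iota> (Fract z 1)) = red (j z)" for z by (simp add: j_def)
  show ?thesis
  proof (rule lubin_tate.intro)
    show "subring_hom padic_integers (\<lambda>x. red (\<iota> x))"
    proof (rule subring_hom.intro)
      show "red (\<iota> 1) = 1" by (simp add: red.hom_1)
      fix a b :: "'p padic" assume "a \<in> padic_integers" "b \<in> padic_integers"
      then have "\<iota> a \<in> A" "\<iota> b \<in> A" using j_mem by (auto simp: padic_integers_def j_def)
      then show "red (\<iota> (a + b)) = red (\<iota> a) + red (\<iota> b)" "red (\<iota> (a * b)) = red (\<iota> a) * red (\<iota> b)"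
        by (simp_all add: iota.hom_add iota.hom_mult red.hom_add red.hom_mult)
    qed (rule sub)
    show "of_nat CARD('p) \<in> (padic_integers :: 'p padic set)" by (rule subring_of_nat[OF sub])
    have io: "\<iota> (of_nat CARD('p)) = of_nat CARD('p)" using j_of_nat[of "CARD('p)"] by (simp add: j_def of_nat)
    show "red (\<iota> (of_nat CARD('p))) = 0" using red_of_p by (simp only: io)
    show "(of_nat CARD('p) :: 'p padic) \<noteq> 0" using io pK_nonzero iota.hom_zero by metis
    show "prime CARD('p)" by (rule prime_card)
    show "cong_pow (padic_integers :: 'p padic set) (of_nat CARD('p)) 1 (of_nat CARD('p)) 0"
      by (rule cong_powI[OF subring_1[OF sub]]) simp
    show "0 < m" by (rule assms)
    show "infinite (UNIV :: 'p padic set)"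
    proof
      assume fin: "finite (UNIV :: 'p padic set)"
      have "inj (\<lambda>n. of_nat n :: 'p padic)"
      proof (rule injI)
        fix a b :: nat assume "(of_nat a :: 'p padic) = of_nat b"
        then have eq: "(of_nat a :: 'p padic_int) = of_nat b" by (simp add: of_nat eq_fract)
        have "int a mod int CARD('p) ^ k = int b mod int CARD('p) ^ k" for k
          using arg_cong[OF eq, of "\<lambda>z. Rep_padic_int z k"] by (simp add: Rep_padic_of_nat)
        then have "int a mod int CARD('p) ^ (a + b) = int b mod int CARD('p) ^ (a + b)" .
        moreover have lt: "a + b < CARD('p) ^ (a + b)"
          using prime_gt_1_nat[OF prime_card[where 'a = 'p]] by (simp add: power_gt_expt)
        then have "int (a + b) < int CARD('p) ^ (a + b)" by (metis of_nat_less_iff of_nat_power)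
        then have "int a mod int CARD('p) ^ (a + b) = int a" "int b mod int CARD('p) ^ (a + b) = int b"
          by (intro mod_pos_pos_trivial; linarith)+
        ultimately have "int a = int b" by metis
        then show "a = b" by simp
      qed
      then have "infinite (range (\<lambda>n. of_nat n :: 'p padic))" using range_inj_infinite by blast
      then show False using finite_subset[OF subset_UNIV fin] by simp
    qed
    fix a :: "'p padic" assume "a \<in> padic_integers"
    then obtain z where z: "a = Fract z 1" by (auto simp: padic_integers_def)
    obtain t where t: "z ^ (CARD('p) ^ m) - z = of_nat CARD('p) * t" using padic_int_frobenius[of z m] by blast
    have pow: "Fract z 1 ^ k = Fract (z ^ k) 1" for k by (induction k) (simp_all add: One_fract_def)
    have "a ^ (CARD('p) ^ m) - a = Fract (z ^ (CARD('p) ^ m) - z) 1" by (simp add: z pow)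
    also have "\<dots> = of_nat CARD('p) * Fract t 1" by (simp add: t of_nat)
    finally show "cong_pow padic_integers (of_nat CARD('p)) 1 (a ^ (CARD('p) ^ m)) a"
      by (intro cong_powI[OF mem[of t]]) simp
  qed
qed

end

end

section \<open>The stabilizer subgroup of the formal module\<close>

lemma scale2_1: "scale2 1 F = F"
  by (simp add: scale2_def fps_eq_iff)

lemma scale1_compose_X_power:
  fixes g :: "'a::field fps"
  assumes b: "b \<noteq> 0" and g: "g $ 0 = 0" and P: "P > 0"
  shows "scale1 b (g oo fps_X ^ P) = Abs_fps (\<lambda>i. 1 / b * b ^ (P * i) * g $ i) oo fps_X ^ P"
proof (rule fps_ext)
  fix k
  show "scale1 b (g oo fps_X ^ P) $ k = (Abs_fps (\<lambda>i. 1 / b * b ^ (P * i) * g $ i) oo fps_X ^ P) $ k"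
  proof (cases "P dvd k \<and> k > 0")
    case True
    then show ?thesis using power_diff_1[OF b, of k] P
      by (simp add: scale1_def fps_compose_X_power_nth[OF P])
  next
    case False
    then show ?thesis using g by (auto simp: scale1_def fps_compose_X_power_nth[OF P])
  qed
qed

theorem theorem5p1:
  fixes \<iota> :: "'p::prime_card padic \<Rightarrow> 'K::field"
    and A :: "'K set" and \<pi> :: 'K
    and red :: "'K \<Rightarrow> 'L::alg_closed_field"
    and \<omega> :: 'L and d e q n :: nat
    and F H :: "'L fps fps"
  assumes K: "padic_extension_of_degree \<iota> d"
    and A: "A = ring_of_integers \<iota>"
    and \<pi>: "uniformizer A \<pi>"
    and e: "ramification_degree A CARD('p) \<pi> e"
    and k: "residue_map A \<pi> red"
    and q: "q = card (red ` A)"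
    and n: "n > 0"
    and \<omega>: "\<omega> ^ ((q ^ (e * n) - 1) div (q ^ n - 1)) = red (\<pi> ^ e / of_nat CARD('p))"
    and F: "F = G_fgl \<pi> q red n \<omega>"
    and H: "H = G_fgl (of_nat CARD('p) :: 'p padic) CARD('p) (\<lambda>x. red (\<iota> x)) (d * n) 1"
  shows "(\<exists>\<phi>. strict_fgl_iso F H \<phi>) \<and>
    (\<forall>\<phi>. strict_fgl_iso F H \<phi> \<longrightarrow>
      (let S = conjugate_by \<phi> ` formal_module_aut A F (G_action \<pi> q red n \<omega>)
       in subgroup S (fgl_aut_group H) \<and> closedin (fgl_aut_topology H) S))"
proof -
  interpret E: padic_extension \<iota> d by unfold_locales (rule K)
  have A_eq: "E.A = A" by (simp add: E.A_def A)
  let ?p = "CARD('p)"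
  have p: "prime ?p" by (rule prime_card)
  note ctx = \<pi>[folded A_eq] e[folded A_eq] k[folded A_eq]
  obtain f where f: "f > 0" "q = ?p ^ f"
    using E.residue_card_prime_power[OF ctx] unfolding A_eq q by blast
  have dn: "d * n > 0" using E.d_pos n by simp
  interpret LT: lubin_tate A \<pi> red ?p "f * n"
    using E.lubin_tate_ring_of_integers[OF ctx n _ f(1)] f(2) q unfolding A_eq by simp
  interpret LP: lubin_tate "padic_integers :: 'p padic set" "of_nat ?p" "\<lambda>x. red (\<iota> x)" ?p "d * n"
    by (rule E.lubin_tate_padic_integers[OF ctx dn])
  have Q: "?p ^ (f * n) = q ^ n" by (simp add: f(2) power_mult)
  have P: "(?p ^ (f * n)) ^ e = ?p ^ (d * n)"
  proof -
    have "q ^ e = ?p ^ d" using E.residue_degree[OF ctx] unfolding A_eq q .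
    then have "(q ^ e) ^ n = (?p ^ d) ^ n" by simp
    then show ?thesis unfolding Q power_mult[symmetric] by (simp add: mult.commute)
  qed
  have q2: "q \<ge> 2" using f prime_ge_2_nat[OF p] self_le_power[of ?p f] by simp
  have qn2: "q ^ n \<ge> 2" using LT.Q_ge_2 unfolding Q .
  have P2: "?p ^ (d * n) \<ge> 2" using LP.Q_ge_2 .

  \<comment> \<open>Both \<open>v\<close> and its inverse \<open>w\<close> lie in
  \<open>A\<close>, because \<open>p\<close> and \<open>\<pi>^e\<close> generate the same
  ideal.\<close>
  define v where "v = \<pi> ^ e / of_nat ?p"
  define w where "w = of_nat ?p / \<pi> ^ e"
  have p0: "(of_nat ?p :: 'K) \<noteq> 0" by (rule E.pK_nonzero)
  have \<pi>e0: "\<pi> ^ e \<noteq> 0" using LT.\<pi> by simp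
  have ideals: "principal_ideal A (of_nat ?p) = principal_ideal A (\<pi> ^ e)"
    using e by (simp add: ramification_degree_def)
  have sub: "is_subring A" by (rule LT.red.subring)
  have vA: "v \<in> A"
  proof -
    have "\<pi> ^ e \<in> principal_ideal A (of_nat ?p)"
      unfolding ideals using subring_1[OF sub] by (force simp: principal_ideal_def)
    then show ?thesis using p0 by (auto simp: principal_ideal_def v_def)
  qed
  have wA: "w \<in> A"
  proof -
    have "of_nat ?p \<in> principal_ideal A (\<pi> ^ e)"
      unfolding ideals[symmetric] using subring_1[OF sub] by (force simp: principal_ideal_def)
    then show ?thesis using \<pi>e0 by (auto simp: principal_ideal_def w_def)
  qed
  have vw: "red v * red w = 1"
  proof -
    have "v * w = 1" using p0 \<pi>e0 by (simp add: v_def w_def)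
    then show ?thesis using LT.red.hom_mult[OF vA wA] LT.red.hom_1 by simp
  qed

  \<comment> \<open>The exponent in the hypothesis on \<open>\<omega>\<close>. Truncated
  division loses nothing, since \<open>q^n - 1\<close> divides \<open>q^(e n) -
  1\<close>.\<close>
  define M where "M = (q ^ (e * n) - 1) div (q ^ n - 1)"
  have qen: "q ^ (e * n) = ?p ^ (d * n)" using P unfolding Q by (simp add: power_mult[symmetric] mult.commute)
  have M: "(q ^ n - 1) * M = ?p ^ (d * n) - 1"
  proof -
    have "int (q ^ n) - 1 dvd int (q ^ n) ^ e - 1"
      using power_diff_sumr2[of "int (q ^ n)" e 1] by simp
    then have "int (q ^ n - 1) dvd int (q ^ (e * n) - 1)"
      using qn2 q2 by (simp add: of_nat_diff power_mult[symmetric] mult.commute)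
    then have "q ^ n - 1 dvd q ^ (e * n) - 1" by (simp only: of_nat_dvd_iff)
    then show ?thesis unfolding M_def qen by simp
  qed
  have M0: "M > 0" using M P2 by (cases M) auto
  have \<omega>M: "\<omega> ^ M = red v" using \<omega> by (simp add: M_def v_def)
  have \<omega>0: "\<omega> \<noteq> 0"
  proof
    assume "\<omega> = 0"
    then have "red v = 0" using \<omega>M M0 by (simp add: zero_power)
    then show False using vw by simp
  qed
  \<comment> \<open>With this root, \<open>F\<close> is the rescaling by \<open>b\<close> of
  the reduced formal module of Lubin--Tate type.\<close>
  obtain b where b: "b ^ (q ^ n - 1) = \<omega>"
    using nth_root_exists[of "q ^ n - 1" \<omega>] qn2 by auto
  have b0: "b \<noteq> 0" using b \<omega>0 qn2 by (auto simp: zero_power)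
  \<comment> \<open>This is where the hypothesis on \<open>\<omega>\<close> enters: it makes
  the leading coefficient of the multiplication by \<open>p\<close> on \<open>F\<close>
  equal to \<open>1\<close>.\<close>
  have bP: "b ^ (?p ^ (d * n) - 1) * red w = 1"
    using vw power_mult[of b "q ^ n - 1" M] by (simp only: M b \<omega>M)

  have F_eq: "F = scale2 b LT.fgl_red"
    using G_fgl_eq_scale2[where red = red and \<pi> = \<pi> and b = b, OF LT.infinite_K LT.red.hom_0 q2 n]
    unfolding F b LT.fgl_red_def LT.fgl_def LT.lg_def Q .
  have act_eq: "G_action \<pi> q red n \<omega> a = scale1 b (LT.act_red a)" for a
    using G_action_eq_scale1[where red = red and \<pi> = \<pi> and b = b, OF LT.infinite_K LT.red.hom_0 q2 n]
    unfolding b LT.act_red_def LT.act_def LT.lg_def Q .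
  have H_eq: "H = LP.fgl_red"
    using G_fgl_eq_scale2[where red = "\<lambda>x. red (\<iota> x)" and \<pi> = "of_nat ?p :: 'p padic" and b = 1,
        OF LP.infinite_K LP.red.hom_0 prime_ge_2_nat[OF p] dn]
    unfolding H LP.fgl_red_def LP.fgl_def LP.lg_def power_one scale2_1 .
  have F_fgl: "is_fgl F" unfolding F_eq by (rule is_fgl_scale2[OF b0 LT.is_fgl_red])
  have H_fgl: "is_fgl H" unfolding H_eq by (rule LP.is_fgl_red)

  \<comment> \<open>Multiplication by \<open>p = w \<pi>^e\<close> on the unscaled module is
  \<open>[w]\<close> composed with \<open>x^(Q^e)\<close>, where \<open>Q^e = p^(d
  n)\<close>. The series \<open>T\<close> arises from \<open>[w]\<close> by passing to the
  rescaled module.\<close>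
  define T where "T = Abs_fps (\<lambda>i. 1 / b * b ^ (?p ^ (d * n) * i) * LT.act_red w $ i)"
  have T0: "T $ 0 = 0" by (simp add: T_def LT.act_red_0)
  have T1: "T $ 1 = 1"
    using bP power_diff_1[OF b0, of "?p ^ (d * n)"] P2 LT.act_red_nth_1[of w] by (simp add: T_def)
  have mult_F: "fgl_multiple F ?p fps_X = T oo fps_X ^ (?p ^ (d * n))"
  proof -
    have "of_nat ?p = w * \<pi> ^ e" using \<pi>e0 by (simp add: w_def)
    then have "LT.act_red (of_nat ?p) = LT.act_red w oo LT.act_red (\<pi> ^ e)"
      using LT.act_red_mult[OF wA subring_power[OF sub LT.\<pi>(1)]] by simp
    also have "LT.act_red (\<pi> ^ e) = fps_X ^ (?p ^ (d * n))"
      unfolding LT.act_red_uniformizer_power P ..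
    finally have "fgl_multiple F ?p fps_X = scale1 b (LT.act_red w oo fps_X ^ (?p ^ (d * n)))"
      unfolding F_eq fgl_multiple_scale2[OF b0 LT.is_fgl_red] LT.fgl_multiple_red by simp
    also have "\<dots> = T oo fps_X ^ (?p ^ (d * n))"
      unfolding T_def by (rule scale1_compose_X_power[OF b0 LT.act_red_0]) (use P2 in simp)
    finally show ?thesis .
  qed
  have mult_H: "fgl_multiple H ?p fps_X = fps_X ^ (?p ^ (d * n))"
    unfolding H_eq LP.fgl_multiple_red using LP.act_red_uniformizer_power[of 1] by simp
  have "\<exists>\<phi>. strict_fgl_iso F H \<phi>"
    by (rule exists_strict_iso[OF p E.CHAR_residue[OF ctx] dn F_fgl H_fgl T0 T1 mult_F mult_H])
  moreover have "subgroup (conjugate_by \<phi> ` formal_module_aut A F (G_action \<pi> q red n \<omega>)) (fgl_aut_group H)"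
    "closedin (fgl_aut_topology H) (conjugate_by \<phi> ` formal_module_aut A F (G_action \<pi> q red n \<omega>))"
    if "strict_fgl_iso F H \<phi>" for \<phi>
  proof -
    have act0: "G_action \<pi> q red n \<omega> a $ 0 = 0" for a
      unfolding act_eq by (rule scale1_nth_0_1(1)[OF LT.act_red_0])
    have iso: "fgl_iso F H \<phi>" using that by (simp add: strict_fgl_iso_def)
    show "subgroup (conjugate_by \<phi> ` formal_module_aut A F (G_action \<pi> q red n \<omega>)) (fgl_aut_group H)"
      by (rule conjugate_formal_module_aut_subgroup[OF fgl_0_0[OF F_fgl] fgl_0_0[OF H_fgl] act0 iso])
    show "closedin (fgl_aut_topology H) (conjugate_by \<phi> ` formal_module_aut A F (G_action \<pi> q red n \<omega>))"
      by (rule conjugate_formal_module_aut_closed[OF fgl_0_0[OF F_fgl] fgl_0_0[OF H_fgl] act0 iso])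
  qed
  ultimately show ?thesis by (simp add: Let_def)
qed

end
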